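(* Let $(A,\pi A,F)$ be a complete discrete valuation ring of mixed characteristic $(0,p)$ with finite residue field $F=A/\pi A$ and quotient field $K$. Let $R=A[X_1,\ldots,X_n]$ be standard $\mathbb{N}^n$-graded, let $I$ be a $\mathfrak{C}$-monomial ideal of $R$, let $i\ge 0$, and let $M=H^i_I(R)=\bigoplus_{\underline{u}\in\mathbb{Z}^n}M_{\underline{u}}$. For each $\underline{u}\in\mathbb{Z}^n$ let $a(\underline{u}),b(\underline{u})\ge 0$ be the finite numbers with $$\frac{M_{\underline{u}}}{\Gamma_\pi(M_{\underline{u}})}\cong A^{a(\underline{u})}\oplus K^{b(\underline{u})}$$ as $A$-modules. Then for each subset $U\subseteq\{1,\ldots,n\}$ the functions $\underline{u}\mapsto a(\underline{u})$ and $\underline{u}\mapsto b(\underline{u})$ are constant on the block $\mathcal{B}(U)$.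
   Context: Standard $\mathbb{N}^n$-grading: $\deg a=\underline{0}$ for $a\in A$ and $\deg X_j=e_j$, the $j$-th standard basis vector. An ideal $I$ of $R$ is $\mathfrak{C}$-monomial if it can be generated by elements of the form $a\,m$, where $a\in A$ (not necessarily a unit) and $m$ is a monomial in $X_1,\ldots,X_n$. For such $I$ the local cohomology module $H^i_I(R)$ carries a natural $\mathbb{Z}^n$-grading, and $M_{\underline{u}}$ denotes its component (an $A$-module) of degree $\underline{u}$. For an $A$-module $N$, $\Gamma_\pi(N)=\{x\in N:\pi^k x=0\text{ for some }k\ge 0\}$. Recalled from earlier work (may be taken as known): for each $\underline{u}$ there are finite numbers $a(\underline{u}),b(\underline{u})\geq 0$ such that $M_{\underline{u}}/\Gamma_\pi(M_{\underline{u}})\cong A^{a(\underline{u})}\oplus K^{b(\underline{u})}$. Blocks: for $U\subseteq\{1,\ldots,n\}$, $\mathcal{B}(U)=\{\underline{u}\in\mathbb{Z}^n: u_k\ge 0\text{ if }k\in U,\ u_k\le -1\text{ if }k\notin U\}$. *)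

theory Defs
  imports
    "HOL-Algebra.Algebra"
    "HOL-Algebra.Algebraic_Closure_Type"
    "HOL-Computational_Algebra.Fraction_Field"
    "HOL-Library.Poly_Mapping"
begin

abbreviation type_ring :: "'a::comm_ring_1 ring" where
  "type_ring \<equiv> ring_of_type_algebra"

definition discrete_valuation_ring :: "'a::idom \<Rightarrow> bool" where
  "discrete_valuation_ring \<pi> \<longleftrightarrow>
     principal_domain (type_ring :: 'a ring) \<and> \<not> field (type_ring :: 'a ring) \<and>
     {J. maximalideal J (type_ring :: 'a ring)} = {PIdl\<^bsub>type_ring\<^esub> \<pi>}"

text \<open>The map from the ring to the inverse limit of its quotients by powers of \<open>\<pi>\<close> is bijective;
  a compatible system of residues is given by representatives \<open>s k\<close>.\<close>

definition adically_complete :: "'a::comm_ring_1 \<Rightarrow> bool" where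
  "adically_complete \<pi> \<longleftrightarrow>
     (\<forall>x. (\<forall>k. \<pi> ^ k dvd x) \<longrightarrow> x = 0) \<and>
     (\<forall>s :: nat \<Rightarrow> 'a. (\<forall>k. \<pi> ^ k dvd s (Suc k) - s k) \<longrightarrow> (\<exists>l. \<forall>k. \<pi> ^ k dvd l - s k))"

definition residue_ring_of :: "'a::comm_ring_1 \<Rightarrow> 'a set ring" where
  "residue_ring_of \<pi> = type_ring Quot (PIdl\<^bsub>type_ring\<^esub> \<pi>)"

definition mixed_characteristic :: "'a::comm_ring_1 \<Rightarrow> nat \<Rightarrow> bool" where
  "mixed_characteristic \<pi> p \<longleftrightarrow>
     CHAR('a) = 0 \<and> Factorial_Ring.prime p \<and>
     (\<forall>m::nat. add_pow (residue_ring_of \<pi>) m \<one>\<^bsub>residue_ring_of \<pi>\<^esub> = \<zero>\<^bsub>residue_ring_of \<pi>\<^esub>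
        \<longleftrightarrow> p dvd m)"

definition mod_hom ::
    "('r, 'x) ring_scheme \<Rightarrow> ('r, 'm, 'y) module_scheme \<Rightarrow> ('r, 'k, 'z) module_scheme \<Rightarrow> ('m \<Rightarrow> 'k) set"
  where
  "mod_hom R M N = {f \<in> carrier M \<rightarrow> carrier N.
     (\<forall>x\<in>carrier M. \<forall>y\<in>carrier M. f (x \<oplus>\<^bsub>M\<^esub> y) = f x \<oplus>\<^bsub>N\<^esub> f y) \<and>
     (\<forall>r\<in>carrier R. \<forall>x\<in>carrier M. f (r \<odot>\<^bsub>M\<^esub> x) = r \<odot>\<^bsub>N\<^esub> f x)}"

definition mod_iso ::
    "('r, 'x) ring_scheme \<Rightarrow> ('r, 'm, 'y) module_scheme \<Rightarrow> ('r, 'k, 'z) module_scheme \<Rightarrow> bool"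
  where
  "mod_iso R M N \<longleftrightarrow> (\<exists>f\<in>mod_hom R M N. bij_betw f (carrier M) (carrier N))"

text \<open>The record type of modules extends that of rings; the fields \<open>mult\<close> and \<open>one\<close> carry no
  meaning for modules and are left unspecified.\<close>

definition quotient_module ::
    "('r, 'm, 'x) module_scheme \<Rightarrow> 'm set \<Rightarrow> ('r, 'm set) module" where
  "quotient_module M N =
     \<lparr>carrier = a_rcosets\<^bsub>M\<^esub> N, monoid.mult = undefined, one = undefined,
      ring.zero = N, add = set_add M,
      module.smult = (\<lambda>r C. \<Union>x\<in>C. N +>\<^bsub>M\<^esub> (r \<odot>\<^bsub>M\<^esub> x))\<rparr>"

definition pi_torsion :: "'a::comm_ring_1 \<Rightarrow> ('a, 'm, 'x) module_scheme \<Rightarrow> 'm set" where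
  "pi_torsion \<pi> N = {x \<in> carrier N. \<exists>k::nat. (\<pi> ^ k) \<odot>\<^bsub>N\<^esub> x = \<zero>\<^bsub>N\<^esub>}"

text \<open>The module \<open>A\<^sup>a \<oplus> K\<^sup>b\<close>, with vectors represented by sequences vanishing beyond their length.\<close>

definition free_plus_fract :: "nat \<Rightarrow> nat \<Rightarrow>
    ('a::idom, (nat \<Rightarrow> 'a) \<times> (nat \<Rightarrow> 'a fract)) module" where
  "free_plus_fract a b =
     \<lparr>carrier = {(f, g). (\<forall>k\<ge>a. f k = 0) \<and> (\<forall>k\<ge>b. g k = 0)},
      monoid.mult = undefined, one = undefined,
      ring.zero = (\<lambda>_. 0, \<lambda>_. 0),
      add = (\<lambda>(f, g) (f', g'). (\<lambda>k. f k + f' k, \<lambda>k. g k + g' k)),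
      module.smult = (\<lambda>c (f, g). (\<lambda>k. c * f k, \<lambda>k. Fract c 1 * g k))\<rparr>"

text \<open>The polynomial ring over \<open>'a\<close> in variables indexed by the finite type \<open>'n\<close>: a polynomial is
  a finitely supported map from exponent vectors to coefficients. In particular
  \<open>Poly_Mapping.single \<alpha> c\<close> is \<open>c\<close> times the monomial with exponent vector \<open>\<alpha>\<close>.\<close>

type_synonym ('n, 'a) mpoly = "('n \<Rightarrow>\<^sub>0 nat) \<Rightarrow>\<^sub>0 'a"

definition mpoly_component :: "('n \<Rightarrow> int) \<Rightarrow> ('n, 'a::comm_ring_1) mpoly set" where
  "mpoly_component u =
     {f. \<forall>\<alpha>\<in>Poly_Mapping.keys f. \<forall>k. int (Poly_Mapping.lookup \<alpha> k) = u k}"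

definition C_monomial_ideal :: "('n, 'a::comm_ring_1) mpoly set \<Rightarrow> bool" where
  "C_monomial_ideal I \<longleftrightarrow>
     (\<exists>S \<subseteq> {Poly_Mapping.single \<alpha> c |\<alpha> c. True}. I = Idl\<^bsub>type_ring\<^esub> S)"

record ('r, 'm, 'n) graded_module = "('r, 'm) module" +
  component :: "('n \<Rightarrow> int) \<Rightarrow> 'm set"

definition is_graded_module ::
    "(('n, 'a::comm_ring_1) mpoly, 'm, 'n) graded_module \<Rightarrow> bool" where
  "is_graded_module M \<longleftrightarrow>
     Module.module type_ring M \<and>
     (\<forall>u. additive_subgroup (component M u) M) \<and>
     (\<forall>x\<in>carrier M. \<exists>!c. (\<forall>u. c u \<in> component M u) \<and> finite {u. c u \<noteq> \<zero>\<^bsub>M\<^esub>} \<and>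
        x = (\<Oplus>\<^bsub>M\<^esub>u\<in>{u. c u \<noteq> \<zero>\<^bsub>M\<^esub>}. c u)) \<and>
     (\<forall>u v. \<forall>f\<in>mpoly_component u. \<forall>x\<in>component M v.
        f \<odot>\<^bsub>M\<^esub> x \<in> component M (\<lambda>k. u k + v k))"

definition mpoly_module :: "(('n, 'a::comm_ring_1) mpoly, ('n, 'a) mpoly, 'n) graded_module" where
  "mpoly_module =
     \<lparr>carrier = UNIV, monoid.mult = (*), one = 1, ring.zero = 0, add = (+), module.smult = (*),
      component = mpoly_component\<rparr>"

definition graded_hom ::
    "(('n, 'a::comm_ring_1) mpoly, 'm, 'n) graded_module \<Rightarrow>
     (('n, 'a) mpoly, 'k, 'n) graded_module \<Rightarrow> ('m \<Rightarrow> 'k) set" where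
  "graded_hom M N =
     {f \<in> mod_hom type_ring M N. \<forall>u. f ` component M u \<subseteq> component N u}"

definition graded_submodule ::
    "('r, 'm, 'n) graded_module \<Rightarrow> 'm set \<Rightarrow> ('r, 'm, 'n) graded_module" where
  "graded_submodule M H = M\<lparr>carrier := H, component := (\<lambda>u. component M u \<inter> H)\<rparr>"

definition graded_quotient ::
    "('r, 'm, 'n) graded_module \<Rightarrow> 'm set \<Rightarrow> ('r, 'm set, 'n) graded_module" where
  "graded_quotient M N =
     module.extend (quotient_module M N)
       (graded_module.fields (\<lambda>u. (\<lambda>x. N +>\<^bsub>M\<^esub> x) ` component M u))"

text \<open>The component of degree \<open>u\<close> as a module over the coefficient ring, which acts through the
  constant polynomials.\<close>

definition component_module ::
    "(('n, 'a::comm_ring_1) mpoly, 'm, 'n) graded_module \<Rightarrow> ('n \<Rightarrow> int) \<Rightarrow> ('a, 'm) module" where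
  "component_module M u =
     \<lparr>carrier = component M u, monoid.mult = undefined, one = undefined,
      ring.zero = \<zero>\<^bsub>M\<^esub>, add = add M,
      module.smult = (\<lambda>a x. Poly_Mapping.single 0 a \<odot>\<^bsub>M\<^esub> x)\<rparr>"

text \<open>Injective objects of the category of \<open>\<int>\<^sup>n\<close>-graded modules and degree-preserving maps. The test
  modules live on the same type as \<open>E\<close>. This is no restriction on a term of a resolution of the
  polynomial ring \<open>R\<close>: as \<open>R\<close> embeds into the zeroth term, all shifts of \<open>R\<close> and of its homogeneous
  ideals occur, up to isomorphism, on that type, and these suffice by Baer's criterion.\<close>

definition graded_injective ::
    "(('n, 'a::comm_ring_1) mpoly, 'm, 'n) graded_module \<Rightarrow> bool" where
  "graded_injective E \<longleftrightarrow>
     is_graded_module E \<and>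
     (\<forall>(N :: (('n, 'a) mpoly, 'm, 'n) graded_module) (N' :: (('n, 'a) mpoly, 'm, 'n) graded_module) \<iota> f.
        is_graded_module N \<and> is_graded_module N' \<and>
        \<iota> \<in> graded_hom N N' \<and> inj_on \<iota> (carrier N) \<and> f \<in> graded_hom N E \<longrightarrow>
        (\<exists>g\<in>graded_hom N' E. \<forall>x\<in>carrier N. g (\<iota> x) = f x))"

definition graded_injective_resolution ::
    "(('n, 'a::comm_ring_1) mpoly, 'k, 'n) graded_module \<Rightarrow> ('k \<Rightarrow> 'm) \<Rightarrow>
     (nat \<Rightarrow> (('n, 'a) mpoly, 'm, 'n) graded_module) \<Rightarrow> (nat \<Rightarrow> 'm \<Rightarrow> 'm) \<Rightarrow> bool" where
  "graded_injective_resolution M \<epsilon> E d \<longleftrightarrow>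
     is_graded_module M \<and>
     (\<forall>j. graded_injective (E j)) \<and>
     \<epsilon> \<in> graded_hom M (E 0) \<and> inj_on \<epsilon> (carrier M) \<and>
     (\<forall>j. d j \<in> graded_hom (E j) (E (Suc j))) \<and>
     \<epsilon> ` carrier M = a_kernel (E 0) (E (Suc 0)) (d 0) \<and>
     (\<forall>j. d j ` carrier (E j) = a_kernel (E (Suc j)) (E (Suc (Suc j))) (d (Suc j)))"

primrec ideal_power :: "('r, 'x) ring_scheme \<Rightarrow> 'r set \<Rightarrow> nat \<Rightarrow> 'r set" where
  "ideal_power R I 0 = carrier R"
| "ideal_power R I (Suc t) = ideal_prod R I (ideal_power R I t)"

definition ideal_torsion ::
    "('n, 'a::comm_ring_1) mpoly set \<Rightarrow> (('n, 'a) mpoly, 'm, 'n) graded_module \<Rightarrow>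
     (('n, 'a) mpoly, 'm, 'n) graded_module" where
  "ideal_torsion I M =
     graded_submodule M
       {x \<in> carrier M. \<exists>t. \<forall>f\<in>ideal_power type_ring I t. f \<odot>\<^bsub>M\<^esub> x = \<zero>\<^bsub>M\<^esub>}"

definition cohomology ::
    "(nat \<Rightarrow> ('r, 'm, 'n) graded_module) \<Rightarrow> (nat \<Rightarrow> 'm \<Rightarrow> 'm) \<Rightarrow> nat \<Rightarrow>
     ('r, 'm set, 'n) graded_module" where
  "cohomology C d i =
     graded_quotient
       (graded_submodule (C i) (a_kernel (C i) (C (Suc i)) (d i)))
       (case i of 0 \<Rightarrow> {\<zero>\<^bsub>C 0\<^esub>} | Suc j \<Rightarrow> d j ` carrier (C j))"

text \<open>If \<open>(E, d)\<close> is a graded injective resolution of \<open>M\<close>, this is the \<open>i\<close>-th local cohomology module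
  of \<open>M\<close> with support in \<open>I\<close>, i.e. the \<open>i\<close>-th right derived functor of \<open>I\<close>-torsion, with its natural
  grading. Over a Noetherian ring graded injective modules are acyclic for \<open>I\<close>-torsion, so the
  underlying module is the ordinary local cohomology module.\<close>

definition local_cohomology ::
    "('n, 'a::comm_ring_1) mpoly set \<Rightarrow> (nat \<Rightarrow> (('n, 'a) mpoly, 'm, 'n) graded_module) \<Rightarrow>
     (nat \<Rightarrow> 'm \<Rightarrow> 'm) \<Rightarrow> nat \<Rightarrow> (('n, 'a) mpoly, 'm set, 'n) graded_module" where
  "local_cohomology I E d i = cohomology (\<lambda>j. ideal_torsion I (E j)) d i"

definition block :: "'n set \<Rightarrow> ('n \<Rightarrow> int) set" where
  "block U = {u. \<forall>k. (k \<in> U \<longrightarrow> u k \<ge> 0) \<and> (k \<notin> U \<longrightarrow> u k \<le> -1)}"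

end

theory Submission
  imports Defs
begin

text \<open>Multiplication by the variable \<open>X\<^sub>k\<close> is bijective from degree \<open>u\<close> to degree \<open>u + e\<^sub>k\<close> of
  \<open>H\<^sup>i\<^sub>I(R)\<close> whenever \<open>u\<^sub>k \<noteq> -1\<close>, so all components in one block are isomorphic. This property
  (``straightness'') is proved by induction on a finite set of generators of \<open>I\<close> of the form
  \<open>c X\<^sup>\<alpha>\<close>. It is clear for \<open>R\<close> itself. Let \<open>C\<close> be the subcomplex of the injective resolution that is
  torsion for the generators treated so far, and \<open>f\<close> a further generator. Graded injectivity makes
  \<open>0 \<rightarrow> \<Gamma>\<^sub>f(C) \<rightarrow> C \<rightarrow> C\<^sub>f \<rightarrow> 0\<close> exact, straightness passes from \<open>C\<close> to the localisation \<open>C\<^sub>f\<close>, and then to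
  \<open>\<Gamma>\<^sub>f(C)\<close> by the five lemma. Neither Hilbert's basis theorem nor the Artin--Rees lemma is needed:
  up to units the terms \<open>c X\<^sup>\<alpha>\<close> over a discrete valuation ring form the monoid \<open>\<nat>\<^sup>n\<^sup>+\<^sup>1\<close>, and
  Dickson's lemma takes their place.\<close>

subsection \<open>Discrete valuation rings\<close>

text \<open>The induction over the generators cannot lean on injectivity of the torsion
  subcomplexes. What it carries along is divisibility up to \<open>f\<close>-torsion: every
  homogeneous \<open>z\<close> satisfies \<open>f ^ s z = f ^ (s + 1) y\<close> for some
  \<open>s\<close> and some homogeneous \<open>y\<close> killed by everything that kills
  \<open>z\<close>. The last clause keeps \<open>y\<close> inside each torsion submodule that
  contains \<open>z\<close>, so every stage inherits the property. The exceptional value -1 comes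
  from \<open>R\<close> itself: if \<open>u_k = -1\<close>, then \<open>R_u\<close> is zero while
  the component one step further can be a copy of \<open>A\<close>. Multiplication by
  \<open>X_k\<close> is \<open>A\<close>-linear, so it passes to the quotients by \<pi>-torsion. To
  conclude, \<open>a\<close> and \<open>b\<close> must be invariants of \<open>A^a + K^b\<close>:
  \<open>a + b\<close> is the rank over \<open>K\<close>, and \<open>b\<close> is found from the
  divisible part, as only 0 in \<open>A\<close> is divisible by all powers of \<pi>.\<close>

lemma type_ring_simps [simp]:
  "carrier type_ring = UNIV" "x \<otimes>\<^bsub>type_ring\<^esub> y = x * y" "x \<oplus>\<^bsub>type_ring\<^esub> y = x + y"
  "\<one>\<^bsub>type_ring\<^esub> = 1" "\<zero>\<^bsub>type_ring\<^esub> = 0"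
  by (simp_all add: ring_of_type_algebra_def)

lemma type_ring_minus [simp]: "\<ominus>\<^bsub>type_ring\<^esub> (x::'a::comm_ring_1) = - x"
proof -
  interpret cring "type_ring :: 'a ring" by (rule cring_from_type_algebra)
  show ?thesis by (rule minus_equality) auto
qed

lemma PIdl_type_ring: "PIdl\<^bsub>type_ring\<^esub> (x::'a::comm_ring_1) = {y. x dvd y}"
  by (auto simp: cgenideal_def dvd_def mult.commute)

lemma type_ring_Units: "Units (type_ring :: 'a::comm_ring_1 ring) = {x. x dvd 1}"
  unfolding Units_def dvd_def by (auto simp: mult.commute)

lemma dvr_nonzero:
  assumes "discrete_valuation_ring (\<pi>::'a::idom)"
  shows "\<pi> \<noteq> 0"
proof
  assume "\<pi> = 0"
  interpret cring "type_ring :: 'a ring" by (rule cring_from_type_algebra)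
  have "maximalideal (PIdl\<^bsub>type_ring\<^esub> \<pi>) (type_ring :: 'a ring)"
    using assms unfolding discrete_valuation_ring_def by blast
  moreover have "PIdl\<^bsub>type_ring\<^esub> \<pi> = {\<zero>\<^bsub>type_ring\<^esub>}"
    using \<open>\<pi> = 0\<close> by (simp add: PIdl_type_ring)
  ultimately show False
    using assms zeromaximalideal_eq_field unfolding discrete_valuation_ring_def by simp
qed

text \<open>An irreducible divisor of a nonzero non-unit generates a maximal ideal. The ideal of
  \<pi> is the only one, so \<pi> divides that divisor.\<close>

lemma dvr_unit:
  assumes "discrete_valuation_ring (\<pi>::'a::idom)" and c: "\<not> \<pi> dvd c"
  shows "c dvd 1"
proof (rule ccontr)
  assume nu: "\<not> c dvd 1"
  interpret principal_domain "type_ring :: 'a ring"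
    using assms unfolding discrete_valuation_ring_def by blast
  have "c \<noteq> 0" using c by auto
  moreover have "c \<notin> Units (type_ring :: 'a ring)" using nu by (simp add: type_ring_Units)
  ultimately obtain q where q: "ring_irreducible\<^bsub>type_ring\<^esub> q" "q divides\<^bsub>type_ring\<^esub> c"
    using exists_irreducible_divisor[of c] type_ring_simps(1,5) by (metis DiffI UNIV_I singletonD)
  then have "maximalideal (PIdl\<^bsub>type_ring\<^esub> q) (type_ring :: 'a ring)"
    using irreducible_imp_maximalideal by simp
  then have "PIdl\<^bsub>type_ring\<^esub> q = PIdl\<^bsub>type_ring\<^esub> \<pi>"
    using assms unfolding discrete_valuation_ring_def by blast
  then have "\<pi> dvd q"
    by (metis PIdl_type_ring dvd_refl mem_Collect_eq)
  moreover have "q dvd c" using q(2) by (auto simp: factor_def dvd_def)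
  ultimately show False using c dvd_trans by blast
qed

lemma dvr_factor:
  assumes "discrete_valuation_ring (\<pi>::'a::idom)" "adically_complete \<pi>" "c \<noteq> 0"
  obtains k v where "c = \<pi> ^ k * v" "v dvd 1"
proof -
  obtain m where m: "\<not> \<pi> ^ m dvd c"
    using assms unfolding adically_complete_def by blast
  \<comment> \<open>With \<open>Suc m\<close> in the predicate, the least value is the valuation of
    \<open>c\<close> itself and not its successor. It exists because only 0 is divisible by all
    powers of \<pi>.\<close>
  define k where "k = (LEAST m. \<not> \<pi> ^ Suc m dvd c)"
  have m': "\<not> \<pi> ^ Suc m dvd c" using m by (metis dvd_trans le_imp_power_dvd lessI less_imp_le_nat)
  have k: "\<not> \<pi> ^ Suc k dvd c" unfolding k_def by (rule LeastI, rule m')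
  have "\<pi> ^ k dvd c"
  proof (cases k)
    case (Suc j)
    then show ?thesis using not_less_Least[of j "\<lambda>m. \<not> \<pi> ^ Suc m dvd c"] unfolding k_def by auto
  qed auto
  then obtain v where v: "c = \<pi> ^ k * v" by (auto simp: dvd_def)
  have "\<not> \<pi> dvd v"
    using k v by (metis mult_dvd_mono dvd_refl power_Suc mult.commute)
  then show ?thesis using dvr_unit[OF assms(1)] v that by blast
qed

subsection \<open>Dickson's lemma\<close>

text \<open>Every sequence has a monotone subsequence. A decreasing one in the naturals is constant
  from its minimum on, so a tail of it is also (weakly) increasing.\<close>

lemma nat_seq_mono_subseq:
  fixes s :: "nat \<Rightarrow> nat"
  obtains r :: "nat \<Rightarrow> nat" where "strict_mono r" "mono (s \<circ> r)"
proof -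
  obtain r :: "nat \<Rightarrow> nat" where r: "strict_mono r" "monoseq (s \<circ> r)"
    using seq_monosub[of s] by (auto simp: o_def)
  show ?thesis
  proof (cases "mono (s \<circ> r)")
    case True then show ?thesis using r that by blast
  next
    case False
    then have anti: "antimono (s \<circ> r)" using r(2) by (auto simp: monoseq_def mono_def antimono_def)
    define m where "m = (LEAST y. y \<in> range (s \<circ> r))"
    have "m \<in> range (s \<circ> r)" unfolding m_def by (rule LeastI) auto
    then obtain N where N: "(s \<circ> r) N = m" by auto
    have eq: "(s \<circ> r) n = m" if "n \<ge> N" for n
    proof (rule antisym)
      show "(s \<circ> r) n \<le> m" using antimonoD[OF anti that] N by simp
      show "m \<le> (s \<circ> r) n" unfolding m_def by (rule Least_le) auto
    qed
    have "strict_mono (\<lambda>n. r (n + N))" using r(1) by (auto simp: strict_mono_def)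
    moreover have "mono (s \<circ> (\<lambda>n. r (n + N)))" using eq by (auto simp: mono_def)
    ultimately show ?thesis using that by blast
  qed
qed

text \<open>Thinning out for one more coordinate preserves the monotonicity already reached in the
  others.\<close>

lemma dickson_seq:
  fixes s :: "nat \<Rightarrow> 'x \<Rightarrow> nat"
  assumes "finite D"
  shows "\<exists>r. strict_mono (r :: nat \<Rightarrow> nat) \<and> (\<forall>x\<in>D. mono (\<lambda>n. s (r n) x))"
  using assms
proof induction
  case empty
  then show ?case by (auto intro!: exI[of _ id] simp: strict_mono_def)
next
  case (insert x D)
  then obtain r :: "nat \<Rightarrow> nat" where r: "strict_mono r" "\<forall>y\<in>D. mono (\<lambda>n. s (r n) y)" by blast
  obtain q :: "nat \<Rightarrow> nat" where q: "strict_mono q" "mono ((\<lambda>n. s (r n) x) \<circ> q)"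
    by (rule nat_seq_mono_subseq)
  have "strict_mono (r \<circ> q)" using r(1) q(1) by (auto simp: strict_mono_def)
  moreover have "mono (\<lambda>n. s ((r \<circ> q) n) y)" if "y \<in> D" for y
    using r(2) that q(1) by (auto simp: mono_def strict_mono_less_eq)
  ultimately show ?case using q(2) by (auto intro!: exI[of _ "r \<circ> q"] simp: o_def)
qed

text \<open>\<open>T\<close> is the set of minimal elements. A sequence of distinct minimal elements
  would contain two comparable ones by \<open>dickson_seq\<close>, and the descent to a minimal
  element stops because the sum of the entries drops.\<close>

lemma dickson:
  fixes S :: "('x::finite \<Rightarrow> nat) set"
  obtains T where "finite T" "T \<subseteq> S" "\<And>s. s \<in> S \<Longrightarrow> \<exists>t\<in>T. t \<le> s"
proof -
  define T where "T = {t\<in>S. \<forall>s\<in>S. s \<le> t \<longrightarrow> s = t}"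
  have "finite T"
  proof (rule ccontr)
    assume "infinite T"
    then obtain f :: "nat \<Rightarrow> 'x \<Rightarrow> nat" where f: "inj f" "range f \<subseteq> T"
      using infinite_countable_subset by blast
    obtain r :: "nat \<Rightarrow> nat" where r: "strict_mono r" "\<forall>x. mono (\<lambda>n. f (r n) x)"
      using dickson_seq[of UNIV f] by auto
    have "f (r 0) \<le> f (r 1)" using r(2) by (auto simp: le_fun_def mono_def)
    then have "f (r 0) = f (r 1)" using f(2) unfolding T_def by blast
    then show False using f(1) r(1) by (metis injD strict_mono_eq zero_neq_one)
  qed
  moreover have "\<exists>t\<in>T. t \<le> s" if "s \<in> S" for s
    using that
  proof (induction "\<Sum>x\<in>UNIV. s x" arbitrary: s rule: less_induct)
    case less
    show ?case
    proof (cases "s \<in> T")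
      case False
      then obtain t where t: "t \<in> S" "t \<le> s" "t \<noteq> s" using less.prems unfolding T_def by blast
      have "(\<Sum>x\<in>UNIV. t x) < (\<Sum>x\<in>UNIV. s x)"
        using t by (intro sum_strict_mono_ex1) (auto simp: le_fun_def fun_eq_iff nat_less_le)
      then show ?thesis using less.hyps t by (meson order_trans)
    qed auto
  qed
  ultimately show ?thesis using that[of T] unfolding T_def by blast
qed

subsection \<open>Uniqueness of the ranks\<close>

lemma Fract_1_eq_0_iff: "Fract x 1 = 0 \<longleftrightarrow> x = (0::'a::idom)"
  unfolding Zero_fract_def by (subst eq_fract) simp_all

lemma clear_denominators:
  fixes h :: "'i \<Rightarrow> 'a::idom fract"
  assumes "finite J"
  shows "\<exists>q\<noteq>0. \<forall>j\<in>J. \<exists>c. Fract q 1 * h j = Fract c 1"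
  using assms
proof induction
  case empty
  then show ?case by (auto intro: exI[of _ 1])
next
  case (insert i J)
  then obtain q where q: "q \<noteq> 0" "\<forall>j\<in>J. \<exists>c. Fract q 1 * h j = Fract c 1" by blast
  obtain x y where xy: "h i = Fract x y" "y \<noteq> 0" by (cases "h i") auto
  have "\<exists>c. Fract (q * y) 1 * h j = Fract c 1" if j: "j \<in> insert i J" for j
  proof (cases "j = i")
    case True
    have "Fract (q * y) 1 * h j = Fract (q * x) 1"
      using True xy by (simp add: eq_fract algebra_simps)
    then show ?thesis by blast
  next
    case False
    then obtain c where "Fract q 1 * h j = Fract c 1" using q j by auto
    moreover have "Fract (q * y) 1 = Fract y 1 * Fract q 1" by (simp add: mult.commute)
    ultimately have "Fract (q * y) 1 * h j = Fract y 1 * Fract c 1" by (simp only: mult.assoc)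
    then show ?thesis by auto
  qed
  then show ?case using q(1) xy(2) by (intro exI[of _ "q * y"]) auto
qed

text \<open>Gaussian elimination without division: a vector with nonzero last coordinate serves as
  pivot, and cross-multiplication with it kills that coordinate in the other vectors.\<close>

lemma vectors_dependent:
  fixes v :: "'i \<Rightarrow> nat \<Rightarrow> 'k::idom"
  assumes "finite J" "n < card J"
  shows "\<exists>c. (\<exists>i\<in>J. c i \<noteq> 0) \<and> (\<forall>k<n. (\<Sum>i\<in>J. c i * v i k) = 0)"
  using assms
proof (induction n arbitrary: J v)
  case 0
  then show ?case by (intro exI[of _ "\<lambda>_. 1"]) (auto simp: card_gt_0_iff)
next
  case (Suc n)
  show ?case
  proof (cases "\<forall>i\<in>J. v i n = 0")
    case True
    obtain c where c: "\<exists>i\<in>J. c i \<noteq> 0" "\<forall>k<n. (\<Sum>i\<in>J. c i * v i k) = 0"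
      using Suc.IH[of J v] Suc.prems by auto
    then show ?thesis using True by (intro exI[of _ c]) (auto simp: less_Suc_eq)
  next
    case False
    then obtain j where j: "j \<in> J" "v j n \<noteq> 0" by blast
    define J' where "J' = J - {j}"
    have J': "J = insert j J'" "finite J'" "j \<notin> J'" "n < card J'"
      using j Suc.prems by (auto simp: J'_def)
    obtain c where c: "\<exists>i\<in>J'. c i \<noteq> 0"
      "\<forall>k<n. (\<Sum>i\<in>J'. c i * (v j n * v i k - v i n * v j k)) = 0"
      using Suc.IH[of J' "\<lambda>i k. v j n * v i k - v i n * v j k"] J' by auto
    \<comment> \<open>Expanding the combination of the eliminated vectors, the pivot
      \<open>v j\<close> receives minus the sum of the \<open>c i * v i n\<close>, and every other
      \<open>v i\<close> receives \<open>c i * v j n\<close>.\<close>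
    define c' where "c' i = (if i = j then - (\<Sum>i\<in>J'. c i * v i n) else c i * v j n)" for i
    have "(\<Sum>i\<in>J. c' i * v i k) = (\<Sum>i\<in>J'. c i * (v j n * v i k - v i n * v j k))" for k
    proof -
      have "(\<Sum>i\<in>J'. c' i * v i k) = (\<Sum>i\<in>J'. c i * v j n * v i k)"
        using J'(3) by (intro sum.cong) (auto simp: c'_def)
      then show ?thesis
        using J'(1-3) by (simp add: c'_def sum_distrib_right sum_distrib_left sum_subtractf algebra_simps)
    qed
    moreover have "(\<Sum>i\<in>J'. c i * (v j n * v i n - v i n * v j n)) = 0" by (simp add: mult.commute)
    ultimately have "\<forall>k<Suc n. (\<Sum>i\<in>J. c' i * v i k) = 0" using c(2) by (auto simp: less_Suc_eq)
    moreover have "\<exists>i\<in>J. c' i \<noteq> 0" using c(1) j J'(1,3) by (auto simp: c'_def)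
    ultimately show ?thesis by blast
  qed
qed

lemma fract_vectors_dependent:
  fixes v :: "nat \<Rightarrow> nat \<Rightarrow> 'a::idom fract"
  assumes "n < m" and supp: "\<And>i k. i < m \<Longrightarrow> n \<le> k \<Longrightarrow> v i k = 0"
  shows "\<exists>c. (\<exists>i<m. c i \<noteq> 0) \<and> (\<forall>k. (\<Sum>i<m. Fract (c i) 1 * v i k) = 0)"
proof -
  obtain h where h: "\<exists>i\<in>{..<m}. h i \<noteq> 0" "\<forall>k<n. (\<Sum>i<m. h i * v i k) = 0"
    using vectors_dependent[of "{..<m}" n v] assms(1) by auto
  obtain q where q: "q \<noteq> 0" "\<forall>j\<in>{..<m}. \<exists>c. Fract q 1 * h j = Fract c 1"
    using clear_denominators[of "{..<m}" h] by blast
  then obtain c where c: "\<And>j. j < m \<Longrightarrow> Fract q 1 * h j = Fract (c j) 1" by (metis lessThan_iff)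
  have "(\<Sum>i<m. Fract (c i) 1 * v i k) = 0" for k
  proof (cases "k < n")
    case True
    have "(\<Sum>i<m. Fract (c i) 1 * v i k) = Fract q 1 * (\<Sum>i<m. h i * v i k)"
      unfolding sum_distrib_left by (intro sum.cong) (auto simp: c[symmetric] mult.assoc)
    then show ?thesis using h(2) True by simp
  next
    case False
    then show ?thesis using supp by (intro sum.neutral) auto
  qed
  moreover have "c i \<noteq> 0" if "i < m" "h i \<noteq> 0" for i
  proof
    assume "c i = 0"
    then have "Fract q 1 * h i = 0" using c[OF that(1)] by (simp add: Zero_fract_def)
    moreover have "Fract q 1 \<noteq> 0" using q(1) by (simp add: Fract_1_eq_0_iff)
    ultimately show False using that by auto
  qed
  ultimately show ?thesis using h by (intro exI[of _ c]) auto
qed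

text \<open>The lattice \<open>A^(a + b)\<close> inside \<open>A^a + K^b\<close>; indices from
  \<open>a\<close> on land in \<open>K^b\<close>. It is large enough to detect ranks and needs
  scalars from \<open>A\<close> only.\<close>

definition fract_vec :: "nat \<Rightarrow> nat \<Rightarrow> (nat \<Rightarrow> 'a) \<Rightarrow> (nat \<Rightarrow> 'a::idom) \<times> (nat \<Rightarrow> 'a fract)" where
  "fract_vec a b c = (\<lambda>k. if k < a then c k else 0, \<lambda>k. if k < b then Fract (c (a + k)) 1 else 0)"

lemma free_plus_fract_simps:
  "x \<in> carrier (free_plus_fract a b) \<longleftrightarrow> (\<forall>k\<ge>a. fst x k = 0) \<and> (\<forall>k\<ge>b. snd x k = 0)"
  "fst (x \<oplus>\<^bsub>free_plus_fract a b\<^esub> y) k = fst x k + fst y k"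
  "snd (x \<oplus>\<^bsub>free_plus_fract a b\<^esub> y) k = snd x k + snd y k"
  "fst (r \<odot>\<^bsub>free_plus_fract a b\<^esub> x) k = r * fst x k"
  "snd (r \<odot>\<^bsub>free_plus_fract a b\<^esub> x) k = Fract r 1 * snd x k"
  "x = \<zero>\<^bsub>free_plus_fract a b\<^esub> \<longleftrightarrow> (\<forall>k. fst x k = 0) \<and> (\<forall>k. snd x k = 0)"
  by (cases x; cases y; auto simp: free_plus_fract_def)+

lemma fract_vec_carrier: "fract_vec a b c \<in> carrier (free_plus_fract a b)"
  by (simp add: fract_vec_def free_plus_fract_def)

lemma fract_vec_add:
  "fract_vec a b (\<lambda>i. c i + c' i) = fract_vec a b c \<oplus>\<^bsub>free_plus_fract a b\<^esub> fract_vec a b c'"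
  by (auto simp: fract_vec_def free_plus_fract_def)

lemma fract_vec_smult:
  "fract_vec a b (\<lambda>i. r * c i) = r \<odot>\<^bsub>free_plus_fract a b\<^esub> fract_vec a b c"
  by (auto simp: fract_vec_def free_plus_fract_def)

lemma fract_vec_zero: "fract_vec a b (\<lambda>_. 0) = \<zero>\<^bsub>free_plus_fract a b\<^esub>"
  by (auto simp: fract_vec_def free_plus_fract_def Zero_fract_def)

lemma fract_vec_eq_zero:
  assumes "fract_vec a b c = \<zero>\<^bsub>free_plus_fract a b\<^esub>" "i < a + b"
  shows "c i = 0"
proof (cases "i < a")
  case True
  then show ?thesis using fun_cong[OF arg_cong[OF assms(1), of fst], of i]
    by (simp add: fract_vec_def free_plus_fract_def)
next
  case False
  then have "a + (i - a) = i" "i - a < b" using assms(2) by auto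
  then show ?thesis using fun_cong[OF arg_cong[OF assms(1), of snd], of "i - a"]
    by (simp add: fract_vec_def free_plus_fract_def Fract_1_eq_0_iff)
qed

text \<open>More than \<open>n\<close> basis vectors from index \<open>l\<close> on have images in
  an \<open>n\<close>-dimensional space over \<open>K\<close>, hence are dependent, with
  coefficients in \<open>A\<close> after clearing denominators. The case \<open>l = 0\<close>
  compares total ranks, the case \<open>l = a\<close> the summands \<open>K^b\<close> alone.\<close>

lemma fract_vec_kernel:
  fixes h :: "(nat \<Rightarrow> 'a::idom) \<times> (nat \<Rightarrow> 'a fract) \<Rightarrow> nat \<Rightarrow> 'a fract"
  assumes add: "\<And>x y k. x \<in> carrier (free_plus_fract a b) \<Longrightarrow> y \<in> carrier (free_plus_fract a b) \<Longrightarrow>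
      h (x \<oplus>\<^bsub>free_plus_fract a b\<^esub> y) k = h x k + h y k"
    and smult: "\<And>r x k. x \<in> carrier (free_plus_fract a b) \<Longrightarrow>
      h (r \<odot>\<^bsub>free_plus_fract a b\<^esub> x) k = Fract r 1 * h x k"
    and supp: "\<And>i k. l \<le> i \<Longrightarrow> i < a + b \<Longrightarrow> n \<le> k \<Longrightarrow>
      h (fract_vec a b (\<lambda>j. if j = i then 1 else 0)) k = 0"
    and "n + l < a + b"
  shows "\<exists>c. (\<exists>i<a + b. c i \<noteq> 0) \<and> (\<forall>i<l. c i = 0) \<and> (\<forall>k. h (fract_vec a b c) k = 0)"
proof -
  define v where "v i = h (fract_vec a b (\<lambda>j. if j = l + i then 1 else 0))" for i
  obtain c where c: "\<exists>i<a + b - l. c i \<noteq> 0" "\<forall>k. (\<Sum>i<a + b - l. Fract (c i) 1 * v i k) = 0"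
    using fract_vectors_dependent[of n "a + b - l" v] supp assms(4) by (force simp: v_def less_diff_conv add.commute)
  have sum: "h (fract_vec a b (\<lambda>j. if l \<le> j \<and> j < l + m then c (j - l) else 0)) k =
      (\<Sum>i<m. Fract (c i) 1 * v i k)" (is "h (fract_vec a b (?w m)) k = _") for m k
  proof (induction m)
    case 0
    \<comment> \<open>Writing the zero vector as a multiple by 0 lets \<open>smult\<close> show that
      its image vanishes.\<close>
    have "?w 0 = (\<lambda>j. 0 * 0)" by (auto simp: fun_eq_iff)
    then show ?case using smult[OF fract_vec_carrier, of 0 "\<lambda>_. 0" k]
      by (simp only: fract_vec_smult) (simp add: Fract_1_eq_0_iff)
  next
    case (Suc m)
    have "?w (Suc m) = (\<lambda>j. ?w m j + c m * (if j = l + m then 1 else 0))"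
      by (auto simp: fun_eq_iff less_Suc_eq)
    then have "h (fract_vec a b (?w (Suc m))) k =
        h (fract_vec a b (?w m) \<oplus>\<^bsub>free_plus_fract a b\<^esub>
          c m \<odot>\<^bsub>free_plus_fract a b\<^esub> fract_vec a b (\<lambda>j. if j = l + m then 1 else 0)) k"
      by (simp only: fract_vec_add fract_vec_smult)
    also have "\<dots> = h (fract_vec a b (?w m)) k + Fract (c m) 1 * v m k"
      using add[OF fract_vec_carrier fract_vec_carrier, of _ "\<lambda>j. c m * (if j = l + m then 1 else 0)"]
        smult[OF fract_vec_carrier] by (simp only: fract_vec_smult v_def)
    finally have "h (fract_vec a b (?w (Suc m))) k = h (fract_vec a b (?w m)) k + Fract (c m) 1 * v m k" .
    then show ?case using Suc.IH by simp
  qed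
  obtain i where i: "i < a + b - l" "c i \<noteq> 0" using c(1) by blast
  let ?c = "\<lambda>j. if l \<le> j \<and> j < l + (a + b - l) then c (j - l) else 0"
  have "?c (l + i) \<noteq> 0" "l + i < a + b" using i by auto
  moreover have "\<forall>i<l. ?c i = 0" by simp
  moreover have "\<forall>k. h (fract_vec a b ?c) k = 0" using sum[of "a + b - l"] c(2) by simp
  ultimately show ?thesis by (intro exI[of _ ?c] conjI) (rule exI[of _ "l + i"], simp_all)
qed

text \<open>The first inequality compares dimensions after embedding the target in
  \<open>K^(a' + b')\<close>. For the second, the divisible summand \<open>K^b\<close> must map into
  \<open>K^b'\<close>, because \<open>A^a'\<close> contains no nonzero element divisible by all
  powers of \<pi>.\<close>

lemma inj_free_plus_fract_le:
  fixes \<pi> :: "'a::idom"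
    and g :: "(nat \<Rightarrow> 'a) \<times> (nat \<Rightarrow> 'a fract) \<Rightarrow> (nat \<Rightarrow> 'a) \<times> (nat \<Rightarrow> 'a fract)"
  assumes "\<pi> \<noteq> 0" and sep: "\<And>x. \<forall>k. \<pi> ^ k dvd x \<Longrightarrow> x = 0"
    and g: "g \<in> mod_hom type_ring (free_plus_fract a b) (free_plus_fract a' b')"
      "inj_on g (carrier (free_plus_fract a b))"
  shows "a + b \<le> a' + b' \<and> b \<le> b'"
proof -
  let ?F = "free_plus_fract a b :: ('a, _) module" and ?G = "free_plus_fract a' b' :: ('a, _) module"
  have gc: "g x \<in> carrier ?G" if "x \<in> carrier ?F" for x
    using g(1) that unfolding mod_hom_def by blast
  have ga: "g (x \<oplus>\<^bsub>?F\<^esub> y) = g x \<oplus>\<^bsub>?G\<^esub> g y" if "x \<in> carrier ?F" "y \<in> carrier ?F" for x y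
    using g(1) that unfolding mod_hom_def by blast
  have gs: "g (r \<odot>\<^bsub>?F\<^esub> x) = r \<odot>\<^bsub>?G\<^esub> g x" if "x \<in> carrier ?F" for r x
  proof -
    have "r \<in> carrier type_ring" by simp
    then show ?thesis using g(1) that unfolding mod_hom_def by blast
  qed
  have gc1: "fst (g (fract_vec a b c)) k = 0" if "a' \<le> k" for c k
    using gc[OF fract_vec_carrier] that unfolding free_plus_fract_simps by blast
  have gc2: "snd (g (fract_vec a b c)) k = 0" if "b' \<le> k" for c k
    using gc[OF fract_vec_carrier] that unfolding free_plus_fract_simps by blast
  have z: "\<zero>\<^bsub>?F\<^esub> \<in> carrier ?F" using fract_vec_carrier[of a b "\<lambda>_. 0"] by (simp add: fract_vec_zero)
  have "\<zero>\<^bsub>?F\<^esub> = 0 \<odot>\<^bsub>?F\<^esub> \<zero>\<^bsub>?F\<^esub>"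
    unfolding fract_vec_zero[symmetric] fract_vec_smult[symmetric] by simp
  then have "g \<zero>\<^bsub>?F\<^esub> = 0 \<odot>\<^bsub>?G\<^esub> g \<zero>\<^bsub>?F\<^esub>"
    using gs[OF z, of 0] by simp
  also have "\<dots> = \<zero>\<^bsub>?G\<^esub>"
    by (simp only: free_plus_fract_simps Zero_fract_def[symmetric]) simp
  finally have g0: "g \<zero>\<^bsub>?F\<^esub> = \<zero>\<^bsub>?G\<^esub>" .
  have ginj: "c i = 0" if "g (fract_vec a b c) = \<zero>\<^bsub>?G\<^esub>" "i < a + b" for c i
  proof (rule fract_vec_eq_zero)
    show "fract_vec a b c = \<zero>\<^bsub>?F\<^esub>"
      by (rule inj_onD[OF g(2)]) (use that g0 z fract_vec_carrier in auto)
  qed (rule that(2))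
  have "a + b \<le> a' + b'"
  proof (rule ccontr)
    assume gt: "\<not> a + b \<le> a' + b'"
    \<comment> \<open>The target seen as a subset of \<open>K^(a' + b')\<close>: coordinates below
      \<open>a'\<close> are entries in \<open>A\<close> turned into fractions.\<close>
    define h where "h x k = (if k < a' then Fract (fst (g x) k) 1 else snd (g x) (k - a'))" for x k
    have "\<exists>c. (\<exists>i<a + b. c i \<noteq> 0) \<and> (\<forall>i<0. c i = 0) \<and> (\<forall>k. h (fract_vec a b c) k = 0)"
    proof (rule fract_vec_kernel[where n = "a' + b'"])
      fix i k assume "a' + b' \<le> k"
      then show "h (fract_vec a b (\<lambda>j. if j = i then 1 else 0)) k = 0"
        unfolding h_def by (simp add: gc2)
    next
      fix x y k assume "x \<in> carrier ?F" "y \<in> carrier ?F"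
      then show "h (x \<oplus>\<^bsub>?F\<^esub> y) k = h x k + h y k"
        unfolding h_def by (simp only: ga) (simp add: free_plus_fract_simps)
    next
      fix r x k assume "x \<in> carrier ?F"
      then show "h (r \<odot>\<^bsub>?F\<^esub> x) k = Fract r 1 * h x k"
        unfolding h_def by (simp only: gs) (simp add: free_plus_fract_simps)
    qed (use gt in simp)
    then obtain c where "(\<exists>i<a + b. c i \<noteq> 0) \<and> (\<forall>i<0. c i = 0) \<and> (\<forall>k. h (fract_vec a b c) k = 0)" ..
    then obtain i where c: "i < a + b" "c i \<noteq> 0" and h: "h (fract_vec a b c) k = 0" for k by metis
    have "fst (g (fract_vec a b c)) k = 0" for k
    proof (cases "k < a'")
      case True
      then have "Fract (fst (g (fract_vec a b c)) k) 1 = 0" using h[of k] unfolding h_def by simp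
      then show ?thesis by (simp only: Fract_1_eq_0_iff)
    qed (simp add: gc1)
    moreover have "snd (g (fract_vec a b c)) k = 0" for k
      using h[of "a' + k"] unfolding h_def by simp
    ultimately have "g (fract_vec a b c) = \<zero>\<^bsub>?G\<^esub>" by (simp only: free_plus_fract_simps) simp
    then show False using ginj c by blast
  qed
  moreover have "b \<le> b'"
  proof (rule ccontr)
    assume gt: "\<not> b \<le> b'"
    \<comment> \<open>An element of the summand \<open>K^b\<close> can be divided by every power of
      \<pi>, so the same holds for the \<open>A\<close>-entries of its image.\<close>
    have div: "fst (g x) j = 0" if x: "x \<in> carrier ?F" "\<And>k. fst x k = 0" for x j
    proof (rule sep, rule allI)
      fix k
      have nz: "Fract (\<pi> ^ k) 1 \<noteq> 0" using \<open>\<pi> \<noteq> 0\<close> by (simp add: Fract_1_eq_0_iff)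
      define y where "y = (fst x, \<lambda>j. snd x j / Fract (\<pi> ^ k) 1)"
      have y: "y \<in> carrier ?F"
        using x(1) unfolding free_plus_fract_simps y_def by simp
      have "x = \<pi> ^ k \<odot>\<^bsub>?F\<^esub> y"
        by (rule prod_eqI; rule ext) (use x nz in \<open>simp_all add: free_plus_fract_simps y_def\<close>)
      then have "g x = \<pi> ^ k \<odot>\<^bsub>?G\<^esub> g y" using gs[OF y] by simp
      then show "\<pi> ^ k dvd fst (g x) j" by (simp add: free_plus_fract_simps)
    qed
    define h where "h x = snd (g x)" for x
    have "\<exists>c. (\<exists>i<a + b. c i \<noteq> 0) \<and> (\<forall>i<a. c i = 0) \<and> (\<forall>k. h (fract_vec a b c) k = 0)"
    proof (rule fract_vec_kernel[where n = b'])
      fix i k assume "b' \<le> k"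
      then show "h (fract_vec a b (\<lambda>j. if j = i then 1 else 0)) k = 0"
        unfolding h_def by (simp add: gc2)
    next
      fix x y k assume "x \<in> carrier ?F" "y \<in> carrier ?F"
      then show "h (x \<oplus>\<^bsub>?F\<^esub> y) k = h x k + h y k"
        unfolding h_def by (simp only: ga) (simp add: free_plus_fract_simps)
    next
      fix r x k assume "x \<in> carrier ?F"
      then show "h (r \<odot>\<^bsub>?F\<^esub> x) k = Fract r 1 * h x k"
        unfolding h_def by (simp only: gs) (simp add: free_plus_fract_simps)
    qed (use gt in simp)
    then obtain c where "(\<exists>i<a + b. c i \<noteq> 0) \<and> (\<forall>i<a. c i = 0) \<and> (\<forall>k. h (fract_vec a b c) k = 0)" ..
    then obtain i where c: "i < a + b" "c i \<noteq> 0" "\<forall>i<a. c i = 0" and h: "h (fract_vec a b c) k = 0" for k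
      by metis
    have "fst (fract_vec a b c) k = 0" for k using c(3) unfolding fract_vec_def by simp
    then have "fst (g (fract_vec a b c)) k = 0" for k by (rule div[OF fract_vec_carrier])
    then have "g (fract_vec a b c) = \<zero>\<^bsub>?G\<^esub>"
      using h unfolding free_plus_fract_simps h_def by simp
    then show False using ginj c by blast
  qed
  ultimately show ?thesis ..
qed

subsection \<open>Graded modules\<close>

lemma module_restrict:
  assumes "Module.module R M" "N \<subseteq> carrier M" "\<zero>\<^bsub>M\<^esub> \<in> N"
    and "\<And>x y. x \<in> N \<Longrightarrow> y \<in> N \<Longrightarrow> x \<oplus>\<^bsub>M\<^esub> y \<in> N"
    and "\<And>r x. r \<in> carrier R \<Longrightarrow> x \<in> N \<Longrightarrow> r \<odot>\<^bsub>M\<^esub> x \<in> N"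
    and eqs: "carrier M' = N" "add M' = add M" "\<zero>\<^bsub>M'\<^esub> = \<zero>\<^bsub>M\<^esub>" "module.smult M' = module.smult M"
  shows "Module.module R M'"
proof -
  interpret M: Module.module R M by fact
  have "\<ominus>\<^bsub>M\<^esub> x \<in> N" if "x \<in> N" for x
    using assms(5)[of "\<ominus>\<^bsub>R\<^esub> \<one>\<^bsub>R\<^esub>" x] that assms(2) by (auto simp: M.smult_l_minus)
  moreover have N: "x \<in> N \<Longrightarrow> x \<in> carrier M" for x using assms(2) by auto
  ultimately have "abelian_group M'"
    using assms(3,4) by (intro abelian_groupI)
      (auto simp: eqs M.a_assoc intro: M.a_comm intro!: bexI[of _ "\<ominus>\<^bsub>M\<^esub> _"] M.l_neg)
  with N show ?thesis
    by (intro moduleI M.R.cring_axioms)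
      (auto simp: eqs assms(5) M.smult_l_distr M.smult_r_distr M.smult_assoc1 M.smult_one)
qed

lemma additive_subgroupI':
  assumes "abelian_group G" "H \<subseteq> carrier G" "\<zero>\<^bsub>G\<^esub> \<in> H"
    and "\<And>x y. x \<in> H \<Longrightarrow> y \<in> H \<Longrightarrow> x \<oplus>\<^bsub>G\<^esub> y \<in> H"
    and inv: "\<And>x. x \<in> H \<Longrightarrow> \<exists>y\<in>H. x \<oplus>\<^bsub>G\<^esub> y = \<zero>\<^bsub>G\<^esub>"
  shows "additive_subgroup H G"
proof -
  interpret abelian_group G by fact
  have "\<ominus>\<^bsub>G\<^esub> x \<in> H" if x: "x \<in> H" for x
  proof -
    obtain y where y: "y \<in> H" "x \<oplus>\<^bsub>G\<^esub> y = \<zero>\<^bsub>G\<^esub>" using inv[OF x] by blast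
    then have "\<ominus>\<^bsub>G\<^esub> x = y" using minus_equality[of y x] x assms(2) a_comm by auto
    then show ?thesis using y by simp
  qed
  then show ?thesis
    unfolding additive_subgroup_def subgroup_def using assms by (auto simp: a_inv_def)
qed

abbreviation shift :: "('n \<Rightarrow>\<^sub>0 nat) \<Rightarrow> ('n \<Rightarrow> int) \<Rightarrow> 'n \<Rightarrow> int" where
  "shift \<alpha> v \<equiv> (\<lambda>k. int (Poly_Mapping.lookup \<alpha> k) + v k)"

lemma shift_inj: "shift \<alpha> v = shift \<beta> v \<Longrightarrow> \<alpha> = \<beta>"
  by (auto simp: fun_eq_iff intro: poly_mapping_eqI)

lemma mpoly_induct [case_names zero single add]:
  fixes f :: "'b \<Rightarrow>\<^sub>0 'c::monoid_add"
  assumes "P 0" "\<And>k c. P (Poly_Mapping.single k c)" "\<And>f g. P f \<Longrightarrow> P g \<Longrightarrow> P (f + g)"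
  shows "P f"
proof (induction f rule: update_induct)
  case const
  have "(0 :: 'b \<Rightarrow>\<^sub>0 'c) = Poly_Mapping.Abs_poly_mapping (\<lambda>_. 0)" by simp
  then show ?case using assms(1) by simp
next
  case (update f a b)
  have "Poly_Mapping.update a b f = f + Poly_Mapping.single a b"
    using update(1) by (intro poly_mapping_eqI) (auto simp: lookup_update lookup_add lookup_single in_keys_iff)
  then show ?case using update assms(2,3) by simp
qed

section \<open>Terms of the polynomial ring up to units\<close>

lemma single_power:
  "\<exists>\<beta>. (\<forall>k. Poly_Mapping.lookup \<beta> k = s * Poly_Mapping.lookup \<alpha> k) \<and>
     Poly_Mapping.single \<alpha> (c::'a::comm_ring_1) ^ s = Poly_Mapping.single (\<beta> :: 'n \<Rightarrow>\<^sub>0 nat) (c ^ s)"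
proof (induction s)
  case 0
  then show ?case by (intro exI[of _ 0]) (auto simp: single_one)
next
  case (Suc s)
  then obtain \<beta> where "\<forall>k. Poly_Mapping.lookup \<beta> k = s * Poly_Mapping.lookup \<alpha> k"
     "Poly_Mapping.single \<alpha> c ^ s = Poly_Mapping.single \<beta> (c ^ s)" by blast
  then show ?case by (intro exI[of _ "\<alpha> + \<beta>"]) (auto simp: lookup_add mult_single)
qed

text \<open>The monoid of exponents with one more coordinate: \<open>None\<close> holds the exponent
  of \<pi>, \<open>Some k\<close> that of the variable \<open>k\<close>. As the index type is
  finite, every function is the lookup of some exponent vector.\<close>

definition term_of :: "'a \<Rightarrow> ('n option \<Rightarrow> nat) \<Rightarrow> ('n::finite, 'a::comm_ring_1) mpoly" where
  "term_of \<pi> \<tau> = Poly_Mapping.single (Poly_Mapping.Abs_poly_mapping (\<lambda>k. \<tau> (Some k))) (\<pi> ^ \<tau> None)"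

lemma term_of_mult: "term_of \<pi> \<sigma> * term_of \<pi> \<tau> = term_of \<pi> (\<lambda>i. \<sigma> i + \<tau> i)"
proof -
  have "Poly_Mapping.Abs_poly_mapping (\<lambda>k. \<sigma> (Some k)) + Poly_Mapping.Abs_poly_mapping (\<lambda>k. \<tau> (Some k)) =
      Poly_Mapping.Abs_poly_mapping (\<lambda>k. \<sigma> (Some k) + \<tau> (Some k))"
    by (rule poly_mapping_eqI) (simp add: lookup_add)
  then show ?thesis by (simp add: term_of_def mult_single power_add)
qed

lemma term_of_power: "term_of \<pi> \<tau> ^ s = term_of \<pi> (\<lambda>i. s * \<tau> i)"
proof (induction s)
  case 0
  then show ?case by (simp add: term_of_def single_one)
next
  case (Suc s)
  then show ?case by (simp add: term_of_mult)
qed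

lemma term_of_dvd: "\<sigma> \<le> \<tau> \<Longrightarrow> \<exists>\<rho>. term_of \<pi> \<tau> = term_of \<pi> \<rho> * term_of \<pi> \<sigma>"
  by (auto simp: le_fun_def term_of_mult intro!: exI[of _ "\<lambda>i. \<tau> i - \<sigma> i"] arg_cong[of _ _ "term_of \<pi>"])

lemma single_eq_unit_term_of:
  fixes \<pi> :: "'a::idom"
  assumes "discrete_valuation_ring \<pi>" "adically_complete \<pi>" "c \<noteq> 0"
  shows "\<exists>v w \<tau>. v * w = 1 \<and> Poly_Mapping.single \<alpha> c = Poly_Mapping.single 0 v * term_of \<pi> (\<tau> :: 'n::finite option \<Rightarrow> nat)"
proof -
  obtain k v where kv: "c = \<pi> ^ k * v" "v dvd 1" using dvr_factor assms by blast
  then obtain w where w: "v * w = 1" by (metis dvdE)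
  have "Poly_Mapping.single \<alpha> c = Poly_Mapping.single 0 v * term_of \<pi> (case_option k (Poly_Mapping.lookup \<alpha>))"
    by (simp add: term_of_def mult_single kv mult.commute)
  with w show ?thesis by blast
qed

section \<open>Homogeneous components and projections to them\<close>

locale gmod =
  fixes M :: "(('n::finite, 'a::idom) mpoly, 'm, 'n) graded_module" (structure)
  assumes graded: "is_graded_module M"
begin

sublocale Module.module type_ring M
  using graded by (simp add: is_graded_module_def)

lemma comp_sub: "additive_subgroup (component M u) M"
  using graded by (simp add: is_graded_module_def)

lemma comp_carrier [simp]: "x \<in> component M u \<Longrightarrow> x \<in> carrier M"
  using additive_subgroup.a_subset[OF comp_sub] by blast

lemma comp_zero [simp]: "\<zero> \<in> component M u"
  using additive_subgroup.zero_closed[OF comp_sub] .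

lemma comp_add [simp]: "x \<in> component M u \<Longrightarrow> y \<in> component M u \<Longrightarrow> x \<oplus> y \<in> component M u"
  using additive_subgroup.a_closed[OF comp_sub] .

lemma comp_neg [simp]: "x \<in> component M u \<Longrightarrow> \<ominus> x \<in> component M u"
  using additive_subgroup.a_inv_closed[OF comp_sub] .

lemma comp_minus [simp]: "x \<in> component M u \<Longrightarrow> y \<in> component M u \<Longrightarrow> x \<ominus> y \<in> component M u"
  by (simp add: minus_eq)

lemma smult_carrier [simp]: "x \<in> carrier M \<Longrightarrow> r \<odot> x \<in> carrier M"
  using smult_closed by simp

lemma smult_mult: "x \<in> carrier M \<Longrightarrow> (r * s) \<odot> x = r \<odot> (s \<odot> x)"
  using smult_assoc1[of r s x] by simp

lemma smult_add: "x \<in> carrier M \<Longrightarrow> (r + s) \<odot> x = r \<odot> x \<oplus> s \<odot> x"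
  using smult_l_distr[of r s x] by simp

lemma smult_distr: "x \<in> carrier M \<Longrightarrow> y \<in> carrier M \<Longrightarrow> r \<odot> (x \<oplus> y) = r \<odot> x \<oplus> r \<odot> y"
  using smult_r_distr[of r x y] by simp

lemma smult_neg: "x \<in> carrier M \<Longrightarrow> r \<odot> (\<ominus> x) = \<ominus> (r \<odot> x)"
  using smult_r_minus[of r x] by simp

lemma smult_minus: "x \<in> carrier M \<Longrightarrow> y \<in> carrier M \<Longrightarrow> r \<odot> (x \<ominus> y) = r \<odot> x \<ominus> r \<odot> y"
  by (simp add: minus_eq smult_distr smult_neg)

lemma smult_1 [simp]: "x \<in> carrier M \<Longrightarrow> 1 \<odot> x = x"
  using smult_one by simp

lemma smult_0 [simp]: "x \<in> carrier M \<Longrightarrow> 0 \<odot> x = \<zero>"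
  using smult_l_null by simp

lemma smult_zero [simp]: "r \<odot> \<zero> = \<zero>"
  using smult_r_null by simp

lemma comp_smult: "f \<in> mpoly_component u \<Longrightarrow> x \<in> component M v \<Longrightarrow> f \<odot> x \<in> component M (\<lambda>k. u k + v k)"
  using graded by (simp add: is_graded_module_def)

lemma comp_single: "x \<in> component M v \<Longrightarrow> Poly_Mapping.single \<alpha> c \<odot> x \<in> component M (shift \<alpha> v)"
  by (intro comp_smult) (auto simp: mpoly_component_def split: if_splits)

lemma comp_power:
  "x \<in> component M v \<Longrightarrow>
    Poly_Mapping.single \<alpha> c ^ s \<odot> x \<in> component M (\<lambda>k. int s * int (Poly_Mapping.lookup \<alpha> k) + v k)"
proof -
  assume x: "x \<in> component M v"
  obtain \<beta> where "\<forall>k. Poly_Mapping.lookup \<beta> k = s * Poly_Mapping.lookup \<alpha> k"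
     "Poly_Mapping.single \<alpha> c ^ s = Poly_Mapping.single \<beta> (c ^ s)"
    using single_power by blast
  then show ?thesis using comp_single[OF x, of \<beta> "c ^ s"] by simp
qed

definition proj :: "('n \<Rightarrow> int) \<Rightarrow> 'm \<Rightarrow> 'm" where
  "proj u x = (THE c. (\<forall>u. c u \<in> component M u) \<and> finite {u. c u \<noteq> \<zero>} \<and>
        x = (\<Oplus>u\<in>{u. c u \<noteq> \<zero>}. c u)) u"

lemma finsum_mono_neutral:
  assumes "finite A" "\<And>u. u \<in> A \<Longrightarrow> c u \<in> carrier M" "B \<subseteq> A" "\<And>u. u \<in> A - B \<Longrightarrow> c u = \<zero>"
  shows "(\<Oplus>u\<in>A. c u) = (\<Oplus>u\<in>B. c u)"
  using assms by (intro M.add.finprod_mono_neutral_cong_right) auto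

text \<open>Allowing any finite set that contains the support spares the computation of exact
  supports, for instance of a sum, where terms may cancel.\<close>

lemma proj_unique:
  assumes "\<And>u. c u \<in> component M u" "finite A" "\<And>u. u \<notin> A \<Longrightarrow> c u = \<zero>" "x = (\<Oplus>u\<in>A. c u)"
  shows "proj u x = c u"
proof -
  have c: "(\<Oplus>u\<in>A. c u) = (\<Oplus>u\<in>{u. c u \<noteq> \<zero>}. c u)"
    using assms comp_carrier by (intro finsum_mono_neutral) blast+
  have fin: "finite {u. c u \<noteq> \<zero>}" using assms(2,3) by (metis (mono_tags, lifting) finite_subset mem_Collect_eq subsetI)
  have "x \<in> carrier M" using assms(1,4) comp_carrier by (auto intro!: M.finsum_closed intro: comp_carrier)
  then have "\<exists>!c. (\<forall>u. c u \<in> component M u) \<and> finite {u. c u \<noteq> \<zero>} \<and> x = (\<Oplus>u\<in>{u. c u \<noteq> \<zero>}. c u)"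
    using graded by (simp add: is_graded_module_def)
  then show ?thesis unfolding proj_def
    by (rule arg_cong[of _ c "\<lambda>c. c u", OF the1_equality]) (use assms c fin in auto)
qed

lemma proj_decomp:
  assumes "x \<in> carrier M"
  shows "proj u x \<in> component M u" "finite {u. proj u x \<noteq> \<zero>}" "x = (\<Oplus>u\<in>{u. proj u x \<noteq> \<zero>}. proj u x)"
proof -
  have "\<exists>!c. (\<forall>u. c u \<in> component M u) \<and> finite {u. c u \<noteq> \<zero>} \<and> x = (\<Oplus>u\<in>{u. c u \<noteq> \<zero>}. c u)"
    using graded assms by (simp add: is_graded_module_def)
  from theI'[OF this]
  show "proj u x \<in> component M u" "finite {u. proj u x \<noteq> \<zero>}" "x = (\<Oplus>u\<in>{u. proj u x \<noteq> \<zero>}. proj u x)"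
    unfolding proj_def by blast+
qed

lemma proj_carrier [simp]: "x \<in> carrier M \<Longrightarrow> proj u x \<in> carrier M"
  using proj_decomp(1) comp_carrier by blast

lemma proj_component:
  assumes "x \<in> component M v"
  shows "proj u x = (if u = v then x else \<zero>)"
  by (rule proj_unique[where A = "{v}"]) (use assms in \<open>auto simp: M.finsum_singleton\<close>)

lemma proj_zero [simp]: "proj u \<zero> = \<zero>"
  using proj_component[of \<zero> u u] by simp

lemma proj_eq_zero: "x \<in> carrier M \<Longrightarrow> (\<And>u. proj u x = \<zero>) \<Longrightarrow> x = \<zero>"
  using proj_decomp(3)[of x] by simp

lemma proj_add:
  assumes "x \<in> carrier M" "y \<in> carrier M"
  shows "proj u (x \<oplus> y) = proj u x \<oplus> proj u y"
proof (rule proj_unique)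
  let ?A = "{u. proj u x \<noteq> \<zero>} \<union> {u. proj u y \<noteq> \<zero>}"
  show fin: "finite ?A" using assms proj_decomp(2) by auto
  have "x = (\<Oplus>u\<in>?A. proj u x)" "y = (\<Oplus>u\<in>?A. proj u y)"
    using assms fin by (subst proj_decomp(3), simp, intro finsum_mono_neutral[symmetric], auto)+
  then show "x \<oplus> y = (\<Oplus>u\<in>?A. proj u x \<oplus> proj u y)"
    using assms by (subst M.finsum_addf) auto
qed (use assms proj_decomp(1) in auto)

lemma proj_single:
  assumes "x \<in> carrier M"
  shows "proj (shift \<alpha> v) (Poly_Mapping.single \<alpha> c \<odot> x) = Poly_Mapping.single \<alpha> c \<odot> proj v x"
proof -
  let ?A = "{u. proj u x \<noteq> \<zero>}" and ?c = "\<lambda>u. Poly_Mapping.single \<alpha> c \<odot> proj (\<lambda>k. u k - int (Poly_Mapping.lookup \<alpha> k)) x"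
  have "proj (shift \<alpha> v) (Poly_Mapping.single \<alpha> c \<odot> x) = ?c (shift \<alpha> v)"
  proof (rule proj_unique[where c = ?c])
    show "finite (shift \<alpha> ` ?A)" using proj_decomp(2)[OF assms] by simp
    show "?c u \<in> component M u" for u
      using comp_single[OF proj_decomp(1)[OF assms], of \<alpha> c "\<lambda>k. u k - int (Poly_Mapping.lookup \<alpha> k)"] by simp
    show "?c u = \<zero>" if u: "u \<notin> shift \<alpha> ` ?A" for u
    proof -
      let ?v = "\<lambda>k. u k - int (Poly_Mapping.lookup \<alpha> k)"
      have "shift \<alpha> ?v = u" by simp
      then have "?v \<notin> ?A" using u imageI[of ?v ?A "shift \<alpha>"] by metis
      then show ?thesis by simp
    qed
    have "Poly_Mapping.single \<alpha> c \<odot> x = (\<Oplus>u\<in>?A. Poly_Mapping.single \<alpha> c \<odot> proj u x)"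
      using proj_decomp[OF assms] assms by (subst proj_decomp(3)[OF assms], subst finsum_smult_ldistr) auto
    also have "\<dots> = (\<Oplus>u\<in>?A. ?c (shift \<alpha> u))" by simp
    also have "\<dots> = (\<Oplus>u\<in>shift \<alpha> ` ?A. ?c u)"
      using assms by (intro M.finsum_reindex[symmetric]) (auto simp: inj_on_def fun_eq_iff)
    finally show "Poly_Mapping.single \<alpha> c \<odot> x = (\<Oplus>u\<in>shift \<alpha> ` ?A. ?c u)" .
  qed
  then show ?thesis by simp
qed

end

context gmod begin

lemma minus_self: "x \<in> carrier M \<Longrightarrow> x \<ominus> x = \<zero>"
  by (simp add: minus_eq M.r_neg)

lemma minus_eq_zero:
  assumes "x \<in> carrier M" "y \<in> carrier M" "x \<ominus> y = \<zero>"
  shows "x = y"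
proof -
  have "x = (x \<ominus> y) \<oplus> y" using assms(1,2) by (simp add: minus_eq M.a_assoc M.l_neg)
  then show ?thesis using assms by simp
qed

text \<open>The grading of a submodule is stated with the submodule's own \<open>finsum\<close>;
  this turns it into that of \<open>M\<close>.\<close>

lemma finsum_restrict:
  assumes "finite A" "N \<subseteq> carrier M" "\<And>u. u \<in> A \<Longrightarrow> c u \<in> N" "abelian_group M'"
    and "carrier M' = N" "add M' = add M" "\<zero>\<^bsub>M'\<^esub> = \<zero>"
  shows "finsum M' c A = finsum M c A"
proof -
  interpret M': abelian_group M' by fact
  show ?thesis
    using assms(1,3)
  proof (induction A)
    case empty
    then show ?case using assms(7) by (simp add: M.finsum_empty)
  next
    case (insert u A)
    then have "c \<in> A \<rightarrow> carrier M'" "c \<in> A \<rightarrow> carrier M" "c u \<in> carrier M'" "c u \<in> carrier M"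
      using assms(2,5) by auto
    then show ?case using insert assms(6) by (simp add: M.finsum_insert)
  qed
qed

text \<open>The twist \<open>N(a)\<close> of a graded submodule, with \<open>N(a)_v\<close> the part
  of \<open>N\<close> of degree \<open>a + v\<close>. Through the twist, multiplication by a term of
  degree \<open>a\<close> becomes a degree-preserving map from \<open>N\<close> to
  \<open>N(a)\<close>, as \<open>graded_injective\<close> demands.\<close>

lemma graded_shift:
  assumes N: "N \<subseteq> carrier M" "\<zero> \<in> N" "\<And>x y. x \<in> N \<Longrightarrow> y \<in> N \<Longrightarrow> x \<oplus> y \<in> N"
    "\<And>r x. x \<in> N \<Longrightarrow> r \<odot> x \<in> N" and proj: "\<And>u x. x \<in> N \<Longrightarrow> proj u x \<in> N"
  shows "is_graded_module (M\<lparr>carrier := N, component := \<lambda>v. component M (\<lambda>k. a k + v k) \<inter> N\<rparr>)"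
    (is "is_graded_module ?M")
proof -
  have mod: "Module.module type_ring ?M"
    by (rule module_restrict[OF module_axioms N(1,2,3)]) (auto simp: N)
  then have ab: "abelian_group ?M" by (simp add: module_def)
  have neg: "\<ominus> x \<in> N" if "x \<in> N" for x
    using N(4)[OF that, of "-1"] smult_l_minus[of 1 x] that N(1) by auto
  have sub: "additive_subgroup (component M (\<lambda>k. a k + v k) \<inter> N) ?M" for v
  proof (rule additive_subgroupI'[OF ab])
    fix x assume x: "x \<in> component M (\<lambda>k. a k + v k) \<inter> N"
    then have "x \<oplus> \<ominus> x = \<zero>" by (intro M.r_neg) (auto intro: comp_carrier)
    then show "\<exists>y\<in>component M (\<lambda>k. a k + v k) \<inter> N. x \<oplus>\<^bsub>?M\<^esub> y = \<zero>\<^bsub>?M\<^esub>"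
      using x neg by (intro bexI[of _ "\<ominus> x"]) auto
  qed (use N in auto)
  have fs: "finsum ?M c A = finsum M c A" if "finite A" "\<And>u. u \<in> A \<Longrightarrow> c u \<in> N" for c and A :: "('n \<Rightarrow> int) set"
    by (rule finsum_restrict[where N = N]) (use that N(1) ab in auto)
  have inj: "inj_on (\<lambda>u k. a k + u k) B" for B by (auto simp: inj_on_def fun_eq_iff)
  have uniq: "c u = proj (\<lambda>k. a k + u k) x" if c: "\<forall>u. c u \<in> component M (\<lambda>k. a k + u k) \<inter> N"
    "finite {u. c u \<noteq> \<zero>}" "x = finsum ?M c {u. c u \<noteq> \<zero>}" for x c u
  proof -
    let ?c = "\<lambda>v. c (\<lambda>k. v k - a k)" and ?A = "(\<lambda>u k. a k + u k) ` {u. c u \<noteq> \<zero>}"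
    have "proj (\<lambda>k. a k + u k) x = ?c (\<lambda>k. a k + u k)"
    proof (rule proj_unique[where c = ?c and A = ?A])
      show "?c v \<in> component M v" for v using c(1)[rule_format, of "\<lambda>k. v k - a k"] by simp
      show "?c v = \<zero>" if "v \<notin> ?A" for v
        using that imageI[of "\<lambda>k. v k - a k" "{u. c u \<noteq> \<zero>}" "\<lambda>u k. a k + u k"] by auto
      have "x = finsum M c {u. c u \<noteq> \<zero>}" using c fs by auto
      also have "\<dots> = finsum M ?c ?A"
        using c(1) N(1) by (subst M.finsum_reindex) (auto intro: inj comp_carrier)
      finally show "x = finsum M ?c ?A" .
    qed (use c(2) in auto)
    then show ?thesis by simp
  qed
  have ex: "(\<forall>u. c u \<in> component M (\<lambda>k. a k + u k) \<inter> N) \<and> finite {u. c u \<noteq> \<zero>} \<and>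
     x = finsum ?M c {u. c u \<noteq> \<zero>}"
    if x: "x \<in> N" and c: "c = (\<lambda>u. proj (\<lambda>k. a k + u k) x)" for x and c :: "('n \<Rightarrow> int) \<Rightarrow> 'm"
  proof -
    have xc: "x \<in> carrier M" using x N(1) by auto
    have img: "{v. proj v x \<noteq> \<zero>} = (\<lambda>u k. a k + u k) ` {u. c u \<noteq> \<zero>}"
    proof (rule Set.set_eqI, rule iffI)
      fix v assume "v \<in> {v. proj v x \<noteq> \<zero>}"
      then show "v \<in> (\<lambda>u k. a k + u k) ` {u. c u \<noteq> \<zero>}"
        by (intro image_eqI[of _ _ "\<lambda>k. v k - a k"]) (auto simp: c)
    qed (auto simp: c)
    have fin: "finite {u. c u \<noteq> \<zero>}"
      by (rule finite_imageD[OF _ inj]) (use proj_decomp(2)[OF xc] in \<open>simp only: img\<close>)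
    have "x = finsum M (\<lambda>v. proj v x) {v. proj v x \<noteq> \<zero>}" by (rule proj_decomp(3)[OF xc])
    also have "\<dots> = finsum M c {u. c u \<noteq> \<zero>}"
      unfolding img using xc by (subst M.finsum_reindex) (auto intro: inj simp: c)
    also have "\<dots> = finsum ?M c {u. c u \<noteq> \<zero>}"
      using fin proj x by (subst fs) (auto simp: c)
    finally show ?thesis using fin proj x proj_decomp(1)[OF xc] by (simp add: c)
  qed
  have "\<exists>!c. (\<forall>u. c u \<in> component M (\<lambda>k. a k + u k) \<inter> N) \<and> finite {u. c u \<noteq> \<zero>} \<and>
     x = finsum ?M c {u. c u \<noteq> \<zero>}" if "x \<in> N" for x
    by (rule ex1I, rule ex[OF that refl]) (use uniq in blast)
  moreover have "f \<odot> x \<in> component M (\<lambda>k. a k + (u k + v k))"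
    if "f \<in> mpoly_component u" "x \<in> component M (\<lambda>k. a k + v k)" for f x u v
    using comp_smult[OF that] by (simp add: add.left_commute)
  ultimately show ?thesis
    unfolding is_graded_module_def using mod sub N(4) by simp
qed

text \<open>In the fine grading a degree belongs to at most one monomial, so only one monomial of
  \<open>r\<close> can move \<open>x\<close> from degree \<open>w\<close> to degree
  \<open>v\<close>. This reduces questions about all multiples of \<open>x\<close> to multiples by
  terms.\<close>

lemma proj_smult_term:
  assumes "x \<in> component M w"
  shows "\<exists>\<beta>. \<forall>r. \<exists>m. proj v (r \<odot> x) = Poly_Mapping.single \<beta> m \<odot> x"
proof (cases "\<exists>\<beta>. v = shift \<beta> w")
  case True
  then obtain \<beta> where \<beta>: "v = shift \<beta> w" by blast
  have "\<exists>m. proj v (r \<odot> x) = Poly_Mapping.single \<beta> m \<odot> x" for r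
  proof (induction r rule: mpoly_induct)
    case zero
    then show ?case using assms by (intro exI[of _ 0]) (auto simp: comp_carrier)
  next
    case (single \<gamma> c)
    have "proj v (Poly_Mapping.single \<gamma> c \<odot> x) = (if v = shift \<gamma> w then Poly_Mapping.single \<gamma> c \<odot> x else \<zero>)"
      by (rule proj_component[OF comp_single[OF assms]])
    then show ?case using shift_inj[of \<beta> w \<gamma>] \<beta> comp_carrier[OF assms]
      by (cases "v = shift \<gamma> w") (auto intro: exI[of _ c] exI[of _ 0])
  next
    case (add f g)
    then obtain m m' where "proj v (f \<odot> x) = Poly_Mapping.single \<beta> m \<odot> x"
      "proj v (g \<odot> x) = Poly_Mapping.single \<beta> m' \<odot> x" by blast
    then show ?case using comp_carrier[OF assms]
      by (intro exI[of _ "m + m'"]) (simp add: smult_add proj_add single_add)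
  qed
  then show ?thesis by blast
next
  case False
  have "proj v (r \<odot> x) = \<zero>" for r
  proof (induction r rule: mpoly_induct)
    case zero
    then show ?case using comp_carrier[OF assms] by simp
  next
    case (single \<gamma> c)
    then show ?case using proj_component[OF comp_single[OF assms]] False by simp
  next
    case (add f g)
    then show ?case using comp_carrier[OF assms] by (simp add: smult_add proj_add)
  qed
  then show ?thesis using comp_carrier[OF assms] by (intro exI[of _ 0] allI exI[of _ 0]) simp
qed

text \<open>The chain of annihilators of \<open>f ^ s z\<close> becomes stationary, as far as terms
  are concerned. Up to units, the terms that kill \<open>z\<close> are a set of exponents with
  finitely many minimal elements, and these give a uniform \<open>s\<close>.\<close>

lemma stable_annihilator:
  fixes \<pi> :: 'a
  assumes dvr: "discrete_valuation_ring \<pi>" "adically_complete \<pi>" and z: "z \<in> carrier M"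
  shows "\<exists>s. \<forall>j \<beta> m. (Poly_Mapping.single \<alpha> c ^ (s + j) * Poly_Mapping.single \<beta> m) \<odot> z = \<zero> \<longrightarrow>
     (Poly_Mapping.single \<alpha> c ^ s * Poly_Mapping.single \<beta> m) \<odot> z = \<zero>"
proof (cases "c = 0")
  case True
  \<comment> \<open>Here \<open>f = 0\<close>, and 1 is the first exponent for which
    \<open>f ^ s\<close> vanishes.\<close>
  then show ?thesis using z by (intro exI[of _ 1]) simp
next
  case False
  obtain v w \<tau> where \<tau>: "v * w = 1"
    "Poly_Mapping.single \<alpha> c = Poly_Mapping.single 0 v * (term_of \<pi> \<tau> :: ('n, 'a) mpoly)"
    using single_eq_unit_term_of[OF dvr False] by blast
  define U where "U = {\<sigma>. (term_of \<pi> \<sigma> :: ('n, 'a) mpoly) \<odot> z = \<zero>}"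
  obtain T where T: "finite T" "T \<subseteq> U" "\<And>\<sigma>. \<sigma> \<in> U \<Longrightarrow> \<exists>t\<in>T. t \<le> \<sigma>"
    using dickson[of U] by blast
  \<comment> \<open>A common bound for all entries of the minimal exponents; the inserted 0 covers
    the case that no term kills \<open>z\<close>.\<close>
  define s where "s = Max (insert 0 ((\<lambda>(t, i). t i) ` (T \<times> UNIV)))"
  have s: "t i \<le> s" if "t \<in> T" for t i
    unfolding s_def using T(1) that by (intro Max_ge) auto
  have "(Poly_Mapping.single \<alpha> c ^ s * Poly_Mapping.single \<beta> m) \<odot> z = \<zero>"
    if kill: "(Poly_Mapping.single \<alpha> c ^ (s + j) * Poly_Mapping.single \<beta> m) \<odot> z = \<zero>" for j \<beta> m
  proof (cases "m = 0")
    case True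
    then show ?thesis using z by simp
  next
    case False
    obtain v' w' \<mu> where \<mu>: "v' * w' = 1"
      "Poly_Mapping.single \<beta> m = Poly_Mapping.single 0 v' * (term_of \<pi> \<mu> :: ('n, 'a) mpoly)"
      using single_eq_unit_term_of[OF dvr False] by blast
    have eq: "Poly_Mapping.single \<alpha> c ^ n * Poly_Mapping.single \<beta> m =
        (Poly_Mapping.single 0 v ^ n * Poly_Mapping.single 0 v') * term_of \<pi> (\<lambda>i. n * \<tau> i + \<mu> i)" for n
      by (simp add: \<tau> \<mu> power_mult_distrib term_of_power term_of_mult[symmetric] mult_ac)
    have u1: "Poly_Mapping.single 0 v * Poly_Mapping.single 0 w = (1 :: ('n, 'a) mpoly)"
      and u2: "Poly_Mapping.single 0 v' * Poly_Mapping.single 0 w' = (1 :: ('n, 'a) mpoly)"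
      using \<tau>(1) \<mu>(1) by (simp_all add: mult_single)
    have inv: "(Poly_Mapping.single 0 w ^ n * Poly_Mapping.single 0 w') *
       (Poly_Mapping.single 0 v ^ n * Poly_Mapping.single 0 v') = (1 :: ('n, 'a) mpoly)" for n
    proof -
      have "(Poly_Mapping.single 0 w ^ n * Poly_Mapping.single 0 w') *
          (Poly_Mapping.single 0 v ^ n * Poly_Mapping.single 0 v') =
          (Poly_Mapping.single 0 v * Poly_Mapping.single 0 w) ^ n *
          (Poly_Mapping.single 0 v' * Poly_Mapping.single 0 w' :: ('n, 'a) mpoly)"
        by (simp only: power_mult_distrib mult_ac)
      then show ?thesis by (simp only: u1 u2 power_one mult_1)
    qed
    have "term_of \<pi> (\<lambda>i. (s + j) * \<tau> i + \<mu> i) \<odot> z =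
       (Poly_Mapping.single 0 w ^ (s + j) * Poly_Mapping.single 0 w') \<odot>
         ((Poly_Mapping.single \<alpha> c ^ (s + j) * Poly_Mapping.single \<beta> m) \<odot> z)"
      unfolding eq smult_mult[OF z, symmetric] by (subst mult.assoc[symmetric]) (simp only: inv mult_1)
    then have "(\<lambda>i. (s + j) * \<tau> i + \<mu> i) \<in> U" using kill by (simp add: U_def)
    then obtain t where t: "t \<in> T" "t \<le> (\<lambda>i. (s + j) * \<tau> i + \<mu> i)" using T(3) by blast
    \<comment> \<open>Where \<open>\<tau> i = 0\<close>, the extra factor \<open>f ^ j\<close> did
      not change coordinate \<open>i\<close>. Elsewhere \<open>s * \<tau> i\<close> is at least
      \<open>s\<close>, which already bounds \<open>t i\<close>.\<close>
    have "t i \<le> s * \<tau> i + \<mu> i" for i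
    proof (cases "\<tau> i = 0")
      case True
      then show ?thesis using t(2) by (simp add: le_fun_def) (metis add_0 mult_0_right)
    next
      case False
      then have "s \<le> s * \<tau> i" by simp
      then show ?thesis using s[OF t(1), of i] by linarith
    qed
    then obtain \<rho> where "term_of \<pi> (\<lambda>i. s * \<tau> i + \<mu> i) = term_of \<pi> \<rho> * (term_of \<pi> t :: ('n, 'a) mpoly)"
      using term_of_dvd[of t "\<lambda>i. s * \<tau> i + \<mu> i"] by (auto simp: le_fun_def)
    moreover have "term_of \<pi> t \<odot> z = \<zero>" using t(1) T(2) by (auto simp: U_def)
    ultimately show ?thesis unfolding eq using z by (simp add: smult_mult)
  qed
  then show ?thesis by blast
qed

text \<open>Once \<open>f\<close> acts injectively on the submodule generated by
  \<open>z' = f ^ s z\<close>, injectivity of \<open>M\<close> extends the inverse of this action to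
  \<open>z'\<close> itself. The extension is linear, so \<open>y\<close> is killed by whatever kills
  \<open>z'\<close>, in particular by whatever kills \<open>z\<close>.\<close>

lemma divisible:
  fixes \<pi> :: 'a
  assumes dvr: "discrete_valuation_ring \<pi>" "adically_complete \<pi>" and inj: "graded_injective M"
    and z: "z \<in> component M w"
  shows "\<exists>s. \<exists>y\<in>component M (\<lambda>k. w k - int (Poly_Mapping.lookup \<alpha> k)).
    Poly_Mapping.single \<alpha> c ^ Suc s \<odot> y = Poly_Mapping.single \<alpha> c ^ s \<odot> z \<and>
    (\<forall>r. r \<odot> z = \<zero> \<longrightarrow> r \<odot> y = \<zero>)"
proof -
  note zc = comp_carrier[OF z]
  let ?f = "Poly_Mapping.single \<alpha> c"
  obtain s where s: "\<And>j \<beta> m. (?f ^ (s + j) * Poly_Mapping.single \<beta> m) \<odot> z = \<zero> \<Longrightarrow>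
     (?f ^ s * Poly_Mapping.single \<beta> m) \<odot> z = \<zero>"
    using stable_annihilator[OF dvr zc] by blast
  \<comment> \<open>After multiplication by this power, \<open>f\<close>-torsion has disappeared
    from the generated submodule.\<close>
  define z' where "z' = ?f ^ s \<odot> z"
  have z': "z' \<in> component M (\<lambda>k. int s * int (Poly_Mapping.lookup \<alpha> k) + w k)"
    unfolding z'_def by (rule comp_power[OF z])
  note z'c = comp_carrier[OF z']
  define N where "N = {r \<odot> z' | r. True}"
  let ?S = "\<lambda>a. M\<lparr>carrier := N, component := \<lambda>v. component M (\<lambda>k. a k + v k) \<inter> N\<rparr>"
  have Nadd: "x \<oplus> y \<in> N" if "x \<in> N" "y \<in> N" for x y
  proof -
    obtain r r' where "x = r \<odot> z'" "y = r' \<odot> z'" using \<open>x \<in> N\<close> \<open>y \<in> N\<close> by (auto simp: N_def)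
    then have "x \<oplus> y = (r + r') \<odot> z'" using z'c by (simp add: smult_add)
    then show ?thesis by (auto simp: N_def)
  qed
  have Nsmult: "r \<odot> x \<in> N" if "x \<in> N" for r x
  proof -
    obtain r' where "x = r' \<odot> z'" using \<open>x \<in> N\<close> by (auto simp: N_def)
    then have "r \<odot> x = (r * r') \<odot> z'" using z'c by (simp add: smult_mult)
    then show ?thesis by (auto simp: N_def)
  qed
  have Nc: "N \<subseteq> carrier M" using z'c by (auto simp: N_def)
  have z'N: "z' \<in> N" using z'c smult_1 unfolding N_def by (metis (mono_tags, lifting) mem_Collect_eq)
  have N0: "\<zero> \<in> N" using Nsmult[OF z'N, of 0] z'c by simp
  have Nproj: "\<exists>\<beta> m. proj v x = Poly_Mapping.single \<beta> m \<odot> z'" if "x \<in> N" for v x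
    using proj_smult_term[OF z', of v] \<open>x \<in> N\<close> by (auto simp: N_def)
  have graded: "is_graded_module (?S a)" for a
  proof (rule graded_shift[OF Nc N0 Nadd Nsmult])
    show "proj u x \<in> N" if "x \<in> N" for u x using Nproj[OF that, of u] Nsmult[OF z'N] by auto
  qed
  \<comment> \<open>The exponent is \<open>Suc s\<close> because \<open>z'\<close> has degree
    \<open>s \<alpha> + w\<close>: division by a term of degree \<open>(s + 1) \<alpha>\<close>
    brings it to the required degree \<open>w - \<alpha>\<close>.\<close>
  let ?g = "?f ^ Suc s"
  obtain \<gamma> where \<gamma>: "\<And>k. Poly_Mapping.lookup \<gamma> k = Suc s * Poly_Mapping.lookup \<alpha> k"
    "?g = Poly_Mapping.single \<gamma> (c ^ Suc s)"
    using single_power[of "Suc s" \<alpha> c] by blast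
  \<comment> \<open>It suffices to treat homogeneous parts. Each is a term times \<open>z'\<close>,
    which is the situation of \<open>stable_annihilator\<close>.\<close>
  have ker: "x = \<zero>" if x: "x \<in> N" "?g \<odot> x = \<zero>" for x
  proof (rule proj_eq_zero)
    show xc: "x \<in> carrier M" using x Nc by auto
    fix v
    obtain \<beta> m where m: "proj v x = Poly_Mapping.single \<beta> m \<odot> z'" using Nproj[OF x(1)] by blast
    have "?g \<odot> proj v x = \<zero>" using proj_single[OF xc, of \<gamma> v "c ^ Suc s"] x(2) \<gamma>(2) by simp
    then have "(?f ^ (s + Suc s) * Poly_Mapping.single \<beta> m) \<odot> z = \<zero>"
      unfolding m z'_def smult_mult[OF zc, symmetric] by (simp add: power_add mult_ac)
    then have "(?f ^ s * Poly_Mapping.single \<beta> m) \<odot> z = \<zero>" by (rule s)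
    then show "proj v x = \<zero>" unfolding m z'_def smult_mult[OF zc, symmetric] by (simp add: mult.commute)
  qed
  have inj_g: "inj_on (\<lambda>x. ?g \<odot> x) N"
  proof (rule inj_onI)
    fix x y assume xy: "x \<in> N" "y \<in> N" "?g \<odot> x = ?g \<odot> y"
    then have c: "x \<in> carrier M" "y \<in> carrier M" using Nc by auto
    have "\<ominus> y \<in> N" using Nsmult[OF xy(2), of "-1"] smult_l_minus[of 1 y] c by simp
    then have "x \<ominus> y \<in> N" using Nadd xy(1) by (simp add: minus_eq)
    moreover have "?g \<odot> (x \<ominus> y) = \<zero>"
      unfolding smult_minus[OF c] xy(3) by (rule minus_self) (use c in simp)
    ultimately have "x \<ominus> y = \<zero>" by (rule ker)
    then show "x = y" using c minus_eq_zero by blast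
  qed
  define a where "a k = int (Suc s) * int (Poly_Mapping.lookup \<alpha> k)" for k
  have g_hom: "(\<lambda>x. ?g \<odot> x) \<in> graded_hom (?S (\<lambda>_. 0)) (?S a)"
  proof -
    have "?g \<odot> x \<in> component M (\<lambda>k. a k + v k)" if "x \<in> component M v" for x v
      unfolding a_def by (rule comp_power[OF that])
    moreover have "?g \<odot> (r \<odot> x) = r \<odot> (?g \<odot> x)" if "x \<in> N" for r x
      using that Nc by (auto simp: smult_mult[symmetric] mult_ac)
    ultimately show ?thesis using Nsmult Nc
      by (auto simp: graded_hom_def mod_hom_def smult_distr subset_iff simp del: power_Suc)
  qed
  have id_hom: "(\<lambda>x. x) \<in> graded_hom (?S (\<lambda>_. 0)) M"
    using Nc by (auto simp: graded_hom_def mod_hom_def)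
  have inj_g': "inj_on (\<lambda>x. ?g \<odot> x) (carrier (?S (\<lambda>_. 0)))" using inj_g by simp
  \<comment> \<open>The inclusion of \<open>N\<close> in \<open>M\<close> is extended along the
    embedding \<open>x \<mapsto> g x\<close> of \<open>N\<close> in its twist. The result
    \<open>e\<close> divides by \<open>g\<close>, and it is defined on \<open>z'\<close> even where
    \<open>z'\<close> is no multiple of \<open>g\<close> in \<open>N\<close>.\<close>
  have "\<exists>e\<in>graded_hom (?S a) M. \<forall>x\<in>carrier (?S (\<lambda>_. 0)). e (?g \<odot> x) = x"
    by (rule inj[unfolded graded_injective_def, THEN conjunct2, rule_format,
        of "?S (\<lambda>_. 0)" "?S a" "\<lambda>x. ?g \<odot> x" "\<lambda>x. x"]) (intro conjI graded g_hom inj_g' id_hom)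
  then obtain e where e: "e \<in> graded_hom (?S a) M" and "\<forall>x\<in>carrier (?S (\<lambda>_. 0)). e (?g \<odot> x) = x"
    by blast
  then have eg: "e (?g \<odot> x) = x" if "x \<in> N" for x using that by simp
  have e_smult: "e (r \<odot> x) = r \<odot> e x" if "x \<in> N" for r x
    using e that by (auto simp: graded_hom_def mod_hom_def)
  have "e ` component (?S a) (\<lambda>k. w k - int (Poly_Mapping.lookup \<alpha> k)) \<subseteq>
      component M (\<lambda>k. w k - int (Poly_Mapping.lookup \<alpha> k))"
    using e unfolding graded_hom_def by blast
  moreover have "(\<lambda>k. a k + (w k - int (Poly_Mapping.lookup \<alpha> k))) =
      (\<lambda>k. int s * int (Poly_Mapping.lookup \<alpha> k) + w k)"
    by (simp add: a_def algebra_simps)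
  ultimately have "e z' \<in> component M (\<lambda>k. w k - int (Poly_Mapping.lookup \<alpha> k))"
    using z' z'N by auto
  moreover have "?g \<odot> e z' = ?f ^ s \<odot> z" using eg[OF z'N] e_smult[OF z'N] by (simp add: z'_def)
  moreover have "r \<odot> e z' = \<zero>" if "r \<odot> z = \<zero>" for r
  proof -
    have "r \<odot> z' = ?f ^ s \<odot> (r \<odot> z)" using zc by (simp add: z'_def smult_mult[symmetric] mult.commute)
    then have "r \<odot> z' = \<zero>" using that by simp
    then have "r \<odot> e z' = e \<zero>" using e_smult[OF z'N] by metis
    also have "e \<zero> = \<zero>" using eg[OF N0] by simp
    finally show ?thesis .
  qed
  ultimately show ?thesis by blast
qed

end

section \<open>Equality in a localisation, and torsion\<close>

context gmod begin

text \<open>Equality of the images of \<open>x\<close> and \<open>y\<close> in the localisation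
  \<open>M_f\<close>, expressed without that module. Accordingly \<open>feq f x \<zero>\<close> says
  that \<open>x\<close> is \<open>f\<close>-torsion.\<close>

definition feq :: "('n, 'a) mpoly \<Rightarrow> 'm \<Rightarrow> 'm \<Rightarrow> bool" where
  "feq f x y \<longleftrightarrow> (\<exists>t. f ^ t \<odot> x = f ^ t \<odot> y)"

definition tors :: "('n, 'a) mpoly set \<Rightarrow> ('n \<Rightarrow> int) \<Rightarrow> 'm set" where
  "tors F v = {x \<in> component M v. \<forall>f\<in>F. feq f x \<zero>}"

lemma feq_refl: "feq f x x"
  by (simp add: feq_def)

lemma feq_sym: "feq f x y \<Longrightarrow> feq f y x"
  unfolding feq_def by metis

lemma power_smult_mono:
  assumes "f ^ t \<odot> x = f ^ t \<odot> y" "x \<in> carrier M" "y \<in> carrier M"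
  shows "f ^ (s + t) \<odot> x = f ^ (s + t) \<odot> y"
  using assms by (simp add: power_add smult_mult)

lemma feq_trans:
  assumes "feq f x y" "feq f y z" "x \<in> carrier M" "y \<in> carrier M" "z \<in> carrier M"
  shows "feq f x z"
proof -
  obtain s t where st: "f ^ s \<odot> x = f ^ s \<odot> y" "f ^ t \<odot> y = f ^ t \<odot> z" using assms by (auto simp: feq_def)
  have "f ^ (t + s) \<odot> x = f ^ (t + s) \<odot> y" by (rule power_smult_mono) (use st assms in auto)
  also have "\<dots> = f ^ (s + t) \<odot> y" by (simp add: add.commute)
  also have "\<dots> = f ^ (s + t) \<odot> z" by (rule power_smult_mono) (use st assms in auto)
  finally show ?thesis unfolding feq_def by (metis add.commute)
qed

lemma smult_commute: "x \<in> carrier M \<Longrightarrow> r \<odot> (s \<odot> x) = s \<odot> (r \<odot> x)"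
  by (simp add: smult_mult[symmetric] mult.commute)

lemma feq_smult: "feq f x y \<Longrightarrow> x \<in> carrier M \<Longrightarrow> y \<in> carrier M \<Longrightarrow> feq f (r \<odot> x) (r \<odot> y)"
  unfolding feq_def by (metis smult_commute)

lemma feq_add:
  assumes "feq f x y" "feq f x' y'" "x \<in> carrier M" "y \<in> carrier M" "x' \<in> carrier M" "y' \<in> carrier M"
  shows "feq f (x \<oplus> x') (y \<oplus> y')"
proof -
  obtain s t where st: "f ^ s \<odot> x = f ^ s \<odot> y" "f ^ t \<odot> x' = f ^ t \<odot> y'"
    using assms by (auto simp: feq_def)
  have "f ^ (t + s) \<odot> x = f ^ (t + s) \<odot> y" by (rule power_smult_mono) (use st assms in auto)
  moreover have "f ^ (s + t) \<odot> x' = f ^ (s + t) \<odot> y'" by (rule power_smult_mono) (use st assms in auto)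
  ultimately have "f ^ (t + s) \<odot> (x \<oplus> x') = f ^ (t + s) \<odot> (y \<oplus> y')"
    using assms by (simp add: smult_distr add.commute)
  then show ?thesis unfolding feq_def by blast
qed

lemma feq_neg: "feq f x y \<Longrightarrow> x \<in> carrier M \<Longrightarrow> y \<in> carrier M \<Longrightarrow> feq f (\<ominus> x) (\<ominus> y)"
  unfolding feq_def by (metis smult_neg)

lemma feq_minus:
  assumes "feq f x y" "feq f x' y'" "x \<in> carrier M" "y \<in> carrier M" "x' \<in> carrier M" "y' \<in> carrier M"
  shows "feq f (x \<ominus> x') (y \<ominus> y')"
  unfolding minus_eq using assms by (intro feq_add feq_neg) auto

lemma feq_minus_zero:
  assumes "feq f x y" "x \<in> carrier M" "y \<in> carrier M"
  shows "feq f (x \<ominus> y) \<zero>"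
  using feq_minus[OF assms(1) feq_refl[of f y]] assms minus_self by simp

lemma feq_cancel:
  assumes "feq f (f ^ n \<odot> x) (f ^ n \<odot> y)" "x \<in> carrier M" "y \<in> carrier M"
  shows "feq f x y"
proof -
  obtain t where "f ^ t \<odot> (f ^ n \<odot> x) = f ^ t \<odot> (f ^ n \<odot> y)" using assms(1) by (auto simp: feq_def)
  then have "f ^ (t + n) \<odot> x = f ^ (t + n) \<odot> y" using assms(2,3) by (simp add: power_add smult_mult)
  then show ?thesis unfolding feq_def by blast
qed

lemma tors_component: "x \<in> tors F v \<Longrightarrow> x \<in> component M v"
  by (simp add: tors_def)

lemma tors_carrier: "x \<in> tors F v \<Longrightarrow> x \<in> carrier M"
  using tors_component comp_carrier by blast

lemma tors_zero: "\<zero> \<in> tors F v"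
  by (simp add: tors_def feq_refl)

lemma tors_add: "x \<in> tors F v \<Longrightarrow> y \<in> tors F v \<Longrightarrow> x \<oplus> y \<in> tors F v"
  using feq_add[of _ x \<zero> y \<zero>] tors_carrier[of x F v] tors_carrier[of y F v] by (simp add: tors_def)

lemma tors_minus: "x \<in> tors F v \<Longrightarrow> y \<in> tors F v \<Longrightarrow> x \<ominus> y \<in> tors F v"
  using feq_minus[of _ x \<zero> y \<zero>] tors_carrier[of x F v] tors_carrier[of y F v] minus_self[of \<zero>]
  by (simp add: tors_def)

lemma tors_single: "x \<in> tors F v \<Longrightarrow> Poly_Mapping.single \<alpha> c \<odot> x \<in> tors F (shift \<alpha> v)"
  using feq_smult[of _ x \<zero> "Poly_Mapping.single \<alpha> c"] tors_carrier[of x F v] comp_single[of x v \<alpha> c]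
  by (simp add: tors_def)

lemma tors_power: "x \<in> tors F v \<Longrightarrow>
    Poly_Mapping.single \<alpha> c ^ s \<odot> x \<in> tors F (\<lambda>k. int s * int (Poly_Mapping.lookup \<alpha> k) + v k)"
  using feq_smult[of _ x \<zero> "Poly_Mapping.single \<alpha> c ^ s"] tors_carrier[of x F v] comp_power[of x v \<alpha> c s]
  by (simp add: tors_def)

lemma tors_insert: "x \<in> tors (insert f F) v \<longleftrightarrow> x \<in> tors F v \<and> feq f x \<zero>"
  by (auto simp: tors_def)

end

section \<open>Degree-preserving homomorphisms\<close>

locale gmod_hom = M: gmod M + N: gmod N
  for M :: "(('n::finite, 'a::idom) mpoly, 'm, 'n) graded_module"
    and N :: "(('n, 'a) mpoly, 'k, 'n) graded_module" +
  fixes h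
  assumes hom: "h \<in> graded_hom M N"
begin

lemma closed: "x \<in> carrier M \<Longrightarrow> h x \<in> carrier N"
  using hom by (auto simp: graded_hom_def mod_hom_def)

lemma add: "x \<in> carrier M \<Longrightarrow> y \<in> carrier M \<Longrightarrow> h (x \<oplus>\<^bsub>M\<^esub> y) = h x \<oplus>\<^bsub>N\<^esub> h y"
  using hom by (auto simp: graded_hom_def mod_hom_def)

lemma smult: "x \<in> carrier M \<Longrightarrow> h (r \<odot>\<^bsub>M\<^esub> x) = r \<odot>\<^bsub>N\<^esub> h x"
  using hom by (auto simp: graded_hom_def mod_hom_def)

lemma comp: "x \<in> component M u \<Longrightarrow> h x \<in> component N u"
  using hom by (auto simp: graded_hom_def)

lemma zero: "h \<zero>\<^bsub>M\<^esub> = \<zero>\<^bsub>N\<^esub>"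
  using smult[of "\<zero>\<^bsub>M\<^esub>" 0] closed[of "\<zero>\<^bsub>M\<^esub>"] by simp

lemma neg:
  assumes "x \<in> carrier M"
  shows "h (\<ominus>\<^bsub>M\<^esub> x) = \<ominus>\<^bsub>N\<^esub> h x"
  using smult[OF assms, of "- 1"] M.smult_l_minus[of 1 x] N.smult_l_minus[of 1 "h x"] assms closed[OF assms]
  by simp

lemma minus: "x \<in> carrier M \<Longrightarrow> y \<in> carrier M \<Longrightarrow> h (x \<ominus>\<^bsub>M\<^esub> y) = h x \<ominus>\<^bsub>N\<^esub> h y"
  by (simp add: M.minus_eq N.minus_eq add neg)

lemma feq: "M.feq f x y \<Longrightarrow> x \<in> carrier M \<Longrightarrow> y \<in> carrier M \<Longrightarrow> N.feq f (h x) (h y)"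
  unfolding M.feq_def N.feq_def by (metis smult)

lemma tors: "x \<in> M.tors F v \<Longrightarrow> h x \<in> N.tors F v"
  using feq[of _ x "\<zero>\<^bsub>M\<^esub>"] M.tors_carrier[of x F v] comp[of x v] by (auto simp: M.tors_def N.tors_def zero)

lemma finsum:
  assumes "finite A" "\<And>u. u \<in> A \<Longrightarrow> c u \<in> carrier M"
  shows "h (finsum M c A) = finsum N (\<lambda>u. h (c u)) A"
  using assms
proof (induction A)
  case empty
  then show ?case by (simp add: zero)
next
  case (insert u A)
  then show ?case using closed by (simp add: M.M.finsum_insert N.M.finsum_insert Pi_iff add M.M.finsum_closed)
qed

text \<open>Used to replace a preimage of a homogeneous element by a homogeneous one.\<close>

lemma proj:
  assumes "x \<in> carrier M"
  shows "h (M.proj u x) = N.proj u (h x)"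
proof (rule sym, rule N.proj_unique[where A = "{u. M.proj u x \<noteq> \<zero>\<^bsub>M\<^esub>}"])
  have "h x = h (finsum M (\<lambda>u. M.proj u x) {u. M.proj u x \<noteq> \<zero>\<^bsub>M\<^esub>})"
    using M.proj_decomp(3)[OF assms] by simp
  then show "h x = (\<Oplus>\<^bsub>N\<^esub>u\<in>{u. M.proj u x \<noteq> \<zero>\<^bsub>M\<^esub>}. h (M.proj u x))"
    using finsum[OF M.proj_decomp(2)[OF assms], of "\<lambda>u. M.proj u x"] assms by simp
qed (use M.proj_decomp[OF assms] comp zero in auto)

end

abbreviation up :: "'n \<Rightarrow> ('n \<Rightarrow> int) \<Rightarrow> 'n \<Rightarrow> int" where
  "up k v \<equiv> shift (Poly_Mapping.single k 1) v"

abbreviation var :: "'n \<Rightarrow> ('n, 'a::comm_ring_1) mpoly" where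
  "var k \<equiv> Poly_Mapping.single (Poly_Mapping.single k 1) 1"

lemma single_split_var:
  assumes "Poly_Mapping.lookup \<alpha> k \<noteq> 0"
  obtains \<beta> where "\<alpha> = Poly_Mapping.single k 1 + \<beta>"
    "\<And>c. Poly_Mapping.single \<alpha> c = var k * Poly_Mapping.single \<beta> (c::'a::comm_ring_1)"
proof -
  have "\<alpha> = Poly_Mapping.single k 1 + (\<alpha> - Poly_Mapping.single k 1)"
    using assms by (intro poly_mapping_eqI) (auto simp: lookup_add lookup_minus lookup_single when_def)
  then show ?thesis using that[of "\<alpha> - Poly_Mapping.single k 1"] by (metis mult_1 mult_single)
qed

subsection \<open>Complexes of graded modules with torsion\<close>

text \<open>Integer indices make \<open>j - 1\<close> and \<open>j - 2\<close> available everywhere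
  in a diagram chase. The assumption \<open>div\<close> is the conclusion of
  \<open>divisible\<close>, the form in which injectivity enters the induction.\<close>

locale gcomplex =
  fixes E :: "int \<Rightarrow> (('n::finite, 'a::idom) mpoly, 'm, 'n) graded_module"
    and d :: "int \<Rightarrow> 'm \<Rightarrow> 'm"
  assumes gmodE: "gmod (E j)"
    and d_hom: "d j \<in> graded_hom (E j) (E (j + 1))"
    and d_d: "x \<in> carrier (E j) \<Longrightarrow> d (j + 1) (d j x) = \<zero>\<^bsub>E (j + 1 + 1)\<^esub>"
    and div: "z \<in> component (E j) w \<Longrightarrow>
      \<exists>s. \<exists>y\<in>component (E j) (\<lambda>k. w k - int (Poly_Mapping.lookup \<alpha> k)).
        Poly_Mapping.single \<alpha> c ^ Suc s \<odot>\<^bsub>E j\<^esub> y = Poly_Mapping.single \<alpha> c ^ s \<odot>\<^bsub>E j\<^esub> z \<and>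
        (\<forall>r. r \<odot>\<^bsub>E j\<^esub> z = \<zero>\<^bsub>E j\<^esub> \<longrightarrow> r \<odot>\<^bsub>E j\<^esub> y = \<zero>\<^bsub>E j\<^esub>)"
begin

abbreviation C :: "('n, 'a) mpoly set \<Rightarrow> int \<Rightarrow> ('n \<Rightarrow> int) \<Rightarrow> 'm set" where
  "C F j v \<equiv> gmod.tors (E j) F v"

lemma d_gmod_hom: "gmod_hom (E j) (E (j + 1)) (d j)"
  by (intro gmod_hom.intro gmodE gmod_hom_axioms.intro d_hom)

lemma d_gmod_hom': "gmod_hom (E (j - 1)) (E j) (d (j - 1))"
  using d_gmod_hom[of "j - 1"] by simp

lemma d_d': "x \<in> carrier (E (j - 1)) \<Longrightarrow> d j (d (j - 1) x) = \<zero>\<^bsub>E (j + 1)\<^esub>"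
  using d_d[of x "j - 1"] by simp

text \<open>The fraction \<open>z / f ^ n\<close> is represented by an element of the same torsion
  subcomplex. As \<open>f ^ n\<close> is again a term, \<open>div\<close> applies to it directly,
  and its annihilator clause puts \<open>y\<close> into the \<open>F\<close>-torsion.\<close>

lemma divide:
  assumes z: "z \<in> C F j (\<lambda>k. int n * int (Poly_Mapping.lookup \<alpha> k) + w k)"
  shows "\<exists>y\<in>C F j w. gmod.feq (E j) (Poly_Mapping.single \<alpha> c) (Poly_Mapping.single \<alpha> c ^ n \<odot>\<^bsub>E j\<^esub> y) z"
proof -
  interpret M: gmod "E j" by (rule gmodE)
  let ?f = "Poly_Mapping.single \<alpha> c"
  obtain \<gamma> where \<gamma>: "\<And>k. Poly_Mapping.lookup \<gamma> k = n * Poly_Mapping.lookup \<alpha> k"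
    "?f ^ n = Poly_Mapping.single \<gamma> (c ^ n)" using single_power[of n \<alpha> c] by blast
  obtain s y where y: "y \<in> component (E j) w" "(?f ^ n) ^ Suc s \<odot>\<^bsub>E j\<^esub> y = (?f ^ n) ^ s \<odot>\<^bsub>E j\<^esub> z"
    "\<And>r. r \<odot>\<^bsub>E j\<^esub> z = \<zero>\<^bsub>E j\<^esub> \<Longrightarrow> r \<odot>\<^bsub>E j\<^esub> y = \<zero>\<^bsub>E j\<^esub>"
    using div[OF M.tors_component[OF z], of \<gamma> "c ^ n"] \<gamma> by auto
  have "M.feq g y \<zero>\<^bsub>E j\<^esub>" if "g \<in> F" for g
    using z y(3) that unfolding M.tors_def M.feq_def M.smult_zero by blast
  then have "y \<in> C F j w" using y(1) by (simp add: M.tors_def)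
  moreover have "?f ^ (n * s) \<odot>\<^bsub>E j\<^esub> (?f ^ n \<odot>\<^bsub>E j\<^esub> y) = ?f ^ (n * s) \<odot>\<^bsub>E j\<^esub> z"
    using y(2) M.comp_carrier[OF y(1)] by (simp add: M.smult_mult[symmetric] power_mult mult.commute)
  ultimately show ?thesis unfolding M.feq_def by blast
qed

text \<open>For the cohomology of the \<open>F\<close>-torsion subcomplex, the first conjunct is
  surjectivity and the second injectivity of the variable \<open>k\<close> from degree
  \<open>v\<close> to the next. Both are phrased with cocycles and coboundaries, which is what the
  diagram chases handle.\<close>

definition straight_at :: "('n, 'a) mpoly set \<Rightarrow> int \<Rightarrow> 'n \<Rightarrow> ('n \<Rightarrow> int) \<Rightarrow> bool" where
  "straight_at F j k v \<longleftrightarrow>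
     (\<forall>z\<in>C F j (up k v). d j z = \<zero>\<^bsub>E (j + 1)\<^esub> \<longrightarrow>
        (\<exists>w\<in>C F j v. \<exists>y\<in>C F (j - 1) (up k v).
          d j w = \<zero>\<^bsub>E (j + 1)\<^esub> \<and> var k \<odot>\<^bsub>E j\<^esub> w = z \<oplus>\<^bsub>E j\<^esub> d (j - 1) y)) \<and>
     (\<forall>z\<in>C F j v. \<forall>y\<in>C F (j - 1) (up k v).
        d j z = \<zero>\<^bsub>E (j + 1)\<^esub> \<longrightarrow> var k \<odot>\<^bsub>E j\<^esub> z = d (j - 1) y \<longrightarrow>
        (\<exists>y\<in>C F (j - 1) v. z = d (j - 1) y))"

definition straight :: "('n, 'a) mpoly set \<Rightarrow> bool" where
  "straight F \<longleftrightarrow> (\<forall>j k v. v k \<noteq> -1 \<longrightarrow> straight_at F j k v)"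

lemma straight_surj:
  assumes "straight F" "v k \<noteq> -1" "z \<in> C F j (up k v)" "d j z = \<zero>\<^bsub>E (j + 1)\<^esub>"
  obtains w y where "w \<in> C F j v" "y \<in> C F (j - 1) (up k v)" "d j w = \<zero>\<^bsub>E (j + 1)\<^esub>"
    "var k \<odot>\<^bsub>E j\<^esub> w = z \<oplus>\<^bsub>E j\<^esub> d (j - 1) y"
  using assms unfolding straight_def straight_at_def by blast

lemma straight_inj:
  assumes "straight F" "v k \<noteq> -1" "z \<in> C F j v" "y \<in> C F (j - 1) (up k v)" "d j z = \<zero>\<^bsub>E (j + 1)\<^esub>"
    "var k \<odot>\<^bsub>E j\<^esub> z = d (j - 1) y"
  obtains y' where "y' \<in> C F (j - 1) v" "z = d (j - 1) y'"
  using assms unfolding straight_def straight_at_def by blast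

text \<open>The quotient of the complex by its \<open>f\<close>-torsion is its localisation at \<open>f\<close>, by lemma \<open>divide\<close>.
  The next two lemmas say that the localisation is straight again: a cocycle over it is transported
  by a power of \<open>f\<close> to degree \<open>n \<alpha> + v\<close> if \<open>f\<close> does not involve the variable \<open>k\<close>, and otherwise this
  variable acts invertibly.\<close>

lemma loc_surj:
  assumes F: "straight F" and v: "v k \<noteq> -1" and z: "z \<in> C F j (up k v)"
    and f: "f = Poly_Mapping.single \<alpha> c" and dz: "gmod.feq (E (j + 1)) f (d j z) \<zero>\<^bsub>E (j + 1)\<^esub>"
  obtains w y where "w \<in> C F j v" "y \<in> C F (j - 1) (up k v)"
    "gmod.feq (E (j + 1)) f (d j w) \<zero>\<^bsub>E (j + 1)\<^esub>"
    "gmod.feq (E j) f (var k \<odot>\<^bsub>E j\<^esub> w) (z \<oplus>\<^bsub>E j\<^esub> d (j - 1) y)"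
proof -
  interpret D: gmod_hom "E j" "E (j + 1)" "d j" by (rule d_gmod_hom)
  interpret D': gmod_hom "E (j - 1)" "E j" "d (j - 1)" by (rule d_gmod_hom')
  note zc = D.M.tors_carrier[OF z]
  show ?thesis
  proof (cases "Poly_Mapping.lookup \<alpha> k = 0")
    case True
    \<comment> \<open>\<open>z\<close> is a cocycle only up to \<open>f\<close>-torsion; multiplying
      by \<open>f ^ t\<close> makes it a cocycle of the complex itself, to which straightness
      applies.\<close>
    obtain t where t: "f ^ t \<odot>\<^bsub>E (j + 1)\<^esub> d j z = \<zero>\<^bsub>E (j + 1)\<^esub>" using dz by (auto simp: D.N.feq_def)
    let ?v = "\<lambda>l. int t * int (Poly_Mapping.lookup \<alpha> l) + v l"
    have up: "(\<lambda>l. int t * int (Poly_Mapping.lookup \<alpha> l) + up k v l) = up k ?v" by (simp add: algebra_simps)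
    have 1: "f ^ t \<odot>\<^bsub>E j\<^esub> z \<in> C F j (up k ?v)"
      using D.M.tors_power[OF z, of \<alpha> c t] unfolding up f .
    have 2: "?v k \<noteq> -1" using True v by simp
    have 3: "d j (f ^ t \<odot>\<^bsub>E j\<^esub> z) = \<zero>\<^bsub>E (j + 1)\<^esub>" using t zc by (simp add: D.smult)
    obtain w1 y1 where w1: "w1 \<in> C F j ?v" "y1 \<in> C F (j - 1) (up k ?v)" "d j w1 = \<zero>\<^bsub>E (j + 1)\<^esub>"
      "var k \<odot>\<^bsub>E j\<^esub> w1 = f ^ t \<odot>\<^bsub>E j\<^esub> z \<oplus>\<^bsub>E j\<^esub> d (j - 1) y1"
      by (rule straight_surj[OF F 2 1 3])
    obtain w where w: "w \<in> C F j v" "D.M.feq f (f ^ t \<odot>\<^bsub>E j\<^esub> w) w1"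
      using divide[OF w1(1)] f by blast
    obtain y where y: "y \<in> C F (j - 1) (up k v)" "D'.M.feq f (f ^ t \<odot>\<^bsub>E (j - 1)\<^esub> y) y1"
      using divide[OF w1(2)[folded up], of c] f by blast
    note cs = zc D.M.tors_carrier[OF w1(1)] D'.M.tors_carrier[OF w1(2)] D.M.tors_carrier[OF w(1)]
      D'.M.tors_carrier[OF y(1)]
    have "D.N.feq f (f ^ t \<odot>\<^bsub>E (j + 1)\<^esub> d j w) (f ^ t \<odot>\<^bsub>E (j + 1)\<^esub> \<zero>\<^bsub>E (j + 1)\<^esub>)"
      using D.feq[OF w(2)] cs w1(3) by (simp add: D.smult)
    then have a: "D.N.feq f (d j w) \<zero>\<^bsub>E (j + 1)\<^esub>" by (rule D.N.feq_cancel) (use cs D.closed in auto)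
    have "D.M.feq f (f ^ t \<odot>\<^bsub>E j\<^esub> (var k \<odot>\<^bsub>E j\<^esub> w)) (f ^ t \<odot>\<^bsub>E j\<^esub> z \<oplus>\<^bsub>E j\<^esub> d (j - 1) y1)"
      using D.M.feq_smult[OF w(2), of "var k"] cs w1(4) by (simp add: D.M.smult_commute)
    moreover have "D.M.feq f (f ^ t \<odot>\<^bsub>E j\<^esub> z \<oplus>\<^bsub>E j\<^esub> d (j - 1) y1)
        (f ^ t \<odot>\<^bsub>E j\<^esub> (z \<oplus>\<^bsub>E j\<^esub> d (j - 1) y))"
      using D'.feq[OF y(2)] cs
      by (simp add: D.M.smult_distr D'.smult D'.closed D.M.feq_add D.M.feq_refl D.M.feq_sym)
    ultimately have "D.M.feq f (f ^ t \<odot>\<^bsub>E j\<^esub> (var k \<odot>\<^bsub>E j\<^esub> w)) (f ^ t \<odot>\<^bsub>E j\<^esub> (z \<oplus>\<^bsub>E j\<^esub> d (j - 1) y))"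
      by (rule D.M.feq_trans) (use cs D'.closed in auto)
    then have b: "D.M.feq f (var k \<odot>\<^bsub>E j\<^esub> w) (z \<oplus>\<^bsub>E j\<^esub> d (j - 1) y)"
      by (rule D.M.feq_cancel) (use cs D'.closed in auto)
    show ?thesis by (rule that[OF w(1) y(1) a b])
  next
    case False
    obtain \<beta> where \<beta>: "\<alpha> = Poly_Mapping.single k 1 + \<beta>" "f = var k * Poly_Mapping.single \<beta> c"
      using single_split_var[OF False] f by metis
    let ?h = "Poly_Mapping.single \<beta> c :: ('n, 'a) mpoly"
    have "shift \<beta> (up k v) = (\<lambda>l. int 1 * int (Poly_Mapping.lookup \<alpha> l) + v l)"
      by (simp add: \<beta>(1) lookup_add algebra_simps)
    then have "?h \<odot>\<^bsub>E j\<^esub> z \<in> C F j (\<lambda>l. int 1 * int (Poly_Mapping.lookup \<alpha> l) + v l)"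
      using D.M.tors_single[OF z, of \<beta> c] by simp
    then obtain w where w: "w \<in> C F j v" "D.M.feq f (f ^ 1 \<odot>\<^bsub>E j\<^esub> w) (?h \<odot>\<^bsub>E j\<^esub> z)"
      using divide[where c = c] f by blast
    note cs = zc D.M.tors_carrier[OF w(1)]
    have "D.N.feq f (f ^ 1 \<odot>\<^bsub>E (j + 1)\<^esub> d j w) (?h \<odot>\<^bsub>E (j + 1)\<^esub> d j z)"
      using D.feq[OF w(2)] cs by (simp add: D.smult)
    moreover have "D.N.feq f (?h \<odot>\<^bsub>E (j + 1)\<^esub> d j z) (f ^ 1 \<odot>\<^bsub>E (j + 1)\<^esub> \<zero>\<^bsub>E (j + 1)\<^esub>)"
      using D.N.feq_smult[OF dz, of ?h] cs by (simp add: D.closed)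
    ultimately have "D.N.feq f (f ^ 1 \<odot>\<^bsub>E (j + 1)\<^esub> d j w) (f ^ 1 \<odot>\<^bsub>E (j + 1)\<^esub> \<zero>\<^bsub>E (j + 1)\<^esub>)"
      by (rule D.N.feq_trans) (use cs D.closed in auto)
    then have a: "D.N.feq f (d j w) \<zero>\<^bsub>E (j + 1)\<^esub>" by (rule D.N.feq_cancel) (use cs D.closed in auto)
    have "D.M.feq f (f ^ 1 \<odot>\<^bsub>E j\<^esub> (var k \<odot>\<^bsub>E j\<^esub> w)) (f ^ 1 \<odot>\<^bsub>E j\<^esub> z)"
      using D.M.feq_smult[OF w(2), of "var k"] cs
      by (simp add: \<beta>(2) D.M.smult_commute D.M.smult_mult mult.assoc)
    then have "D.M.feq f (var k \<odot>\<^bsub>E j\<^esub> w) z" by (rule D.M.feq_cancel) (use cs in auto)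
    then have b: "D.M.feq f (var k \<odot>\<^bsub>E j\<^esub> w) (z \<oplus>\<^bsub>E j\<^esub> d (j - 1) \<zero>\<^bsub>E (j - 1)\<^esub>)"
      using cs by (simp add: D'.zero)
    show ?thesis by (rule that[OF w(1) D'.M.tors_zero a b])
  qed
qed

lemma loc_inj:
  assumes F: "straight F" and v: "v k \<noteq> -1" and z: "z \<in> C F j v" and y: "y \<in> C F (j - 1) (up k v)"
    and f: "f = Poly_Mapping.single \<alpha> c" and dz: "gmod.feq (E (j + 1)) f (d j z) \<zero>\<^bsub>E (j + 1)\<^esub>"
    and zy: "gmod.feq (E j) f (var k \<odot>\<^bsub>E j\<^esub> z) (d (j - 1) y)"
  obtains y' where "y' \<in> C F (j - 1) v" "gmod.feq (E j) f z (d (j - 1) y')"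
proof -
  interpret D: gmod_hom "E j" "E (j + 1)" "d j" by (rule d_gmod_hom)
  interpret D': gmod_hom "E (j - 1)" "E j" "d (j - 1)" by (rule d_gmod_hom')
  note zc = D.M.tors_carrier[OF z] D'.M.tors_carrier[OF y]
  show ?thesis
  proof (cases "Poly_Mapping.lookup \<alpha> k = 0")
    case True
    obtain t1 t2 where t12: "f ^ t1 \<odot>\<^bsub>E (j + 1)\<^esub> d j z = f ^ t1 \<odot>\<^bsub>E (j + 1)\<^esub> \<zero>\<^bsub>E (j + 1)\<^esub>"
      "f ^ t2 \<odot>\<^bsub>E j\<^esub> (var k \<odot>\<^bsub>E j\<^esub> z) = f ^ t2 \<odot>\<^bsub>E j\<^esub> d (j - 1) y"
      using dz zy unfolding D.N.feq_def D.M.feq_def by blast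
    define t where "t = t1 + t2"
    have t1: "f ^ t \<odot>\<^bsub>E (j + 1)\<^esub> d j z = \<zero>\<^bsub>E (j + 1)\<^esub>"
      using D.N.power_smult_mono[OF t12(1) D.closed[OF zc(1)] D.N.M.zero_closed, of t2]
      unfolding t_def add.commute[of t1 t2] by simp
    have t2: "f ^ t \<odot>\<^bsub>E j\<^esub> (var k \<odot>\<^bsub>E j\<^esub> z) = f ^ t \<odot>\<^bsub>E j\<^esub> d (j - 1) y"
      using D.M.power_smult_mono[OF t12(2), of t1] zc by (simp add: D'.closed t_def)
    let ?v = "\<lambda>l. int t * int (Poly_Mapping.lookup \<alpha> l) + v l"
    have up: "(\<lambda>l. int t * int (Poly_Mapping.lookup \<alpha> l) + up k v l) = up k ?v" by (simp add: algebra_simps)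
    have 1: "f ^ t \<odot>\<^bsub>E j\<^esub> z \<in> C F j ?v" "f ^ t \<odot>\<^bsub>E (j - 1)\<^esub> y \<in> C F (j - 1) (up k ?v)"
      using D.M.tors_power[OF z, of \<alpha> c t] D'.M.tors_power[OF y, of \<alpha> c t] unfolding up f .
    have 2: "?v k \<noteq> -1" using True v by simp
    have 3: "d j (f ^ t \<odot>\<^bsub>E j\<^esub> z) = \<zero>\<^bsub>E (j + 1)\<^esub>" using t1 zc by (simp add: D.smult)
    have 4: "var k \<odot>\<^bsub>E j\<^esub> (f ^ t \<odot>\<^bsub>E j\<^esub> z) = d (j - 1) (f ^ t \<odot>\<^bsub>E (j - 1)\<^esub> y)"
      using t2 zc by (simp add: D.M.smult_commute D'.smult)
    obtain y1 where y1: "y1 \<in> C F (j - 1) ?v" "f ^ t \<odot>\<^bsub>E j\<^esub> z = d (j - 1) y1"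
      by (rule straight_inj[OF F 2 1 3 4])
    obtain y' where y': "y' \<in> C F (j - 1) v" "D'.M.feq f (f ^ t \<odot>\<^bsub>E (j - 1)\<^esub> y') y1"
      using divide[OF y1(1)] f by blast
    note cs = zc D'.M.tors_carrier[OF y1(1)] D'.M.tors_carrier[OF y'(1)]
    have "D.M.feq f (f ^ t \<odot>\<^bsub>E j\<^esub> z) (f ^ t \<odot>\<^bsub>E j\<^esub> d (j - 1) y')"
      using D'.feq[OF y'(2)] cs y1(2) by (simp add: D'.smult D.M.feq_sym)
    then have "D.M.feq f z (d (j - 1) y')" by (rule D.M.feq_cancel) (use cs D'.closed in auto)
    then show ?thesis by (rule that[OF y'(1)])
  next
    case False
    obtain \<beta> where \<beta>: "\<alpha> = Poly_Mapping.single k 1 + \<beta>" "f = var k * Poly_Mapping.single \<beta> c"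
      using single_split_var[OF False] f by metis
    let ?h = "Poly_Mapping.single \<beta> c :: ('n, 'a) mpoly"
    \<comment> \<open>From \<open>X_k z = d y\<close> in the localisation follows
      \<open>z = d (y / X_k)\<close>, and \<open>y / X_k\<close> is \<open>h y / f\<close>.\<close>
    have "shift \<beta> (up k v) = (\<lambda>l. int 1 * int (Poly_Mapping.lookup \<alpha> l) + v l)"
      by (simp add: \<beta>(1) lookup_add algebra_simps)
    then have "?h \<odot>\<^bsub>E (j - 1)\<^esub> y \<in> C F (j - 1) (\<lambda>l. int 1 * int (Poly_Mapping.lookup \<alpha> l) + v l)"
      using D'.M.tors_single[OF y, of \<beta> c] by simp
    then obtain y' where y': "y' \<in> C F (j - 1) v"
      "D'.M.feq f (f ^ 1 \<odot>\<^bsub>E (j - 1)\<^esub> y') (?h \<odot>\<^bsub>E (j - 1)\<^esub> y)"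
      using divide[where c = c] f by blast
    note cs = zc D'.M.tors_carrier[OF y'(1)]
    have "D.M.feq f (f ^ 1 \<odot>\<^bsub>E j\<^esub> z) (?h \<odot>\<^bsub>E j\<^esub> d (j - 1) y)"
      using D.M.feq_smult[OF zy, of ?h] cs
      by (simp add: \<beta>(2) D'.closed D.M.smult_mult[symmetric] mult.commute)
    moreover have "D.M.feq f (?h \<odot>\<^bsub>E j\<^esub> d (j - 1) y) (f ^ 1 \<odot>\<^bsub>E j\<^esub> d (j - 1) y')"
      using D'.feq[OF y'(2)] cs by (simp add: D'.smult D.M.feq_sym)
    ultimately have "D.M.feq f (f ^ 1 \<odot>\<^bsub>E j\<^esub> z) (f ^ 1 \<odot>\<^bsub>E j\<^esub> d (j - 1) y')"
      by (rule D.M.feq_trans) (use cs D'.closed in auto)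
    then have "D.M.feq f z (d (j - 1) y')" by (rule D.M.feq_cancel) (use cs D'.closed in auto)
    then show ?thesis by (rule that[OF y'(1)])
  qed
qed

text \<open>The two halves of the five lemma, chased on elements. Surjectivity on the
  \<open>f\<close>-torsion in degree \<open>j\<close> uses surjectivity on \<open>C\<close> and
  injectivity on \<open>C_f\<close> in degree \<open>j\<close>, and surjectivity on
  \<open>C_f\<close> in degree \<open>j - 1\<close>. Injectivity uses injectivity on
  \<open>C\<close> in degree \<open>j\<close>, and surjectivity on \<open>C\<close> and injectivity
  on \<open>C_f\<close> in degree \<open>j - 1\<close>.\<close>

lemma straight_insert:
  assumes F: "straight F" and f: "f = Poly_Mapping.single \<alpha> c"
  shows "straight (insert f F)"
  unfolding straight_def straight_at_def
proof (intro allI impI conjI ballI)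
  fix j :: int and k and v :: "'n \<Rightarrow> int" and z
  assume v: "v k \<noteq> -1" and z: "z \<in> C (insert f F) j (up k v)" and dz: "d j z = \<zero>\<^bsub>E (j + 1)\<^esub>"
  interpret D: gmod_hom "E j" "E (j + 1)" "d j" by (rule d_gmod_hom)
  interpret D': gmod_hom "E (j - 1)" "E j" "d (j - 1)" by (rule d_gmod_hom')
  interpret D'': gmod_hom "E (j - 1 - 1)" "E (j - 1)" "d (j - 1 - 1)" by (rule d_gmod_hom')
  have zF: "z \<in> C F j (up k v)" and zf: "D.M.feq f z \<zero>\<^bsub>E j\<^esub>" using z by (simp_all add: D.M.tors_insert)
  obtain w y where w: "w \<in> C F j v" and y: "y \<in> C F (j - 1) (up k v)" and dw: "d j w = \<zero>\<^bsub>E (j + 1)\<^esub>"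
    and wy: "var k \<odot>\<^bsub>E j\<^esub> w = z \<oplus>\<^bsub>E j\<^esub> d (j - 1) y"
    by (rule straight_surj[OF F v zF dz])
  note c1 = D.M.tors_carrier[OF z] D.M.tors_carrier[OF w] D'.M.tors_carrier[OF y]
  have dwf: "D.N.feq f (d j w) \<zero>\<^bsub>E (j + 1)\<^esub>" unfolding dw by (rule D.N.feq_refl)
  \<comment> \<open>As \<open>z\<close> is \<open>f\<close>-torsion, \<open>X_k w\<close> is a
    boundary in \<open>C_f\<close>; by injectivity there, so is \<open>w\<close>.\<close>
  have wyf: "D.M.feq f (var k \<odot>\<^bsub>E j\<^esub> w) (d (j - 1) y)"
    unfolding wy using D.M.feq_add[OF zf D.M.feq_refl[of f "d (j - 1) y"]] c1 by (simp add: D'.closed)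
  obtain y' where y': "y' \<in> C F (j - 1) v" and wy': "D.M.feq f w (d (j - 1) y')"
    by (rule loc_inj[OF F v w y f dwf wyf])
  \<comment> \<open>The element \<open>w - d y'\<close> is \<open>f\<close>-torsion and its product
    with \<open>X_k\<close> is \<open>z + d q\<close>, but \<open>q\<close> itself need not be
    \<open>f\<close>-torsion. It is a cocycle in \<open>C_f\<close>, so it can be lifted along
    \<open>X_k\<close>.\<close>
  define q where "q = y \<ominus>\<^bsub>E (j - 1)\<^esub> var k \<odot>\<^bsub>E (j - 1)\<^esub> y'"
  have q: "q \<in> C F (j - 1) (up k v)"
    unfolding q_def by (intro D'.M.tors_minus y D'.M.tors_single y')
  note c2 = c1 D'.M.tors_carrier[OF y'] D'.M.tors_carrier[OF q]
  have dq: "d (j - 1) q = d (j - 1) y \<ominus>\<^bsub>E j\<^esub> var k \<odot>\<^bsub>E j\<^esub> d (j - 1) y'"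
    unfolding q_def using c2 by (simp add: D'.minus D'.smult)
  have "D.M.feq f (d (j - 1) y) (var k \<odot>\<^bsub>E j\<^esub> d (j - 1) y')"
    by (rule D.M.feq_trans[OF D.M.feq_sym[OF wyf] D.M.feq_smult[OF wy']]) (use c2 D'.closed in auto)
  then have dqf: "D.M.feq f (d (j - 1) q) \<zero>\<^bsub>E j\<^esub>"
    unfolding dq by (rule D.M.feq_minus_zero) (use c2 D'.closed in auto)
  obtain w2 y2 where w2: "w2 \<in> C F (j - 1) v" and y2: "y2 \<in> C F (j - 1 - 1) (up k v)"
    and dw2: "D.M.feq f (d (j - 1) w2) \<zero>\<^bsub>E j\<^esub>"
    and w2y2: "D'.M.feq f (var k \<odot>\<^bsub>E (j - 1)\<^esub> w2) (q \<oplus>\<^bsub>E (j - 1)\<^esub> d (j - 1 - 1) y2)"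
    by (rule loc_surj[OF F v q f]) (use dqf in simp_all)
  note c3 = c2 D'.M.tors_carrier[OF w2] D''.M.tors_carrier[OF y2] D''.closed[OF D''.M.tors_carrier[OF y2]]
  \<comment> \<open>Subtracting \<open>d w2\<close> changes the lift of \<open>z\<close> by an
    \<open>f\<close>-torsion element and replaces \<open>q\<close> by \<sigma>, which vanishes in
    \<open>C_f\<close>.\<close>
  define \<tau> where "\<tau> = w \<ominus>\<^bsub>E j\<^esub> d (j - 1) y' \<ominus>\<^bsub>E j\<^esub> d (j - 1) w2"
  define \<sigma> where "\<sigma> = q \<oplus>\<^bsub>E (j - 1)\<^esub> d (j - 1 - 1) y2 \<ominus>\<^bsub>E (j - 1)\<^esub> var k \<odot>\<^bsub>E (j - 1)\<^esub> w2"
  have "D.M.feq f \<tau> (\<zero>\<^bsub>E j\<^esub> \<ominus>\<^bsub>E j\<^esub> \<zero>\<^bsub>E j\<^esub>)"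
    unfolding \<tau>_def by (intro D.M.feq_minus D.M.feq_minus_zero wy' dw2) (use c3 D'.closed in auto)
  then have \<tau>: "\<tau> \<in> C (insert f F) j v"
    unfolding D.M.tors_insert using D.M.tors_minus[OF D.M.tors_minus[OF w D'.tors[OF y']] D'.tors[OF w2]]
    by (simp add: \<tau>_def D.M.minus_self)
  have "D'.M.feq f \<sigma> \<zero>\<^bsub>E (j - 1)\<^esub>"
    unfolding \<sigma>_def by (intro D'.M.feq_minus_zero D'.M.feq_sym[OF w2y2]) (use c3 D''.closed in auto)
  then have \<sigma>: "\<sigma> \<in> C (insert f F) (j - 1) (up k v)"
    unfolding D'.M.tors_insert
    using D'.M.tors_minus[OF D'.M.tors_add[OF q D''.tors[OF y2]] D'.M.tors_single[OF w2]]
    by (simp add: \<sigma>_def)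
  have "d j \<tau> = \<zero>\<^bsub>E (j + 1)\<^esub>"
    unfolding \<tau>_def using c3 dw by (simp add: D.minus D'.closed d_d' D.N.minus_self)
  moreover have "d (j - 1) \<sigma> =
      d (j - 1) y \<ominus>\<^bsub>E j\<^esub> var k \<odot>\<^bsub>E j\<^esub> d (j - 1) y' \<ominus>\<^bsub>E j\<^esub> var k \<odot>\<^bsub>E j\<^esub> d (j - 1) w2"
    unfolding \<sigma>_def using c3 d_d'[of y2 "j - 1"]
    by (simp add: D'.minus D'.add D'.smult D''.closed dq D'.closed)
  then have "var k \<odot>\<^bsub>E j\<^esub> \<tau> = z \<oplus>\<^bsub>E j\<^esub> d (j - 1) \<sigma>"
    unfolding \<tau>_def using c3 wy
    by (simp add: D.M.smult_distr D.M.smult_neg D'.closed D.M.minus_eq D.M.M.a_assoc)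
  ultimately show "\<exists>w\<in>C (insert f F) j v. \<exists>y\<in>C (insert f F) (j - 1) (up k v).
      d j w = \<zero>\<^bsub>E (j + 1)\<^esub> \<and> var k \<odot>\<^bsub>E j\<^esub> w = z \<oplus>\<^bsub>E j\<^esub> d (j - 1) y"
    using \<tau> \<sigma> by blast
next
  fix j :: int and k and v :: "'n \<Rightarrow> int" and z y
  assume v: "v k \<noteq> -1" and z: "z \<in> C (insert f F) j v" and y: "y \<in> C (insert f F) (j - 1) (up k v)"
    and dz: "d j z = \<zero>\<^bsub>E (j + 1)\<^esub>" and zy: "var k \<odot>\<^bsub>E j\<^esub> z = d (j - 1) y"
  interpret D: gmod_hom "E j" "E (j + 1)" "d j" by (rule d_gmod_hom)
  interpret D': gmod_hom "E (j - 1)" "E j" "d (j - 1)" by (rule d_gmod_hom')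
  interpret D'': gmod_hom "E (j - 1 - 1)" "E (j - 1)" "d (j - 1 - 1)" by (rule d_gmod_hom')
  have zF: "z \<in> C F j v" and zf: "D.M.feq f z \<zero>\<^bsub>E j\<^esub>" using z by (simp_all add: D.M.tors_insert)
  have yF: "y \<in> C F (j - 1) (up k v)" and yf: "D'.M.feq f y \<zero>\<^bsub>E (j - 1)\<^esub>"
    using y by (simp_all add: D'.M.tors_insert)
  obtain y1 where y1: "y1 \<in> C F (j - 1) v" "z = d (j - 1) y1"
    by (rule straight_inj[OF F v zF yF dz zy])
  \<comment> \<open>The defect of \<open>y1\<close> as a preimage of \<open>y\<close>. It is a
    cocycle because both \<open>y\<close> and \<open>X_k y1\<close> have boundary
    \<open>X_k z\<close>.\<close>
  define q where "q = y \<ominus>\<^bsub>E (j - 1)\<^esub> var k \<odot>\<^bsub>E (j - 1)\<^esub> y1"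
  have q: "q \<in> C F (j - 1) (up k v)"
    unfolding q_def by (intro D'.M.tors_minus yF D'.M.tors_single y1)
  note c1 = D.M.tors_carrier[OF z] D'.M.tors_carrier[OF y] D'.M.tors_carrier[OF y1(1)] D'.M.tors_carrier[OF q]
  have dq: "d (j - 1) q = \<zero>\<^bsub>E (j - 1 + 1)\<^esub>"
    unfolding q_def using c1 zy y1(2) by (simp add: D'.minus D'.smult D'.closed D.M.minus_self)
  obtain w y2 where w: "w \<in> C F (j - 1) v" and y2: "y2 \<in> C F (j - 1 - 1) (up k v)"
    and dw: "d (j - 1) w = \<zero>\<^bsub>E (j - 1 + 1)\<^esub>"
    and wy2: "var k \<odot>\<^bsub>E (j - 1)\<^esub> w = q \<oplus>\<^bsub>E (j - 1)\<^esub> d (j - 1 - 1) y2"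
    by (rule straight_surj[OF F v q dq])
  note c2 = c1 D'.M.tors_carrier[OF w] D''.M.tors_carrier[OF y2] D''.closed[OF D''.M.tors_carrier[OF y2]]
  \<comment> \<open>Adding the lift \<open>w\<close> of \<open>q\<close> leaves
    \<open>d y1 = z\<close> intact and makes \<open>X_k x\<close> equal to \<open>y\<close> up to a
    boundary.\<close>
  define x where "x = y1 \<oplus>\<^bsub>E (j - 1)\<^esub> w"
  have x: "x \<in> C F (j - 1) v" unfolding x_def by (intro D'.M.tors_add y1 w)
  have dx: "d (j - 1) x = z" unfolding x_def using c2 dw y1(2) by (simp add: D'.add D'.closed)
  have "var k \<odot>\<^bsub>E (j - 1)\<^esub> x = y \<oplus>\<^bsub>E (j - 1)\<^esub> d (j - 1 - 1) y2"
  proof -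
    let ?a = "var k \<odot>\<^bsub>E (j - 1)\<^esub> y1"
    have "var k \<odot>\<^bsub>E (j - 1)\<^esub> x = ?a \<oplus>\<^bsub>E (j - 1)\<^esub> (y \<ominus>\<^bsub>E (j - 1)\<^esub> ?a \<oplus>\<^bsub>E (j - 1)\<^esub> d (j - 1 - 1) y2)"
      unfolding x_def using c2 wy2 q_def by (simp add: D'.M.smult_distr)
    also have "\<dots> = (?a \<oplus>\<^bsub>E (j - 1)\<^esub> (y \<ominus>\<^bsub>E (j - 1)\<^esub> ?a)) \<oplus>\<^bsub>E (j - 1)\<^esub> d (j - 1 - 1) y2"
      using c2 by (simp add: D'.M.M.a_assoc D''.closed D'.M.minus_eq)
    also have "?a \<oplus>\<^bsub>E (j - 1)\<^esub> (y \<ominus>\<^bsub>E (j - 1)\<^esub> ?a) = y"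
      using c2 by (simp add: D'.M.minus_eq D'.M.M.a_lcomm D'.M.M.r_neg)
    finally show ?thesis .
  qed
  then have xf: "D'.M.feq f (var k \<odot>\<^bsub>E (j - 1)\<^esub> x) (d (j - 1 - 1) y2)"
    using D'.M.feq_add[OF yf D'.M.feq_refl[of f "d (j - 1 - 1) y2"]] c2 by (simp add: D''.closed)
  \<comment> \<open>In \<open>C_f\<close> both \<open>z\<close> and \<open>y\<close> vanish, so
    \<open>x\<close> is a cocycle there whose product with \<open>X_k\<close> is a boundary. Hence
    \<open>x\<close> is a boundary in \<open>C_f\<close>, and removing it leaves an
    \<open>f\<close>-torsion element with the same image \<open>z\<close>.\<close>
  obtain y3 where y3: "y3 \<in> C F (j - 1 - 1) v" and xy3: "D'.M.feq f x (d (j - 1 - 1) y3)"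
    by (rule loc_inj[OF F v x y2 f _ xf]) (use zf dx in simp_all)
  note c3 = c2 D'.M.tors_carrier[OF x] D''.M.tors_carrier[OF y3] D''.closed[OF D''.M.tors_carrier[OF y3]]
  let ?y = "x \<ominus>\<^bsub>E (j - 1)\<^esub> d (j - 1 - 1) y3"
  have "D'.M.feq f ?y \<zero>\<^bsub>E (j - 1)\<^esub>"
    by (rule D'.M.feq_minus_zero[OF xy3]) (use c3 D''.closed in auto)
  then have "?y \<in> C (insert f F) (j - 1) v"
    unfolding D'.M.tors_insert using D'.M.tors_minus[OF x D''.tors[OF y3]] by simp
  moreover have "z = d (j - 1) ?y"
    using c3 dx d_d'[of y3 "j - 1"] by (simp add: D'.minus D''.closed D.M.minus_eq)
  ultimately show "\<exists>y\<in>C (insert f F) (j - 1) v. z = d (j - 1) y" by blast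
qed

lemma straight_finite:
  assumes "straight {}" "finite F" "F \<subseteq> {Poly_Mapping.single \<alpha> c |\<alpha> c. True}"
  shows "straight F"
  using assms(2,3)
proof (induction F)
  case (insert f F)
  then show ?case using straight_insert by blast
qed (rule assms(1))

end

subsection \<open>Quotient modules\<close>

text \<open>The module axioms are equations and pass along a surjection. This supplies them for
  quotients and for targets that are given only as records.\<close>

lemma module_image:
  assumes "Module.module R P" and surj: "carrier Q = h ` carrier P"
    and add: "\<And>x y. x \<in> carrier P \<Longrightarrow> y \<in> carrier P \<Longrightarrow> h (x \<oplus>\<^bsub>P\<^esub> y) = h x \<oplus>\<^bsub>Q\<^esub> h y"
    and smult: "\<And>r x. r \<in> carrier R \<Longrightarrow> x \<in> carrier P \<Longrightarrow> h (r \<odot>\<^bsub>P\<^esub> x) = r \<odot>\<^bsub>Q\<^esub> h x"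
    and zero: "h \<zero>\<^bsub>P\<^esub> = \<zero>\<^bsub>Q\<^esub>"
  shows "Module.module R Q"
proof -
  interpret P: Module.module R P by fact
  have "abelian_group Q"
  proof (rule abelian_groupI)
    show "\<zero>\<^bsub>Q\<^esub> \<in> carrier Q" using surj zero P.M.zero_closed by (metis imageI)
  next
    fix x assume "x \<in> carrier Q"
    then obtain a where "a \<in> carrier P" "x = h a" using surj by auto
    then have "h (\<ominus>\<^bsub>P\<^esub> a) \<oplus>\<^bsub>Q\<^esub> x = \<zero>\<^bsub>Q\<^esub>" "h (\<ominus>\<^bsub>P\<^esub> a) \<in> carrier Q"
      using surj zero by (simp_all add: add[symmetric] P.M.l_neg)
    then show "\<exists>y\<in>carrier Q. y \<oplus>\<^bsub>Q\<^esub> x = \<zero>\<^bsub>Q\<^esub>" by blast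
  next
    fix x y assume "x \<in> carrier Q" "y \<in> carrier Q"
    then obtain a b where "a \<in> carrier P" "b \<in> carrier P" "x = h a" "y = h b" using surj by auto
    then show "x \<oplus>\<^bsub>Q\<^esub> y = y \<oplus>\<^bsub>Q\<^esub> x"
      using add[of a b] add[of b a] P.M.a_comm[of a b] by simp
  next
    fix x y z assume "x \<in> carrier Q" "y \<in> carrier Q" "z \<in> carrier Q"
    then obtain a b c where "a \<in> carrier P" "b \<in> carrier P" "c \<in> carrier P" "x = h a" "y = h b" "z = h c"
      using surj by auto
    then show "x \<oplus>\<^bsub>Q\<^esub> y \<oplus>\<^bsub>Q\<^esub> z = x \<oplus>\<^bsub>Q\<^esub> (y \<oplus>\<^bsub>Q\<^esub> z)"
      by (simp add: add[symmetric] P.M.a_assoc)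
  next
    fix x y assume "x \<in> carrier Q" "y \<in> carrier Q"
    then obtain a b where "a \<in> carrier P" "b \<in> carrier P" "x = h a" "y = h b" using surj by auto
    then show "x \<oplus>\<^bsub>Q\<^esub> y \<in> carrier Q" using surj by (simp add: add[symmetric])
  next
    fix x assume "x \<in> carrier Q"
    then obtain a where "a \<in> carrier P" "x = h a" using surj by auto
    then show "\<zero>\<^bsub>Q\<^esub> \<oplus>\<^bsub>Q\<^esub> x = x" using add[of "\<zero>\<^bsub>P\<^esub>" a] zero by simp
  qed
  then show ?thesis
  proof (intro moduleI P.R.cring_axioms)
    fix r x assume "r \<in> carrier R" "x \<in> carrier Q"
    then obtain a where "a \<in> carrier P" "x = h a" using surj by auto
    then show "r \<odot>\<^bsub>Q\<^esub> x \<in> carrier Q" using surj smult[of r a] \<open>r \<in> carrier R\<close> P.smult_closed by (metis imageI)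
  next
    fix r s x assume rs: "r \<in> carrier R" "s \<in> carrier R" and "x \<in> carrier Q"
    then obtain a where a: "a \<in> carrier P" "x = h a" using surj by auto
    have "h ((r \<oplus>\<^bsub>R\<^esub> s) \<odot>\<^bsub>P\<^esub> a) = h (r \<odot>\<^bsub>P\<^esub> a \<oplus>\<^bsub>P\<^esub> s \<odot>\<^bsub>P\<^esub> a)"
      using rs a by (simp add: P.smult_l_distr)
    then show "(r \<oplus>\<^bsub>R\<^esub> s) \<odot>\<^bsub>Q\<^esub> x = r \<odot>\<^bsub>Q\<^esub> x \<oplus>\<^bsub>Q\<^esub> s \<odot>\<^bsub>Q\<^esub> x"
      using rs a by (simp add: smult add)
    have "h ((r \<otimes>\<^bsub>R\<^esub> s) \<odot>\<^bsub>P\<^esub> a) = h (r \<odot>\<^bsub>P\<^esub> (s \<odot>\<^bsub>P\<^esub> a))" using rs a by (simp add: P.smult_assoc1)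
    then show "(r \<otimes>\<^bsub>R\<^esub> s) \<odot>\<^bsub>Q\<^esub> x = r \<odot>\<^bsub>Q\<^esub> (s \<odot>\<^bsub>Q\<^esub> x)"
      using rs a by (simp add: smult)
  next
    fix r x y assume r: "r \<in> carrier R" and "x \<in> carrier Q" "y \<in> carrier Q"
    then obtain a b where a: "a \<in> carrier P" "b \<in> carrier P" "x = h a" "y = h b" using surj by auto
    have "h (r \<odot>\<^bsub>P\<^esub> (a \<oplus>\<^bsub>P\<^esub> b)) = h (r \<odot>\<^bsub>P\<^esub> a \<oplus>\<^bsub>P\<^esub> r \<odot>\<^bsub>P\<^esub> b)"
      using r a by (simp add: P.smult_r_distr)
    then show "r \<odot>\<^bsub>Q\<^esub> (x \<oplus>\<^bsub>Q\<^esub> y) = r \<odot>\<^bsub>Q\<^esub> x \<oplus>\<^bsub>Q\<^esub> r \<odot>\<^bsub>Q\<^esub> y"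
      using r a by (simp add: smult add)
  next
    fix x assume "x \<in> carrier Q"
    then obtain a where "a \<in> carrier P" "x = h a" using surj by auto
    then show "\<one>\<^bsub>R\<^esub> \<odot>\<^bsub>Q\<^esub> x = x" using smult[of "\<one>\<^bsub>R\<^esub>" a] by simp
  qed
qed

text \<open>Both targets are \<open>Z\<close> modulo the common kernel. Components of different
  degrees can thus be compared on cocycles, with no map between iterated quotients.\<close>

lemma mod_iso_of_same_kernel:
  assumes Z: "Module.module R Z"
    and h1: "h1 \<in> mod_hom R Z F1" "h1 ` carrier Z = carrier F1" "h1 \<zero>\<^bsub>Z\<^esub> = \<zero>\<^bsub>F1\<^esub>"
    and h2: "h2 \<in> mod_hom R Z F2" "h2 ` carrier Z = carrier F2" "h2 \<zero>\<^bsub>Z\<^esub> = \<zero>\<^bsub>F2\<^esub>"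
    and ker: "\<And>x. x \<in> carrier Z \<Longrightarrow> h1 x = \<zero>\<^bsub>F1\<^esub> \<longleftrightarrow> h2 x = \<zero>\<^bsub>F2\<^esub>"
  shows "mod_iso R F1 F2"
proof -
  interpret Z: Module.module R Z by fact
  have F1: "Module.module R F1"
    by (rule module_image[OF Z, of _ h1]) (use h1 in \<open>auto simp: mod_hom_def\<close>)
  have F2: "Module.module R F2"
    by (rule module_image[OF Z, of _ h2]) (use h2 in \<open>auto simp: mod_hom_def\<close>)
  interpret F1: Module.module R F1 by (rule F1)
  interpret F2: Module.module R F2 by (rule F2)
  have c: "h1 x \<in> carrier F1" "h2 x \<in> carrier F2" if "x \<in> carrier Z" for x using h1 h2 that by auto
  have add: "h1 (x \<oplus>\<^bsub>Z\<^esub> y) = h1 x \<oplus>\<^bsub>F1\<^esub> h1 y" "h2 (x \<oplus>\<^bsub>Z\<^esub> y) = h2 x \<oplus>\<^bsub>F2\<^esub> h2 y"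
    if "x \<in> carrier Z" "y \<in> carrier Z" for x y
    using h1(1) h2(1) that by (auto simp: mod_hom_def)
  have smult: "h1 (r \<odot>\<^bsub>Z\<^esub> x) = r \<odot>\<^bsub>F1\<^esub> h1 x" "h2 (r \<odot>\<^bsub>Z\<^esub> x) = r \<odot>\<^bsub>F2\<^esub> h2 x"
    if "x \<in> carrier Z" "r \<in> carrier R" for r x
    using h1(1) h2(1) that by (auto simp: mod_hom_def)
  have eq: "h1 x = h1 y \<longleftrightarrow> h2 x = h2 y" if xy: "x \<in> carrier Z" "y \<in> carrier Z" for x y
  proof -
    let ?m = "x \<oplus>\<^bsub>Z\<^esub> \<ominus>\<^bsub>Z\<^esub> y"
    have m: "?m \<in> carrier Z" "x = ?m \<oplus>\<^bsub>Z\<^esub> y" using xy by (simp_all add: Z.M.a_assoc Z.M.l_neg)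
    have "h1 x = h1 y \<longleftrightarrow> h1 ?m = \<zero>\<^bsub>F1\<^esub>"
      using add(1)[OF m(1) xy(2)] m c xy F1.M.add.r_cancel_one by metis
    moreover have "h2 x = h2 y \<longleftrightarrow> h2 ?m = \<zero>\<^bsub>F2\<^esub>"
      using add(2)[OF m(1) xy(2)] m c xy F2.M.add.r_cancel_one by metis
    ultimately show ?thesis using ker[OF m(1)] by simp
  qed
  define g where "g y = h2 (SOME x. x \<in> carrier Z \<and> h1 x = y)" for y
  have g: "g (h1 x) = h2 x" if "x \<in> carrier Z" for x
  proof -
    let ?x = "SOME x'. x' \<in> carrier Z \<and> h1 x' = h1 x"
    have "?x \<in> carrier Z \<and> h1 ?x = h1 x" by (rule someI[of _ x]) (use that in auto)
    then show ?thesis unfolding g_def using eq that by blast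
  qed
  have "g \<in> mod_hom R F1 F2"
    unfolding mod_hom_def h1(2)[symmetric] h2(2)[symmetric]
    using c g add smult by (auto simp: g add[symmetric] smult[symmetric])
  moreover have "bij_betw g (carrier F1) (carrier F2)"
    unfolding bij_betw_def inj_on_def h1(2)[symmetric] h2(2)[symmetric]
    by (auto simp: g eq image_iff)
  ultimately show ?thesis unfolding mod_iso_def by blast
qed

locale mod_quot = P: Module.module R P for R :: "('r, 'x) ring_scheme" and P :: "('r, 'm, 'y) module_scheme" +
  fixes B
  assumes sub: "B \<subseteq> carrier P" "\<zero>\<^bsub>P\<^esub> \<in> B"
    and B_add: "\<And>x y. x \<in> B \<Longrightarrow> y \<in> B \<Longrightarrow> x \<oplus>\<^bsub>P\<^esub> y \<in> B"
    and B_smult: "\<And>r x. r \<in> carrier R \<Longrightarrow> x \<in> B \<Longrightarrow> r \<odot>\<^bsub>P\<^esub> x \<in> B"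
begin

lemma abelian_sub: "abelian_subgroup B P"
proof -
  have "\<ominus>\<^bsub>P\<^esub> x \<in> B" if "x \<in> B" for x
    using B_smult[of "\<ominus>\<^bsub>R\<^esub> \<one>\<^bsub>R\<^esub>" x] that sub by (auto simp: P.smult_l_minus)
  then have "additive_subgroup B P"
    using sub B_add P.M.r_neg by (intro additive_subgroupI' P.M.abelian_group_axioms) blast+
  then show ?thesis by (rule abelian_subgroupI3) (rule P.M.abelian_group_axioms)
qed

sublocale Q: abelian_subgroup B P by (rule abelian_sub)

lemma coset_eq_iff: "x \<in> carrier P \<Longrightarrow> B +>\<^bsub>P\<^esub> x = B \<longleftrightarrow> x \<in> B"
  using Q.a_rcos_self P.M.a_coset_join2[OF _ Q.a_subgroup] by metis

lemma carrier_quot: "carrier (quotient_module P B) = (\<lambda>x. B +>\<^bsub>P\<^esub> x) ` carrier P"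
  by (auto simp: quotient_module_def A_RCOSETS_def')

lemma add_quot: "x \<in> carrier P \<Longrightarrow> y \<in> carrier P \<Longrightarrow>
    (B +>\<^bsub>P\<^esub> x) \<oplus>\<^bsub>quotient_module P B\<^esub> (B +>\<^bsub>P\<^esub> y) = B +>\<^bsub>P\<^esub> (x \<oplus>\<^bsub>P\<^esub> y)"
  by (simp add: quotient_module_def Q.a_rcos_sum)

lemma zero_quot: "\<zero>\<^bsub>quotient_module P B\<^esub> = B"
  by (simp add: quotient_module_def)

lemma smult_quot:
  assumes r: "r \<in> carrier R" and x: "x \<in> carrier P"
  shows "r \<odot>\<^bsub>quotient_module P B\<^esub> (B +>\<^bsub>P\<^esub> x) = B +>\<^bsub>P\<^esub> (r \<odot>\<^bsub>P\<^esub> x)"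
proof -
  have "B +>\<^bsub>P\<^esub> (r \<odot>\<^bsub>P\<^esub> y) = B +>\<^bsub>P\<^esub> (r \<odot>\<^bsub>P\<^esub> x)" if y: "y \<in> B +>\<^bsub>P\<^esub> x" for y
  proof -
    obtain b where b: "b \<in> B" "y = b \<oplus>\<^bsub>P\<^esub> x" using y by (auto simp: a_r_coset_def')
    then have "r \<odot>\<^bsub>P\<^esub> y = r \<odot>\<^bsub>P\<^esub> b \<oplus>\<^bsub>P\<^esub> r \<odot>\<^bsub>P\<^esub> x"
      using r x sub by (auto simp: P.smult_r_distr)
    then have "r \<odot>\<^bsub>P\<^esub> y \<in> B +>\<^bsub>P\<^esub> (r \<odot>\<^bsub>P\<^esub> x)"
      using B_smult[OF r b(1)] by (auto simp: a_r_coset_def')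
    then show ?thesis
      by (rule P.M.a_repr_independence[OF _ P.smult_closed[OF r x] Q.a_subgroup, symmetric])
  qed
  then have "(\<Union>y\<in>B +>\<^bsub>P\<^esub> x. B +>\<^bsub>P\<^esub> (r \<odot>\<^bsub>P\<^esub> y)) = (\<Union>y\<in>B +>\<^bsub>P\<^esub> x. B +>\<^bsub>P\<^esub> (r \<odot>\<^bsub>P\<^esub> x))"
    by (rule SUP_cong[OF refl])
  also have "\<dots> = B +>\<^bsub>P\<^esub> (r \<odot>\<^bsub>P\<^esub> x)" using Q.a_rcos_self[OF x] by blast
  finally show ?thesis by (simp add: quotient_module_def)
qed

lemma module_quot: "Module.module R (quotient_module P B)"
proof (rule module_image[OF P.module_axioms, where h = "\<lambda>x. B +>\<^bsub>P\<^esub> x"])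
  show "B +>\<^bsub>P\<^esub> \<zero>\<^bsub>P\<^esub> = \<zero>\<^bsub>quotient_module P B\<^esub>"
    using coset_eq_iff[of "\<zero>\<^bsub>P\<^esub>"] sub by (simp add: zero_quot)
qed (simp_all add: carrier_quot add_quot smult_quot)

end

lemma pi_torsion_mod_quot:
  fixes N :: "('a::comm_ring_1, 'm, 'y) module_scheme"
  assumes "Module.module type_ring N"
  shows "mod_quot type_ring N (pi_torsion \<pi> N)"
proof -
  interpret N: Module.module type_ring N by fact
  have assoc: "(r * s) \<odot>\<^bsub>N\<^esub> x = r \<odot>\<^bsub>N\<^esub> (s \<odot>\<^bsub>N\<^esub> x)" if "x \<in> carrier N" for r s x
    using N.smult_assoc1[of r s x] that by simp
  have c: "r \<odot>\<^bsub>N\<^esub> x \<in> carrier N" if "x \<in> carrier N" for r x using that N.smult_closed by simp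
  have z: "r \<odot>\<^bsub>N\<^esub> \<zero>\<^bsub>N\<^esub> = \<zero>\<^bsub>N\<^esub>" for r using N.smult_r_null by simp
  have kill: "\<pi> ^ (m + k) \<odot>\<^bsub>N\<^esub> x = \<zero>\<^bsub>N\<^esub>" if "\<pi> ^ k \<odot>\<^bsub>N\<^esub> x = \<zero>\<^bsub>N\<^esub>" "x \<in> carrier N" for m k x
    using that by (simp add: power_add assoc z)
  show ?thesis
  proof
    fix x y assume "x \<in> pi_torsion \<pi> N" "y \<in> pi_torsion \<pi> N"
    then obtain k m where km: "x \<in> carrier N" "y \<in> carrier N" "\<pi> ^ k \<odot>\<^bsub>N\<^esub> x = \<zero>\<^bsub>N\<^esub>" "\<pi> ^ m \<odot>\<^bsub>N\<^esub> y = \<zero>\<^bsub>N\<^esub>"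
      by (auto simp: pi_torsion_def)
    have "\<pi> ^ (m + k) \<odot>\<^bsub>N\<^esub> (x \<oplus>\<^bsub>N\<^esub> y) = \<zero>\<^bsub>N\<^esub>"
      using kill[OF km(3,1), of m] kill[OF km(4,2), of k] km(1,2) N.smult_r_distr[of "\<pi> ^ (m + k)" x y]
      by (simp add: add.commute)
    then show "x \<oplus>\<^bsub>N\<^esub> y \<in> pi_torsion \<pi> N" using km by (auto simp: pi_torsion_def)
  next
    fix r x assume "x \<in> pi_torsion \<pi> N"
    then obtain k where k: "x \<in> carrier N" "\<pi> ^ k \<odot>\<^bsub>N\<^esub> x = \<zero>\<^bsub>N\<^esub>" by (auto simp: pi_torsion_def)
    then have "\<pi> ^ k \<odot>\<^bsub>N\<^esub> (r \<odot>\<^bsub>N\<^esub> x) = \<zero>\<^bsub>N\<^esub>"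
      using assoc[OF k(1), of "\<pi> ^ k" r] assoc[OF k(1), of r "\<pi> ^ k"] by (simp add: mult.commute z)
    then show "r \<odot>\<^bsub>N\<^esub> x \<in> pi_torsion \<pi> N" using k c by (auto simp: pi_torsion_def)
  qed (auto simp: pi_torsion_def z)
qed

lemma module_component:
  fixes P :: "(('n, 'a::comm_ring_1) mpoly, 'm, 'n) graded_module"
  assumes "Module.module type_ring P" "component P u \<subseteq> carrier P" "\<zero>\<^bsub>P\<^esub> \<in> component P u"
    and "\<And>x y. x \<in> component P u \<Longrightarrow> y \<in> component P u \<Longrightarrow> x \<oplus>\<^bsub>P\<^esub> y \<in> component P u"
    and closed: "\<And>a x. x \<in> component P u \<Longrightarrow> Poly_Mapping.single 0 a \<odot>\<^bsub>P\<^esub> x \<in> component P u"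
  shows "Module.module type_ring (component_module P u)"
proof -
  interpret P: Module.module type_ring P by fact
  have cr: "cring (type_ring :: 'a ring)" by (rule cring_from_type_algebra)
  have c: "x \<in> component P u \<Longrightarrow> x \<in> carrier P" for x using assms(2) by auto
  have "\<exists>y\<in>component P u. y \<oplus>\<^bsub>P\<^esub> x = \<zero>\<^bsub>P\<^esub>" if x: "x \<in> component P u" for x
  proof (rule bexI[OF _ closed[OF x, of "-1"]])
    have "Poly_Mapping.single 0 (-1) \<odot>\<^bsub>P\<^esub> x = \<ominus>\<^bsub>P\<^esub> x"
      using P.smult_l_minus[of 1 x] P.smult_one[of x] c[OF x] by (simp add: single_uminus)
    then show "Poly_Mapping.single 0 (-1) \<odot>\<^bsub>P\<^esub> x \<oplus>\<^bsub>P\<^esub> x = \<zero>\<^bsub>P\<^esub>"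
      using c[OF x] by (simp add: P.M.l_neg)
  qed
  then have "abelian_group (component_module P u)"
    using assms(3,4) c by (intro abelian_groupI) (auto simp: component_module_def P.M.a_assoc intro: P.M.a_comm)
  then show ?thesis
    using closed c P.smult_l_distr P.smult_r_distr P.smult_assoc1 P.smult_one
    by (intro moduleI cr)
      (auto simp: component_module_def single_add mult_single[of 0 _ 0, simplified, symmetric])
qed

text \<open>\<open>h\<close> is the composite of the projection to the degree \<open>u\<close> part
  of \<open>P / B\<close>, the projection modulo \<pi>-torsion and the given isomorphism. Its kernel
  consists of the elements that some power of \<pi> carries into \<open>B\<close>.\<close>

lemma component_quotient_hom:
  fixes P :: "(('n, 'a::idom) mpoly, 'm, 'n) graded_module"
  assumes P: "mod_quot type_ring P B" and comp: "component P u \<subseteq> carrier P" "\<zero>\<^bsub>P\<^esub> \<in> component P u"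
    "\<And>x y. x \<in> component P u \<Longrightarrow> y \<in> component P u \<Longrightarrow> x \<oplus>\<^bsub>P\<^esub> y \<in> component P u"
    "\<And>a x. x \<in> component P u \<Longrightarrow> Poly_Mapping.single 0 a \<odot>\<^bsub>P\<^esub> x \<in> component P u"
    and iso: "mod_iso type_ring
       (quotient_module (component_module (graded_quotient P B) u)
         (pi_torsion \<pi> (component_module (graded_quotient P B) u))) F"
    and F: "\<And>y. y \<in> carrier F \<Longrightarrow> 0 \<odot>\<^bsub>F\<^esub> y = \<zero>\<^bsub>F\<^esub>"
  obtains h where "h \<in> mod_hom type_ring (component_module P u) F" "h ` component P u = carrier F"
    "h \<zero>\<^bsub>P\<^esub> = \<zero>\<^bsub>F\<^esub>"
    "\<And>x. x \<in> component P u \<Longrightarrow> h x = \<zero>\<^bsub>F\<^esub> \<longleftrightarrow> (\<exists>n. Poly_Mapping.single 0 (\<pi> ^ n) \<odot>\<^bsub>P\<^esub> x \<in> B)"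
proof -
  interpret P: mod_quot type_ring P B by (rule P)
  let ?N = "component_module (graded_quotient P B) u" and ?q = "\<lambda>x. B +>\<^bsub>P\<^esub> x"
  have Pu: "Module.module type_ring (component_module P u)"
    by (rule module_component[OF P.P.module_axioms comp])
  have cP: "x \<in> carrier P" if "x \<in> component P u" for x using comp that by auto
  have Nsimps: "carrier ?N = ?q ` component P u" "add ?N = add (quotient_module P B)" "\<zero>\<^bsub>?N\<^esub> = B"
    "a \<odot>\<^bsub>?N\<^esub> C = Poly_Mapping.single 0 a \<odot>\<^bsub>quotient_module P B\<^esub> C" for a C
    by (simp_all add: component_module_def graded_quotient_def quotient_module_def module.defs graded_module.defs)
  have q0: "?q \<zero>\<^bsub>P\<^esub> = B" using P.coset_eq_iff[of "\<zero>\<^bsub>P\<^esub>"] P.sub by simp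
  have qadd: "?q (x \<oplus>\<^bsub>P\<^esub> y) = ?q x \<oplus>\<^bsub>?N\<^esub> ?q y" if "x \<in> component P u" "y \<in> component P u" for x y
    using that cP by (simp add: Nsimps P.add_quot)
  have qsm: "?q (Poly_Mapping.single 0 a \<odot>\<^bsub>P\<^esub> x) = a \<odot>\<^bsub>?N\<^esub> ?q x" if "x \<in> component P u" for a x
    using that cP by (simp add: Nsimps P.smult_quot)
  have N: "Module.module type_ring ?N"
    by (rule module_image[OF Pu, where h = ?q])
      (use q0 qadd qsm Nsimps in \<open>simp_all add: component_module_def\<close>)
  let ?T = "pi_torsion \<pi> ?N" and ?r = "\<lambda>C. pi_torsion \<pi> ?N +>\<^bsub>?N\<^esub> C"
  interpret T: mod_quot type_ring ?N ?T by (rule pi_torsion_mod_quot[OF N])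
  obtain g where g: "g \<in> mod_hom type_ring (quotient_module ?N ?T) F"
    "bij_betw g (carrier (quotient_module ?N ?T)) (carrier F)"
    using iso unfolding mod_iso_def by blast
  let ?Q = "quotient_module ?N ?T"
  have gadd: "g (x \<oplus>\<^bsub>?Q\<^esub> y) = g x \<oplus>\<^bsub>F\<^esub> g y" if "x \<in> carrier ?Q" "y \<in> carrier ?Q" for x y
    using g(1) that unfolding mod_hom_def by blast
  have gsm: "g (a \<odot>\<^bsub>?Q\<^esub> x) = a \<odot>\<^bsub>F\<^esub> g x" if "x \<in> carrier ?Q" for a x
  proof -
    have "a \<in> carrier type_ring" by simp
    then show ?thesis using g(1) that unfolding mod_hom_def by blast
  qed
  have gim: "g ` carrier ?Q = carrier F" and ginj: "inj_on g (carrier ?Q)"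
    using g(2) unfolding bij_betw_def by simp_all
  interpret Q: Module.module type_ring ?Q by (rule T.module_quot)
  \<comment> \<open>\<open>F\<close> is only a record at this point, so its zero is reached as 0
    times an element.\<close>
  have g0: "g \<zero>\<^bsub>?Q\<^esub> = \<zero>\<^bsub>F\<^esub>"
  proof -
    have "g \<zero>\<^bsub>?Q\<^esub> = 0 \<odot>\<^bsub>F\<^esub> g \<zero>\<^bsub>?Q\<^esub>" using gsm[of "\<zero>\<^bsub>?Q\<^esub>" 0] Q.smult_r_null[of 0] by simp
    also have "\<dots> = \<zero>\<^bsub>F\<^esub>" by (rule F) (use gim Q.M.zero_closed in blast)
    finally show ?thesis .
  qed
  define h where "h x = g (?r (?q x))" for x
  have qN: "?q x \<in> carrier ?N" if "x \<in> component P u" for x using that by (simp add: Nsimps)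
  have rQ: "?r (?q x) \<in> carrier ?Q" if "x \<in> component P u" for x
    unfolding T.carrier_quot using qN[OF that] by simp
  have "h (x \<oplus>\<^bsub>P\<^esub> y) = h x \<oplus>\<^bsub>F\<^esub> h y" if "x \<in> component P u" "y \<in> component P u" for x y
    unfolding h_def qadd[OF that] T.add_quot[OF qN qN, OF that, symmetric] by (rule gadd) (use rQ that in auto)
  moreover have "h (Poly_Mapping.single 0 a \<odot>\<^bsub>P\<^esub> x) = a \<odot>\<^bsub>F\<^esub> h x" if x: "x \<in> component P u" for a x
  proof -
    have "?r (a \<odot>\<^bsub>?N\<^esub> ?q x) = a \<odot>\<^bsub>?Q\<^esub> ?r (?q x)" using T.smult_quot[OF _ qN[OF x], of a] by simp
    then show ?thesis unfolding h_def qsm[OF x] using gsm[OF rQ[OF x]] by simp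
  qed
  moreover have im: "h ` component P u = carrier F"
    unfolding h_def gim[symmetric] T.carrier_quot Nsimps(1) image_image ..
  ultimately have "h \<in> mod_hom type_ring (component_module P u) F"
    by (auto simp: mod_hom_def component_module_def)
  moreover have ker: "h x = \<zero>\<^bsub>F\<^esub> \<longleftrightarrow> (\<exists>n. Poly_Mapping.single 0 (\<pi> ^ n) \<odot>\<^bsub>P\<^esub> x \<in> B)"
    if x: "x \<in> component P u" for x
  proof -
    have "h x = \<zero>\<^bsub>F\<^esub> \<longleftrightarrow> ?r (?q x) = \<zero>\<^bsub>?Q\<^esub>"
      unfolding h_def g0[symmetric] using inj_on_eq_iff[OF ginj rQ[OF x] Q.M.zero_closed] .
    also have "\<dots> \<longleftrightarrow> ?q x \<in> ?T" unfolding T.zero_quot by (rule T.coset_eq_iff[OF qN[OF x]])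
    also have "\<dots> \<longleftrightarrow> (\<exists>n. ?q (Poly_Mapping.single 0 (\<pi> ^ n) \<odot>\<^bsub>P\<^esub> x) = B)"
      unfolding pi_torsion_def qsm[OF x] Nsimps(3) using qN[OF x] by blast
    also have "\<dots> \<longleftrightarrow> (\<exists>n. Poly_Mapping.single 0 (\<pi> ^ n) \<odot>\<^bsub>P\<^esub> x \<in> B)"
      using P.coset_eq_iff[OF cP[OF comp(4)[OF x]]] by simp
    finally show ?thesis .
  qed
  moreover have "h \<zero>\<^bsub>P\<^esub> = \<zero>\<^bsub>F\<^esub>"
    unfolding ker[OF comp(2)] using P.P.smult_r_null P.sub by simp
  ultimately show ?thesis using that im by blast
qed

subsection \<open>Ideal torsion\<close>

lemma type_ring_idealI:
  assumes "0 \<in> J" "\<And>x y. x \<in> J \<Longrightarrow> y \<in> J \<Longrightarrow> x + y \<in> J" "\<And>r x. x \<in> J \<Longrightarrow> r * x \<in> J"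
  shows "ideal J (type_ring :: 'a::comm_ring_1 ring)"
proof -
  interpret cring "type_ring :: 'a ring" by (rule cring_from_type_algebra)
  have "additive_subgroup J (type_ring :: 'a ring)"
  proof (rule additive_subgroupI')
    show "abelian_group (type_ring :: 'a ring)" by (rule is_abelian_group)
    show "\<exists>y\<in>J. x \<oplus>\<^bsub>type_ring\<^esub> y = \<zero>\<^bsub>type_ring\<^esub>" if "x \<in> J" for x
      using assms(3)[OF that, of "-1"] by (intro bexI[of _ "- x"]) auto
  qed (use assms in auto)
  then show ?thesis
    using assms(3) by (intro idealI ring_axioms) (auto simp: additive_subgroup_def mult.commute)
qed

text \<open>Generators whose exponents are minimal, with \<pi> counted as a variable, divide all
  others up to units, and Dickson's lemma makes them finite in number. That \<open>F\<close>
  generates \<open>I\<close> is expressed by minimality among ideals, which is how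
  \<open>ideal_torsion_iff\<close> consumes it.\<close>

lemma C_monomial_finite_generators:
  fixes \<pi> :: "'a::idom" and I :: "('n::finite, 'a) mpoly set"
  assumes dvr: "discrete_valuation_ring \<pi>" "adically_complete \<pi>" and I: "C_monomial_ideal I"
  shows "\<exists>F. finite F \<and> F \<subseteq> {Poly_Mapping.single \<alpha> c |\<alpha> c. True} \<and> F \<subseteq> I \<and>
    (\<forall>J. ideal J type_ring \<longrightarrow> F \<subseteq> J \<longrightarrow> I \<subseteq> J)"
proof -
  obtain S where S: "S \<subseteq> {Poly_Mapping.single \<alpha> c |\<alpha> c. True}" "I = Idl\<^bsub>type_ring\<^esub> S"
    using I unfolding C_monomial_ideal_def by blast
  \<comment> \<open>The unit is part of the definition because \<open>S\<close> need not contain the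
    normalised term itself; \<open>F\<close> then consists of actual members of
    \<open>S\<close>.\<close>
  define U where "U = {\<tau>. \<exists>v w. v * w = 1 \<and> Poly_Mapping.single 0 v * (term_of \<pi> \<tau> :: ('n, 'a) mpoly) \<in> S}"
  obtain T where T: "finite T" "T \<subseteq> U" "\<And>\<sigma>. \<sigma> \<in> U \<Longrightarrow> \<exists>t\<in>T. t \<le> \<sigma>" using dickson[of U] by blast
  have "\<forall>t\<in>T. \<exists>v w. v * w = 1 \<and> Poly_Mapping.single 0 v * (term_of \<pi> t :: ('n, 'a) mpoly) \<in> S"
    using T(2) by (auto simp: U_def)
  then obtain v w where vw: "\<And>t. t \<in> T \<Longrightarrow> v t * w t = 1"
    "\<And>t. t \<in> T \<Longrightarrow> Poly_Mapping.single 0 (v t) * (term_of \<pi> t :: ('n, 'a) mpoly) \<in> S" by metis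
  define F where "F = (\<lambda>t. Poly_Mapping.single 0 (v t) * (term_of \<pi> t :: ('n, 'a) mpoly)) ` T"
  have FS: "F \<subseteq> S" using vw(2) by (auto simp: F_def)
  have "S \<subseteq> I" unfolding S(2) genideal_def by blast
  moreover have "I \<subseteq> J" if J: "ideal J type_ring" "F \<subseteq> J" for J
  proof -
    have mult: "r * x \<in> J" if "x \<in> J" for r x using ideal.I_l_closed[OF J(1), of x r] that by simp
    have zero: "0 \<in> J" using additive_subgroup.zero_closed[OF ideal.axioms(1)[OF J(1)]] by simp
    have "s \<in> J" if s: "s \<in> S" for s
    proof -
      obtain \<alpha> c where sc: "s = Poly_Mapping.single \<alpha> c" using S(1) s by blast
      show ?thesis
      proof (cases "c = 0")
        case True
        then show ?thesis using sc zero by simp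
      next
        case False
        obtain v' w' \<tau> where \<tau>: "v' * w' = 1" "s = Poly_Mapping.single 0 v' * (term_of \<pi> \<tau> :: ('n, 'a) mpoly)"
          using single_eq_unit_term_of[OF dvr False] sc by metis
        then have "\<tau> \<in> U" using s by (auto simp: U_def)
        then obtain t where t: "t \<in> T" "t \<le> \<tau>" using T(3) by blast
        obtain \<rho> where \<rho>: "term_of \<pi> \<tau> = term_of \<pi> \<rho> * (term_of \<pi> t :: ('n, 'a) mpoly)"
          using term_of_dvd[OF t(2)] by blast
        have "Poly_Mapping.single 0 (w t) * Poly_Mapping.single 0 (v t) = (1 :: ('n, 'a) mpoly)"
          using vw(1)[OF t(1)] by (simp add: mult_single mult.commute)
        then have "term_of \<pi> t = Poly_Mapping.single 0 (w t) *
            (Poly_Mapping.single 0 (v t) * (term_of \<pi> t :: ('n, 'a) mpoly))"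
          by (simp only: mult.assoc[symmetric] mult_1)
        also have "\<dots> \<in> J" by (rule mult, rule subsetD[OF J(2)]) (use t(1) in \<open>simp add: F_def\<close>)
        finally show ?thesis unfolding \<tau>(2) \<rho> by (intro mult)
      qed
    qed
    then have "S \<subseteq> J" by blast
    then show ?thesis unfolding S(2) genideal_def using J(1) by blast
  qed
  moreover have "finite F" using T(1) by (simp add: F_def)
  ultimately show ?thesis using FS S(1) by (intro exI[of _ F] conjI) blast+
qed

context gmod begin

lemma ideal_power_torsion_mono:
  assumes "\<forall>f\<in>ideal_power type_ring I t. f \<odot> x = \<zero>" "x \<in> carrier M"
  shows "\<forall>f\<in>ideal_power type_ring I (s + t). f \<odot> x = \<zero>"
proof (induction s)
  case (Suc s)
  have "f \<odot> x = \<zero>" if "f \<in> ideal_prod type_ring I (ideal_power type_ring I (s + t))" for f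
    using that
  proof induction
    case (prod i j)
    then show ?case using Suc assms(2) by (simp add: smult_mult)
  next
    case (sum s1 s2)
    then show ?case using assms(2) by (simp add: smult_add)
  qed
  then show ?case by simp
qed (use assms in simp)

text \<open>The substantial direction avoids expanding powers of \<open>I\<close>. An element
  \<open>y\<close> is \<open>I\<close>-torsion as soon as all \<open>f y\<close> with
  \<open>f\<close> in \<open>F\<close> are, and each such step lowers one of the exponents that kill
  the element.\<close>

lemma ideal_torsion_iff:
  assumes F: "finite F" "F \<subseteq> I" "\<And>J. ideal J type_ring \<Longrightarrow> F \<subseteq> J \<Longrightarrow> I \<subseteq> J" and x: "x \<in> carrier M"
  shows "(\<exists>t. \<forall>f\<in>ideal_power type_ring I t. f \<odot> x = \<zero>) \<longleftrightarrow> (\<forall>f\<in>F. feq f x \<zero>)"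
proof
  assume "\<exists>t. \<forall>f\<in>ideal_power type_ring I t. f \<odot> x = \<zero>"
  then obtain t where t: "\<forall>f\<in>ideal_power type_ring I t. f \<odot> x = \<zero>" by blast
  have pow: "f ^ t \<in> ideal_power type_ring I t" if "f \<in> F" for f t
  proof (induction t)
    case (Suc t)
    then show ?case using ideal_prod.prod[of f I "f ^ t" _ type_ring] that F(2) by auto
  qed simp
  then have "f ^ t \<odot> x = \<zero>" if "f \<in> F" for f using t that by blast
  then show "\<forall>f\<in>F. feq f x \<zero>" unfolding feq_def smult_zero by blast
next
  define K where "K = {x \<in> carrier M. \<exists>t. \<forall>f\<in>ideal_power type_ring I t. f \<odot> x = \<zero>}"
  have step: "y \<in> K" if y: "y \<in> carrier M" and K: "\<forall>f\<in>F. f \<odot> y \<in> K" for y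
  proof -
    have "\<forall>f\<in>F. \<exists>t. \<forall>g\<in>ideal_power type_ring I t. g \<odot> (f \<odot> y) = \<zero>" using K by (auto simp: K_def)
    then obtain t where t: "\<And>f. f \<in> F \<Longrightarrow> \<forall>g\<in>ideal_power type_ring I (t f). g \<odot> (f \<odot> y) = \<zero>" by metis
    define T where "T = Max (insert 0 (t ` F))"
    have T: "\<forall>g\<in>ideal_power type_ring I T. g \<odot> (f \<odot> y) = \<zero>" if f: "f \<in> F" for f
    proof -
      have "t f \<le> T" unfolding T_def using F(1) f by (intro Max_ge) auto
      then have "T = (T - t f) + t f" by simp
      then show ?thesis using ideal_power_torsion_mono[OF t[OF f], of "T - t f"] y by (metis smult_carrier)
    qed
    \<comment> \<open>The multipliers that carry \<open>y\<close> into the elements killed by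
      \<open>I ^ T\<close>. They form an ideal containing \<open>F\<close>, hence \<open>I\<close>,
      so \<open>I ^ (T + 1)\<close> kills \<open>y\<close>.\<close>
    define J where "J = {g. \<forall>h\<in>ideal_power type_ring I T. h \<odot> (g \<odot> y) = \<zero>}"
    have "ideal J type_ring"
    proof (rule type_ring_idealI)
      show "r * g \<in> J" if "g \<in> J" for r g
      proof -
        have "h \<odot> ((r * g) \<odot> y) = r \<odot> (h \<odot> (g \<odot> y))" for h
          using y smult_commute[of "g \<odot> y" h r] by (simp add: smult_mult)
        then show ?thesis using that by (simp add: J_def)
      qed
    qed (use y in \<open>auto simp: J_def smult_add smult_distr\<close>)
    moreover have "F \<subseteq> J" using T by (auto simp: J_def)
    ultimately have IJ: "I \<subseteq> J" by (rule F(3))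
    have "f \<odot> y = \<zero>" if "f \<in> ideal_prod type_ring I (ideal_power type_ring I T)" for f
      using that
    proof induction
      case (prod i j)
      then have "j \<odot> (i \<odot> y) = \<zero>" using IJ by (auto simp: J_def)
      then show ?case using y smult_commute[of y j i] by (simp add: smult_mult)
    next
      case (sum s1 s2)
      then show ?case using y by (simp add: smult_add)
    qed
    then have "\<forall>f\<in>ideal_power type_ring I (Suc T). f \<odot> y = \<zero>" by simp
    then show ?thesis using y unfolding K_def by blast
  qed
  \<comment> \<open>Induction on the sum of the exponents \<open>q\<close>: passing from
    \<open>y\<close> to \<open>f y\<close> reduces \<open>q f\<close> by one, and an exponent 0
    forces \<open>y = 0\<close>.\<close>
  have "y \<in> K" if "y \<in> carrier M" "\<forall>f\<in>F. f ^ q f \<odot> y = \<zero>" for y and q :: "_ \<Rightarrow> nat"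
    using that
  proof (induction "sum q F" arbitrary: q y rule: less_induct)
    case less
    show ?case
    proof (cases "\<exists>f\<in>F. q f = 0")
      case True
      then have "y = \<zero>" using less.prems by force
      then show ?thesis by (simp add: K_def)
    next
      case False
      show ?thesis
      proof (rule step[OF less.prems(1)], rule ballI)
        fix f assume f: "f \<in> F"
        let ?q = "q(f := q f - 1)"
        have "sum ?q F < sum q F"
          using F(1) f False by (intro sum_strict_mono_ex1) auto
        moreover have "g ^ ?q g \<odot> (f \<odot> y) = \<zero>" if g: "g \<in> F" for g
        proof (cases "g = f")
          case True
          have "f ^ ?q f * f = f ^ q f" using False f by (cases "q f") (auto simp: mult.commute)
          then show ?thesis
            using less.prems f True by (simp add: smult_mult[symmetric] del: fun_upd_apply)
        next
          case False
          then show ?thesis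
            using less.prems g smult_commute[OF less.prems(1), of "g ^ q g" f] by simp
        qed
        ultimately show "f \<odot> y \<in> K" using less.hyps less.prems(1) by auto
      qed
    qed
  qed
  moreover assume "\<forall>f\<in>F. feq f x \<zero>"
  then have "\<forall>f\<in>F. \<exists>t. f ^ t \<odot> x = \<zero>" by (simp add: feq_def)
  then obtain q where "\<forall>f\<in>F. f ^ q f \<odot> x = \<zero>" by metis
  ultimately have "x \<in> K" using x by blast
  then show "\<exists>t. \<forall>f\<in>ideal_power type_ring I t. f \<odot> x = \<zero>" by (simp add: K_def)
qed

lemma proj_feq_zero:
  assumes x: "x \<in> carrier M" and f: "feq (Poly_Mapping.single \<alpha> c) x \<zero>"
  shows "feq (Poly_Mapping.single \<alpha> c) (proj u x) \<zero>"
proof -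
  obtain t where t: "Poly_Mapping.single \<alpha> c ^ t \<odot> x = \<zero>" using f by (auto simp: feq_def)
  obtain \<beta> where "Poly_Mapping.single \<alpha> c ^ t = Poly_Mapping.single \<beta> (c ^ t)"
    using single_power by blast
  then have "Poly_Mapping.single \<alpha> c ^ t \<odot> proj u x = \<zero>" using proj_single[OF x, of \<beta> u "c ^ t"] t by simp
  then show ?thesis unfolding feq_def smult_zero by blast
qed

end

subsection \<open>Injective resolutions of the polynomial ring\<close>

locale resolution =
  fixes \<pi> :: "'a::idom" and \<epsilon> :: "('n::finite, 'a) mpoly \<Rightarrow> 'm"
    and E :: "nat \<Rightarrow> (('n, 'a) mpoly, 'm, 'n) graded_module" and d :: "nat \<Rightarrow> 'm \<Rightarrow> 'm"
  assumes dvr: "discrete_valuation_ring \<pi>" "adically_complete \<pi>"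
    and res: "graded_injective_resolution mpoly_module \<epsilon> E d"
begin

lemma inj: "graded_injective (E j)"
  using res by (simp add: graded_injective_resolution_def)

lemma gmod_E: "gmod (E j)"
  using inj by (intro gmod.intro) (simp add: graded_injective_def)

text \<open>The zero module, cut out of \<open>E 0\<close> so that it has the right type and the
  same zero element. The summand 0 in the component matches the twist \<open>a = 0\<close> of
  \<open>graded_shift\<close>.\<close>

definition trivial :: "(('n, 'a) mpoly, 'm, 'n) graded_module" where
  "trivial = E 0\<lparr>carrier := {\<zero>\<^bsub>E 0\<^esub>}, component := \<lambda>v. component (E 0) (\<lambda>k. 0 + v k) \<inter> {\<zero>\<^bsub>E 0\<^esub>}\<rparr>"

text \<open>The resolution continued by zero in negative degrees, to fit the integer indices of
  \<open>gcomplex\<close>.\<close>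

definition ext :: "int \<Rightarrow> (('n, 'a) mpoly, 'm, 'n) graded_module" where
  "ext j = (if j < 0 then trivial else E (nat j))"

definition ext_d :: "int \<Rightarrow> 'm \<Rightarrow> 'm" where
  "ext_d j = (if j < 0 then (\<lambda>_. \<zero>\<^bsub>E 0\<^esub>) else d (nat j))"

lemma ext_nat [simp]: "ext (int i) = E i" "ext_d (int i) = d i"
  by (simp_all add: ext_def ext_d_def)

lemma trivial_simps [simp]:
  "carrier trivial = {\<zero>\<^bsub>E 0\<^esub>}" "component trivial v = {\<zero>\<^bsub>E 0\<^esub>}" "\<zero>\<^bsub>trivial\<^esub> = \<zero>\<^bsub>E 0\<^esub>"
  "add trivial = add (E 0)" "module.smult trivial = module.smult (E 0)"
  using gmod.comp_zero[OF gmod_E] by (auto simp: trivial_def)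

lemma gmod_trivial: "gmod trivial"
proof -
  interpret gmod "E 0" by (rule gmod_E)
  have "is_graded_module trivial" unfolding trivial_def by (rule graded_shift) auto
  then show ?thesis by (rule gmod.intro)
qed

lemma gmod_ext: "gmod (ext j)"
  by (simp add: ext_def gmod_E gmod_trivial)

lemma zero_trivial_hom: "gmod N \<Longrightarrow> \<zero>\<^bsub>N\<^esub> = \<zero>\<^bsub>E 0\<^esub> \<Longrightarrow> (\<lambda>_. \<zero>\<^bsub>E 0\<^esub>) \<in> graded_hom trivial N"
  unfolding graded_hom_def mod_hom_def
proof -
  assume "gmod N" and z: "\<zero>\<^bsub>N\<^esub> = \<zero>\<^bsub>E 0\<^esub>"
  interpret gmod N by fact
  show "(\<lambda>_. \<zero>\<^bsub>E 0\<^esub>) \<in> {f \<in> {f \<in> carrier trivial \<rightarrow> carrier N.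
      (\<forall>x\<in>carrier trivial. \<forall>y\<in>carrier trivial. f (x \<oplus>\<^bsub>trivial\<^esub> y) = f x \<oplus>\<^bsub>N\<^esub> f y) \<and>
      (\<forall>r\<in>carrier type_ring. \<forall>x\<in>carrier trivial. f (r \<odot>\<^bsub>trivial\<^esub> x) = r \<odot>\<^bsub>N\<^esub> f x)}.
      \<forall>u. f ` component trivial u \<subseteq> component N u}"
    unfolding z[symmetric] by simp
qed

lemma d_hom: "d j \<in> graded_hom (E j) (E (Suc j))"
  using res by (simp add: graded_injective_resolution_def)

lemma gmod_hom_d: "gmod_hom (E j) (E (Suc j)) (d j)"
  by (intro gmod_hom.intro gmod_E gmod_hom_axioms.intro d_hom)

lemma d_zero [simp]: "d j \<zero>\<^bsub>E j\<^esub> = \<zero>\<^bsub>E (Suc j)\<^esub>"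
  by (rule gmod_hom.zero[OF gmod_hom_d])

lemma exact: "d j ` carrier (E j) = {x \<in> carrier (E (Suc j)). d (Suc j) x = \<zero>\<^bsub>E (Suc (Suc j))\<^esub>}"
  using res by (simp add: graded_injective_resolution_def a_kernel_def')

lemma exact_0: "range \<epsilon> = {x \<in> carrier (E 0). d 0 x = \<zero>\<^bsub>E (Suc 0)\<^esub>}"
  using res by (simp add: graded_injective_resolution_def a_kernel_def' mpoly_module_def)

lemma nat_cases_int:
  obtains "j < 0" | i where "j = int i"
  by (metis nonneg_int_cases not_less)

lemma int_Suc: "int i + 1 = int (Suc i)"
  by simp

sublocale X: gcomplex ext ext_d
proof
  fix j show "is_graded_module (ext j)" using gmod_ext[of j] by (simp add: gmod_def)
next
  fix j :: int
  show "ext_d j \<in> graded_hom (ext j) (ext (j + 1))"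
  proof (cases j rule: nat_cases_int)
    case 1
    have "\<zero>\<^bsub>ext (j + 1)\<^esub> = \<zero>\<^bsub>E 0\<^esub>" using 1 by (cases "j + 1 < 0") (auto simp: ext_def)
    then show ?thesis using zero_trivial_hom[OF gmod_ext[of "j + 1"]] 1 by (simp add: ext_def ext_d_def)
  next
    case (2 i)
    then show ?thesis using d_hom[of i] unfolding 2 int_Suc ext_nat by simp
  qed
next
  fix x and j :: int assume x: "x \<in> carrier (ext j)"
  show "ext_d (j + 1) (ext_d j x) = \<zero>\<^bsub>ext (j + 1 + 1)\<^esub>"
  proof (cases j rule: nat_cases_int)
    case 1
    \<comment> \<open>Only for \<open>j + 1 = 0\<close> does a genuine differential,
      \<open>d 0\<close>, follow the zero map.\<close>
    consider "j + 1 + 1 < 0" | "j + 1 = - 1" | "j + 1 = 0" using 1 by linarith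
    then show ?thesis
    proof cases
      case 3
      then have "ext (j + 1 + 1) = E (Suc 0)" "ext_d (j + 1) = d 0" by (simp_all add: ext_def ext_d_def)
      then show ?thesis using 1 by (simp add: ext_d_def)
    qed (simp_all add: ext_def ext_d_def)
  next
    case (2 i)
    then have "d i x \<in> d i ` carrier (E i)" using x by simp
    then show ?thesis unfolding exact 2 int_Suc ext_nat by simp
  qed
next
  fix z and j :: int and w \<alpha> and c :: 'a
  assume z: "z \<in> component (ext j) w"
  show "\<exists>s. \<exists>y\<in>component (ext j) (\<lambda>k. w k - int (Poly_Mapping.lookup \<alpha> k)).
      Poly_Mapping.single \<alpha> c ^ Suc s \<odot>\<^bsub>ext j\<^esub> y = Poly_Mapping.single \<alpha> c ^ s \<odot>\<^bsub>ext j\<^esub> z \<and>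
      (\<forall>r. r \<odot>\<^bsub>ext j\<^esub> z = \<zero>\<^bsub>ext j\<^esub> \<longrightarrow> r \<odot>\<^bsub>ext j\<^esub> y = \<zero>\<^bsub>ext j\<^esub>)"
  proof (cases j rule: nat_cases_int)
    case 1
    have "ext j = trivial" using 1 by (simp add: ext_def)
    then show ?thesis using z gmod.smult_zero[OF gmod_E[of 0]] by simp
  next
    case (2 i)
    then show ?thesis
      using gmod.divisible[OF gmod_E dvr inj, of z i w \<alpha> c] z by simp
  qed
qed

lemma straight_at_negative: "j < 0 \<Longrightarrow> X.straight_at {} j k v"
proof -
  assume j: "j < 0"
  have t: "ext j = trivial" "ext (j - 1) = trivial" "ext_d (j - 1) = (\<lambda>_. \<zero>\<^bsub>E 0\<^esub>)" "ext_d j = (\<lambda>_. \<zero>\<^bsub>E 0\<^esub>)"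
    using j by (simp_all add: ext_def ext_d_def)
  have z: "\<zero>\<^bsub>ext (j + 1)\<^esub> = \<zero>\<^bsub>E 0\<^esub>" using j by (cases "j + 1 < 0") (auto simp: ext_def)
  interpret gmod "E 0" by (rule gmod_E)
  show ?thesis
    unfolding X.straight_at_def t z gmod.tors_def[OF gmod_trivial] gmod.feq_def[OF gmod_trivial] trivial_simps
    by simp
qed

text \<open>A resolution has no cohomology in positive degrees, so every cocycle is a boundary and 0
  serves as the lift.\<close>

lemma straight_at_positive: "X.straight_at {} (int (Suc i)) k v"
proof -
  interpret D: gmod_hom "E i" "E (Suc i)" "d i" by (rule gmod_hom_d)
  have idx: "int (Suc i) - 1 = int i" "int (Suc i) + 1 = int (Suc (Suc i))" by simp_all
  \<comment> \<open>Exactness concerns whole modules. Projecting a preimage to degree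
    \<open>u\<close> gives exactness in each component.\<close>
  have lift: "\<exists>y\<in>component (E i) u. z = d i y"
    if z: "z \<in> component (E (Suc i)) u" "d (Suc i) z = \<zero>\<^bsub>E (Suc (Suc i))\<^esub>" for z u
  proof -
    have "z \<in> d i ` carrier (E i)" unfolding exact using z D.N.comp_carrier by simp
    then obtain y where y: "y \<in> carrier (E i)" "z = d i y" by blast
    then have "d i (D.M.proj u y) = z" using D.proj[OF y(1), of u] D.N.proj_component[OF z(1), of u] by simp
    then show ?thesis using D.M.proj_decomp(1)[OF y(1)] by blast
  qed
  show ?thesis
    unfolding X.straight_at_def idx ext_nat D.M.tors_def D.N.tors_def
  proof (intro conjI ballI impI)
    fix z assume "z \<in> {x \<in> component (E (Suc i)) (up k v). \<forall>f\<in>{}. D.N.feq f x \<zero>\<^bsub>E (Suc i)\<^esub>}"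
      and dz: "d (Suc i) z = \<zero>\<^bsub>E (Suc (Suc i))\<^esub>"
    then have z: "z \<in> component (E (Suc i)) (up k v)" by simp
    obtain y where y: "y \<in> component (E i) (up k v)" "z = d i y" using lift[OF z dz] by blast
    have "z \<oplus>\<^bsub>E (Suc i)\<^esub> d i (\<ominus>\<^bsub>E i\<^esub> y) = \<zero>\<^bsub>E (Suc i)\<^esub>"
      using D.M.comp_carrier[OF y(1)] D.N.comp_carrier[OF z] y(2) by (simp add: D.neg D.N.M.r_neg)
    then show "\<exists>w\<in>{x \<in> component (E (Suc i)) v. \<forall>f\<in>{}. D.N.feq f x \<zero>\<^bsub>E (Suc i)\<^esub>}.
        \<exists>y\<in>{x \<in> component (E i) (up k v). \<forall>f\<in>{}. D.M.feq f x \<zero>\<^bsub>E i\<^esub>}.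
        d (Suc i) w = \<zero>\<^bsub>E (Suc (Suc i))\<^esub> \<and> var k \<odot>\<^bsub>E (Suc i)\<^esub> w = z \<oplus>\<^bsub>E (Suc i)\<^esub> d i y"
      using D.M.comp_neg[OF y(1)]
      by (intro bexI[of _ "\<zero>\<^bsub>E (Suc i)\<^esub>"] bexI[of _ "\<ominus>\<^bsub>E i\<^esub> y"]) simp_all
  qed (use lift in auto)
qed

lemma mpoly_component_single:
  assumes r: "r \<in> mpoly_component v" and \<alpha>: "\<alpha> \<in> Poly_Mapping.keys r"
  shows "r = Poly_Mapping.single \<alpha> (Poly_Mapping.lookup r \<alpha>)"
proof -
  have deg: "int (Poly_Mapping.lookup \<beta> l) = v l" if "\<beta> \<in> Poly_Mapping.keys r" for \<beta> l
    using r that by (simp add: mpoly_component_def)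
  have "\<beta> = \<alpha>" if "\<beta> \<in> Poly_Mapping.keys r" for \<beta>
  proof (rule poly_mapping_eqI)
    fix l
    have "int (Poly_Mapping.lookup \<beta> l) = int (Poly_Mapping.lookup \<alpha> l)"
      using deg[OF that, of l] deg[OF \<alpha>, of l] by simp
    then show "Poly_Mapping.lookup \<beta> l = Poly_Mapping.lookup \<alpha> l" by simp
  qed
  then show ?thesis
    by (intro poly_mapping_eqI) (auto simp: lookup_single when_def in_keys_iff)
qed

lemma var_cancel:
  fixes r :: "('n, 'a) mpoly"
  assumes "r \<in> mpoly_component v" "var k * r = 0"
  shows "r = 0"
proof (rule ccontr)
  assume "r \<noteq> 0"
  then obtain \<alpha> where \<alpha>: "\<alpha> \<in> Poly_Mapping.keys r"
    using poly_mapping_eqI[of r 0] by (auto simp: in_keys_iff)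
  have "var k * r = Poly_Mapping.single (Poly_Mapping.single k 1 + \<alpha>) (Poly_Mapping.lookup r \<alpha>)"
    by (subst mpoly_component_single[OF assms(1) \<alpha>]) (simp add: mult_single)
  then have "Poly_Mapping.lookup (var k * r) (Poly_Mapping.single k 1 + \<alpha>) = Poly_Mapping.lookup r \<alpha>" by simp
  then show False using assms(2) \<alpha> by (simp add: in_keys_iff)
qed

text \<open>This is where -1 is excluded: a monomial of degree \<open>up k v\<close> contains the
  variable \<open>k\<close> with exponent \<open>v k + 1\<close>, which must not be 0.\<close>

lemma var_divides:
  fixes r :: "('n, 'a) mpoly"
  assumes r: "r \<in> mpoly_component (up k v)" and v: "v k \<noteq> -1"
  obtains r' where "r' \<in> mpoly_component v" "r = var k * r'"
proof (cases "r = 0")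
  case True
  then show ?thesis using that[of 0] by (simp add: mpoly_component_def)
next
  case False
  then obtain \<alpha> where \<alpha>: "\<alpha> \<in> Poly_Mapping.keys r"
    using poly_mapping_eqI[of r 0] by (auto simp: in_keys_iff)
  have deg: "int (Poly_Mapping.lookup \<alpha> l) = up k v l" for l
    using r \<alpha> by (simp add: mpoly_component_def)
  have "Poly_Mapping.lookup \<alpha> k \<noteq> 0" using deg[of k] v by auto
  then obtain \<beta> where \<beta>: "\<alpha> = Poly_Mapping.single k 1 + \<beta>"
    "Poly_Mapping.single \<alpha> (Poly_Mapping.lookup r \<alpha>) = var k * Poly_Mapping.single \<beta> (Poly_Mapping.lookup r \<alpha>)"
    by (rule single_split_var) blast
  let ?r = "Poly_Mapping.single \<beta> (Poly_Mapping.lookup r \<alpha>)"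
  have "r = var k * ?r" using mpoly_component_single[OF r \<alpha>] \<beta>(2) by simp
  moreover have "int (Poly_Mapping.lookup \<beta> l) = v l" for l
    using deg[of l] by (simp add: \<beta>(1) lookup_add)
  then have "?r \<in> mpoly_component v" by (simp add: mpoly_component_def)
  ultimately show ?thesis using that by blast
qed

text \<open>The kernel of \<open>d 0\<close> is the copy of \<open>R\<close> under \<epsilon>, and
  no boundaries come from degree -1. The claim is thus about \<open>R\<close>:
  \<open>var_divides\<close> gives surjectivity and \<open>var_cancel\<close> injectivity.\<close>

lemma straight_at_zero:
  assumes v: "v k \<noteq> -1"
  shows "X.straight_at {} 0 k v"
proof -
  have gm: "is_graded_module (mpoly_module :: (('n, 'a) mpoly, ('n, 'a) mpoly, 'n) graded_module)"
    and eps: "\<epsilon> \<in> graded_hom mpoly_module (E 0)" and eps_inj: "inj \<epsilon>"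
    using res by (simp_all add: graded_injective_resolution_def mpoly_module_def)
  interpret e: gmod_hom mpoly_module "E 0" \<epsilon>
    by (intro gmod_hom.intro gmod.intro gm gmod_E gmod_hom_axioms.intro eps)
  have simps: "carrier mpoly_module = UNIV" "component mpoly_module = mpoly_component"
    "module.smult mpoly_module = (*)" "\<zero>\<^bsub>mpoly_module\<^esub> = 0"
    by (simp_all add: mpoly_module_def)
  have lift: "\<exists>r\<in>mpoly_component u. z = \<epsilon> r"
    if z: "z \<in> component (E 0) u" "d 0 z = \<zero>\<^bsub>E (Suc 0)\<^esub>" for z u
  proof -
    have "z \<in> range \<epsilon>" unfolding exact_0 using z e.N.comp_carrier by simp
    then obtain r where r: "z = \<epsilon> r" by blast
    then have "\<epsilon> (e.M.proj u r) = z"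
      using e.proj[of r u] e.N.proj_component[OF z(1), of u] by (simp add: simps)
    then show ?thesis using e.M.proj_decomp(1)[of r u] by (auto simp: simps)
  qed
  have de: "d 0 (\<epsilon> r) = \<zero>\<^bsub>E (Suc 0)\<^esub>" for r
    using exact_0 by blast
  have idx: "ext 0 = E 0" "ext_d 0 = d 0" "ext (0 + 1) = E (Suc 0)" "ext (0 - 1) = trivial"
    "ext_d (0 - 1) = (\<lambda>_. \<zero>\<^bsub>E 0\<^esub>)"
    by (simp_all add: ext_def ext_d_def)
  show ?thesis
    unfolding X.straight_at_def idx e.N.tors_def gmod.tors_def[OF gmod_trivial] trivial_simps
  proof (intro conjI ballI impI)
    fix z assume "z \<in> {x \<in> component (E 0) (up k v). \<forall>f\<in>{}. e.N.feq f x \<zero>\<^bsub>E 0\<^esub>}"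
      and dz: "d 0 z = \<zero>\<^bsub>E (Suc 0)\<^esub>"
    then have z: "z \<in> component (E 0) (up k v)" by simp
    obtain r where r: "r \<in> mpoly_component (up k v)" "z = \<epsilon> r" using lift[OF z dz] by blast
    obtain r' where r': "r' \<in> mpoly_component v" "r = var k * r'" by (rule var_divides[OF r(1) v])
    have "var k \<odot>\<^bsub>E 0\<^esub> \<epsilon> r' = z" using e.smult[of r' "var k"] r(2) r'(2) by (simp add: simps)
    then show "\<exists>w\<in>{x \<in> component (E 0) v. \<forall>f\<in>{}. e.N.feq f x \<zero>\<^bsub>E 0\<^esub>}.
        \<exists>y\<in>{x \<in> {\<zero>\<^bsub>E 0\<^esub>}. \<forall>f\<in>{}. gmod.feq trivial f x \<zero>\<^bsub>E 0\<^esub>}.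
          d 0 w = \<zero>\<^bsub>E (Suc 0)\<^esub> \<and> var k \<odot>\<^bsub>E 0\<^esub> w = z \<oplus>\<^bsub>E 0\<^esub> \<zero>\<^bsub>E 0\<^esub>"
      using e.comp[of r' v] r'(1) de e.N.comp_carrier[OF z]
      by (intro bexI[of _ "\<epsilon> r'"] bexI[of _ "\<zero>\<^bsub>E 0\<^esub>"]) (simp_all add: simps)
  next
    fix z y assume "z \<in> {x \<in> component (E 0) v. \<forall>f\<in>{}. e.N.feq f x \<zero>\<^bsub>E 0\<^esub>}"
      and dz: "d 0 z = \<zero>\<^bsub>E (Suc 0)\<^esub>" and zy: "var k \<odot>\<^bsub>E 0\<^esub> z = \<zero>\<^bsub>E 0\<^esub>"
    then obtain r where r: "r \<in> mpoly_component v" "z = \<epsilon> r" using lift[of z v] by auto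
    have "\<epsilon> (var k * r) = \<epsilon> 0" using e.smult[of r "var k"] zy r(2) e.zero by (simp add: simps)
    then have "var k * r = 0" using eps_inj by (simp add: inj_eq)
    then have "r = 0" by (rule var_cancel[OF r(1)])
    then show "\<exists>y\<in>{x \<in> {\<zero>\<^bsub>E 0\<^esub>}. \<forall>f\<in>{}. gmod.feq trivial f x \<zero>\<^bsub>E 0\<^esub>}. z = \<zero>\<^bsub>E 0\<^esub>"
      using r(2) e.zero by (simp add: simps)
  qed
qed

lemma straight_empty: "X.straight {}"
  unfolding X.straight_def
proof (intro allI impI)
  fix j :: int and k and v :: "'n \<Rightarrow> int" assume v: "v k \<noteq> -1"
  show "X.straight_at {} j k v"
  proof (cases j rule: nat_cases_int)
    case 1
    then show ?thesis by (rule straight_at_negative)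
  next
    case (2 i)
    then show ?thesis
      using straight_at_zero[of v k] v straight_at_positive by (cases i) (auto simp del: of_nat_Suc)
  qed
qed

end

section \<open>Equality of the ranks in neighbouring degrees\<close>

lemma free_plus_fract_unique:
  fixes \<pi> :: "'a::idom"
  assumes dvr: "discrete_valuation_ring \<pi>" "adically_complete \<pi>"
    and iso: "mod_iso type_ring (free_plus_fract a b :: ('a, _) module) (free_plus_fract a' b')"
      "mod_iso type_ring (free_plus_fract a' b' :: ('a, _) module) (free_plus_fract a b)"
  shows "a = a' \<and> b = b'"
proof -
  have sep: "x = 0" if "\<forall>k. \<pi> ^ k dvd x" for x using dvr(2) that unfolding adically_complete_def by blast
  have le: "a + b \<le> a' + b' \<and> b \<le> b'"
    if "mod_iso type_ring (free_plus_fract a b :: ('a, _) module) (free_plus_fract a' b')" for a b a' b'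
    using that inj_free_plus_fract_le[OF dvr_nonzero[OF dvr(1)] sep]
    unfolding mod_iso_def bij_betw_def by blast
  show ?thesis using le[OF iso(1)] le[OF iso(2)] by linarith
qed

lemma free_plus_fract_smult_0: "0 \<odot>\<^bsub>free_plus_fract a b\<^esub> y = \<zero>\<^bsub>free_plus_fract a b\<^esub>"
  by (simp only: free_plus_fract_simps Zero_fract_def[symmetric]) simp

context resolution begin

text \<open>Two surjections from the cocycles of degree \<open>u\<close> are compared:
  \<open>h\<close> onto the module with ranks \<open>a u\<close>, \<open>b u\<close>, and
  multiplication by \<open>X_k\<close> followed by \<open>h'\<close> onto the one of the next
  degree. Straightness makes the second surjective and gives it the kernel of the first.\<close>

lemma component_eq:
  assumes I: "C_monomial_ideal I"
    and iso: "\<And>u. mod_iso type_ring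
       (quotient_module (component_module (local_cohomology I E d i) u)
         (pi_torsion \<pi> (component_module (local_cohomology I E d i) u)))
       (free_plus_fract (a u) (b u))"
    and u: "u k \<noteq> -1"
  shows "a u = a (up k u) \<and> b u = b (up k u)"
proof -
  obtain F where F: "finite F" "F \<subseteq> {Poly_Mapping.single \<alpha> c |\<alpha> c. True}" "F \<subseteq> I"
    "\<And>J. ideal J type_ring \<Longrightarrow> F \<subseteq> J \<Longrightarrow> I \<subseteq> J"
    using C_monomial_finite_generators[OF dvr I] by blast
  have straight: "X.straight F" by (rule X.straight_finite[OF straight_empty F(1,2)])
  interpret D: gmod_hom "E i" "E (Suc i)" "d i" by (rule gmod_hom_d)
  have "gmod_hom (ext (int i - 1)) (E i) (ext_d (int i - 1))" using X.d_gmod_hom'[of "int i"] by simp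
  then interpret D': gmod_hom "ext (int i - 1)" "E i" "ext_d (int i - 1)" .
  have dd: "d i (ext_d (int i - 1) y) = \<zero>\<^bsub>E (Suc i)\<^esub>" if "y \<in> carrier (ext (int i - 1))" for y
    using X.d_d'[OF that] unfolding int_Suc ext_nat .
  define T where "T j = {x \<in> carrier (E j). \<forall>f\<in>F. gmod.feq (E j) f x \<zero>\<^bsub>E j\<^esub>}" for j
  have T: "{x \<in> carrier (E j). \<exists>t. \<forall>f\<in>ideal_power type_ring I t. f \<odot>\<^bsub>E j\<^esub> x = \<zero>\<^bsub>E j\<^esub>} = T j" for j
    using gmod.ideal_torsion_iff[OF gmod_E F(1,3,4)] unfolding T_def by blast
  let ?C = "\<lambda>j. ideal_torsion I (E j)"
  let ?P = "graded_submodule (?C i) (a_kernel (?C i) (?C (Suc i)) (d i))"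
  let ?B = "case i of 0 \<Rightarrow> {\<zero>\<^bsub>?C 0\<^esub>} | Suc j \<Rightarrow> d j ` carrier (?C j)"
  have M: "local_cohomology I E d i = graded_quotient ?P ?B"
    by (simp add: local_cohomology_def cohomology_def)
  have C: "carrier (?C j) = T j" "component (?C j) v = component (E j) v \<inter> T j" "\<zero>\<^bsub>?C j\<^esub> = \<zero>\<^bsub>E j\<^esub>"
    "add (?C j) = add (E j)" "module.smult (?C j) = module.smult (E j)" for j v
    by (simp_all add: ideal_torsion_def graded_submodule_def T)
  have P: "carrier ?P = {x \<in> T i. d i x = \<zero>\<^bsub>E (Suc i)\<^esub>}" "\<zero>\<^bsub>?P\<^esub> = \<zero>\<^bsub>E i\<^esub>"
    "add ?P = add (E i)" "module.smult ?P = module.smult (E i)"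
    "component ?P v = component (E i) v \<inter> T i \<inter> {x \<in> T i. d i x = \<zero>\<^bsub>E (Suc i)\<^esub>}" for v
    unfolding graded_submodule_def by (simp_all add: C a_kernel_def')
  have Pcomp: "x \<in> component ?P v \<longleftrightarrow> x \<in> D.M.tors F v \<and> d i x = \<zero>\<^bsub>E (Suc i)\<^esub>" for x v
    unfolding P D.M.tors_def T_def using D.M.comp_carrier by blast
  \<comment> \<open>In terms of \<open>ext\<close>, the case \<open>i = 0\<close> and the successor
    case become one formula, so that straightness in all degrees applies uniformly.\<close>
  have B: "?B = ext_d (int i - 1) ` {y \<in> carrier (ext (int i - 1)).
      \<forall>f\<in>F. D'.M.feq f y \<zero>\<^bsub>ext (int i - 1)\<^esub>}"
  proof (cases i)
    case 0
    have e: "ext (int 0 - 1) = trivial" "ext_d (int 0 - 1) = (\<lambda>_. \<zero>\<^bsub>E 0\<^esub>)"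
      by (simp_all add: ext_def ext_d_def)
    show ?thesis unfolding 0 e gmod.feq_def[OF gmod_trivial] by (auto simp: C)
  next
    case (Suc j)
    have e: "int (Suc j) - 1 = int j" by simp
    show ?thesis unfolding Suc e ext_nat by (simp add: C T_def)
  qed
  have Tadd: "x \<oplus>\<^bsub>E i\<^esub> y \<in> T i" if "x \<in> T i" "y \<in> T i" for x y
    using that D.M.feq_add[of _ x "\<zero>\<^bsub>E i\<^esub>" y "\<zero>\<^bsub>E i\<^esub>"] by (simp add: T_def)
  have Tsmult: "r \<odot>\<^bsub>E i\<^esub> x \<in> T i" if "x \<in> T i" for r x
    using that D.M.feq_smult[of _ x "\<zero>\<^bsub>E i\<^esub>" r] by (simp add: T_def)
  have T0: "\<zero>\<^bsub>E i\<^esub> \<in> T i" by (simp add: T_def D.M.feq_refl)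
  have Tc: "x \<in> carrier (E i)" if "x \<in> T i" for x using that by (simp add: T_def)
  have modP: "Module.module type_ring ?P"
  proof (rule module_restrict[OF D.M.module_axioms _ _ _ _ P(1) P(3) P(2) P(4)])
    show "x \<oplus>\<^bsub>E i\<^esub> y \<in> {x \<in> T i. d i x = \<zero>\<^bsub>E (Suc i)\<^esub>}"
      if "x \<in> {x \<in> T i. d i x = \<zero>\<^bsub>E (Suc i)\<^esub>}" "y \<in> {x \<in> T i. d i x = \<zero>\<^bsub>E (Suc i)\<^esub>}" for x y
      using that Tadd Tc by (simp add: D.add)
    show "r \<odot>\<^bsub>E i\<^esub> x \<in> {x \<in> T i. d i x = \<zero>\<^bsub>E (Suc i)\<^esub>}"
      if "x \<in> {x \<in> T i. d i x = \<zero>\<^bsub>E (Suc i)\<^esub>}" for r x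
      using that Tsmult Tc by (simp add: D.smult)
  qed (use T0 Tc in auto)
  have Bsmult: "r \<odot>\<^bsub>E i\<^esub> x \<in> ?B" if x: "x \<in> ?B" for r x
  proof -
    obtain y where y: "y \<in> carrier (ext (int i - 1))" "x = ext_d (int i - 1) y"
      "\<And>f. f \<in> F \<Longrightarrow> D'.M.feq f y \<zero>\<^bsub>ext (int i - 1)\<^esub>"
      using x unfolding B by blast
    have "D'.M.feq f (r \<odot>\<^bsub>ext (int i - 1)\<^esub> y) \<zero>\<^bsub>ext (int i - 1)\<^esub>" if "f \<in> F" for f
      using D'.M.feq_smult[OF y(3)[OF that], of r] y(1) by simp
    moreover have "r \<odot>\<^bsub>E i\<^esub> x = ext_d (int i - 1) (r \<odot>\<^bsub>ext (int i - 1)\<^esub> y)"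
      using y by (simp add: D'.smult)
    ultimately show ?thesis unfolding B using y(1) by (intro image_eqI) auto
  qed
  interpret Q: mod_quot type_ring ?P ?B
  proof (rule mod_quot.intro[OF modP], unfold_locales)
    show "?B \<subseteq> carrier ?P"
    proof
      fix x assume "x \<in> ?B"
      then obtain y where y: "y \<in> carrier (ext (int i - 1))" "x = ext_d (int i - 1) y"
        "\<And>f. f \<in> F \<Longrightarrow> D'.M.feq f y \<zero>\<^bsub>ext (int i - 1)\<^esub>" unfolding B by blast
      have "D.M.feq f x \<zero>\<^bsub>E i\<^esub>" if "f \<in> F" for f
        using D'.feq[OF y(3)[OF that] y(1)] y(2) by (simp add: D'.zero)
      then show "x \<in> carrier ?P" unfolding P T_def using y D'.closed dd by simp
    qed
    show "\<zero>\<^bsub>?P\<^esub> \<in> ?B"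
      unfolding P B using D'.zero[symmetric] by (rule image_eqI) (simp add: D'.M.feq_refl)
    fix x y assume "x \<in> ?B" "y \<in> ?B"
    then obtain x' y' where xy: "x' \<in> carrier (ext (int i - 1))" "x = ext_d (int i - 1) x'"
      "\<And>f. f \<in> F \<Longrightarrow> D'.M.feq f x' \<zero>\<^bsub>ext (int i - 1)\<^esub>"
      "y' \<in> carrier (ext (int i - 1))" "y = ext_d (int i - 1) y'"
      "\<And>f. f \<in> F \<Longrightarrow> D'.M.feq f y' \<zero>\<^bsub>ext (int i - 1)\<^esub>" unfolding B by blast
    have "D'.M.feq f (x' \<oplus>\<^bsub>ext (int i - 1)\<^esub> y') \<zero>\<^bsub>ext (int i - 1)\<^esub>" if "f \<in> F" for f
      using D'.M.feq_add[OF xy(3)[OF that] xy(6)[OF that]] xy(1,4) by simp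
    moreover have "x \<oplus>\<^bsub>E i\<^esub> y = ext_d (int i - 1) (x' \<oplus>\<^bsub>ext (int i - 1)\<^esub> y')"
      using xy by (simp add: D'.add)
    ultimately show "x \<oplus>\<^bsub>?P\<^esub> y \<in> ?B" unfolding P B using xy(1,4) by (intro image_eqI) auto
  next
    fix r x assume "x \<in> ?B"
    then show "r \<odot>\<^bsub>?P\<^esub> x \<in> ?B" unfolding P by (rule Bsmult)
  qed
  \<comment> \<open>\<open>?B\<close> collects boundaries of arbitrary torsion elements. For
    straightness the preimage must be homogeneous, and its projection is still torsion because the
    members of \<open>F\<close> are terms.\<close>
  have B_comp: "\<exists>y\<in>D'.M.tors F v. x = ext_d (int i - 1) y" if x: "x \<in> ?B" "x \<in> component (E i) v" for x v
  proof -
    obtain y where y: "y \<in> carrier (ext (int i - 1))" "x = ext_d (int i - 1) y"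
      "\<And>f. f \<in> F \<Longrightarrow> D'.M.feq f y \<zero>\<^bsub>ext (int i - 1)\<^esub>" using x(1) unfolding B by blast
    have "D'.M.feq f (D'.M.proj v y) \<zero>\<^bsub>ext (int i - 1)\<^esub>" if f: "f \<in> F" for f
    proof -
      obtain \<alpha> c where "f = Poly_Mapping.single \<alpha> c" using F(2) f by blast
      then show ?thesis using D'.M.proj_feq_zero[OF y(1)] y(3)[OF f] by simp
    qed
    then have "D'.M.proj v y \<in> D'.M.tors F v"
      unfolding D'.M.tors_def using D'.M.proj_decomp(1)[OF y(1)] by simp
    moreover have "x = ext_d (int i - 1) (D'.M.proj v y)"
      using D'.proj[OF y(1), of v] D.M.proj_component[OF x(2), of v] y(2) by simp
    ultimately show ?thesis by blast
  qed
  have B_tors: "ext_d (int i - 1) y \<in> ?B" if "y \<in> D'.M.tors F v" for y v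
    unfolding B using that D'.M.tors_carrier[OF that] by (auto simp: D'.M.tors_def)
  have comp: "component ?P v \<subseteq> carrier ?P" "\<zero>\<^bsub>?P\<^esub> \<in> component ?P v"
    "\<And>x y. x \<in> component ?P v \<Longrightarrow> y \<in> component ?P v \<Longrightarrow> x \<oplus>\<^bsub>?P\<^esub> y \<in> component ?P v"
    "\<And>a x. x \<in> component ?P v \<Longrightarrow> Poly_Mapping.single 0 a \<odot>\<^bsub>?P\<^esub> x \<in> component ?P v" for v
  proof -
    show "component ?P v \<subseteq> carrier ?P" unfolding P by blast
    show "\<zero>\<^bsub>?P\<^esub> \<in> component ?P v" unfolding Pcomp P(2) by (simp add: D.M.tors_zero)
    show "x \<oplus>\<^bsub>?P\<^esub> y \<in> component ?P v" if "x \<in> component ?P v" "y \<in> component ?P v" for x y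
      using that unfolding Pcomp P(3) using D.M.tors_carrier[of _ F v] by (simp add: D.M.tors_add D.add)
    show "Poly_Mapping.single 0 a \<odot>\<^bsub>?P\<^esub> x \<in> component ?P v" if "x \<in> component ?P v" for a x
      using that D.M.tors_single[of x F v 0 a] D.M.tors_carrier[of x F v] unfolding Pcomp P(4)
      by (simp add: D.smult)
  qed
  let ?v = "up k u"
  let ?F = "free_plus_fract (a u) (b u) :: ('a, _) module"
  let ?F' = "free_plus_fract (a ?v) (b ?v) :: ('a, _) module"
  obtain h where h: "h \<in> mod_hom type_ring (component_module ?P u) ?F" "h ` component ?P u = carrier ?F"
    "h \<zero>\<^bsub>?P\<^esub> = \<zero>\<^bsub>?F\<^esub>"
    "\<And>x. x \<in> component ?P u \<Longrightarrow> h x = \<zero>\<^bsub>?F\<^esub> \<longleftrightarrow> (\<exists>n. Poly_Mapping.single 0 (\<pi> ^ n) \<odot>\<^bsub>?P\<^esub> x \<in> ?B)"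
    using component_quotient_hom[OF Q.mod_quot_axioms comp iso[of u, unfolded M] free_plus_fract_smult_0]
    by blast
  obtain h' where h': "h' \<in> mod_hom type_ring (component_module ?P ?v) ?F'"
    "h' ` component ?P ?v = carrier ?F'" "h' \<zero>\<^bsub>?P\<^esub> = \<zero>\<^bsub>?F'\<^esub>"
    "\<And>x. x \<in> component ?P ?v \<Longrightarrow> h' x = \<zero>\<^bsub>?F'\<^esub> \<longleftrightarrow> (\<exists>n. Poly_Mapping.single 0 (\<pi> ^ n) \<odot>\<^bsub>?P\<^esub> x \<in> ?B)"
    using component_quotient_hom[OF Q.mod_quot_axioms comp iso[of ?v, unfolded M] free_plus_fract_smult_0]
    by blast
  have h'add: "h' (x \<oplus>\<^bsub>E i\<^esub> y) = h' x \<oplus>\<^bsub>?F'\<^esub> h' y" if "x \<in> component ?P ?v" "y \<in> component ?P ?v" for x y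
    using h'(1) that unfolding mod_hom_def component_module_def by (simp add: P(3))
  have h'sm: "h' (Poly_Mapping.single 0 c \<odot>\<^bsub>E i\<^esub> x) = c \<odot>\<^bsub>?F'\<^esub> h' x" if "x \<in> component ?P ?v" for c x
    using h'(1) that unfolding mod_hom_def component_module_def by (simp add: P(4))
  have mult: "var k \<odot>\<^bsub>E i\<^esub> x \<in> component ?P ?v" if "x \<in> component ?P u" for x
    using that D.M.tors_single[of x F u "Poly_Mapping.single k 1" 1] D.M.tors_carrier[of x F u]
    unfolding Pcomp by (simp add: D.smult)
  have Pc: "x \<in> carrier (E i)" if "x \<in> component ?P v" for x v
    using that D.M.tors_carrier unfolding Pcomp by blast
  \<comment> \<open>Surjective only modulo boundaries, which suffices because \<open>h'\<close>
    kills them.\<close>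
  define h2 where "h2 x = h' (var k \<odot>\<^bsub>E i\<^esub> x)" for x
  have "h2 \<in> mod_hom type_ring (component_module ?P u) ?F'"
  proof -
    have "h2 (x \<oplus>\<^bsub>E i\<^esub> y) = h2 x \<oplus>\<^bsub>?F'\<^esub> h2 y" if "x \<in> component ?P u" "y \<in> component ?P u" for x y
      unfolding h2_def D.M.smult_distr[OF Pc[OF that(1)] Pc[OF that(2)]]
      by (rule h'add[OF mult mult]) (use that in auto)
    moreover have "h2 (Poly_Mapping.single 0 c \<odot>\<^bsub>E i\<^esub> x) = c \<odot>\<^bsub>?F'\<^esub> h2 x" if "x \<in> component ?P u" for c x
      unfolding h2_def D.M.smult_commute[OF Pc[OF that], of "var k"] by (rule h'sm[OF mult[OF that]])
    moreover have "h2 x \<in> carrier ?F'" if "x \<in> component ?P u" for x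
      unfolding h2_def h'(2)[symmetric] using mult[OF that] by blast
    ultimately show ?thesis unfolding mod_hom_def component_module_def by (simp add: P(3,4))
  qed
  moreover have "h2 ` component ?P u = carrier ?F'"
  proof (rule Set.set_eqI, rule iffI)
    fix y assume "y \<in> h2 ` component ?P u"
    then show "y \<in> carrier ?F'" unfolding h2_def h'(2)[symmetric] using mult by blast
  next
    fix y assume "y \<in> carrier ?F'"
    then obtain z where z: "z \<in> component ?P ?v" "y = h' z" unfolding h'(2)[symmetric] by blast
    then have "z \<in> X.C F (int i) ?v" "ext_d (int i) z = \<zero>\<^bsub>ext (int i + 1)\<^esub>"
      unfolding Pcomp int_Suc ext_nat by simp_all
    from X.straight_surj[OF straight u this, unfolded int_Suc ext_nat]
    obtain w y' where w: "w \<in> D.M.tors F u" "y' \<in> D'.M.tors F ?v" "d i w = \<zero>\<^bsub>E (Suc i)\<^esub>"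
      "var k \<odot>\<^bsub>E i\<^esub> w = z \<oplus>\<^bsub>E i\<^esub> ext_d (int i - 1) y'" by blast
    let ?b = "ext_d (int i - 1) y'"
    have b: "?b \<in> ?B" "?b \<in> component ?P ?v"
      using B_tors[OF w(2)] D'.tors[OF w(2)] dd[OF D'.M.tors_carrier[OF w(2)]] unfolding Pcomp by simp_all
    \<comment> \<open>The exponent 0 in the description of the kernel of \<open>h'\<close> shows
      that boundaries lie in it.\<close>
    have 0: "Poly_Mapping.single 0 (\<pi> ^ 0) \<odot>\<^bsub>?P\<^esub> ?b \<in> ?B" unfolding P(4) by (rule Bsmult[OF b(1)])
    have b0: "h' ?b = \<zero>\<^bsub>?F'\<^esub>" unfolding h'(4)[OF b(2)] by (rule exI) (rule 0)
    have "h' (z \<oplus>\<^bsub>E i\<^esub> ?b) = h' z \<oplus>\<^bsub>?F'\<^esub> h' ?b" by (rule h'add[OF z(1) b(2)])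
    also have "\<dots> = h' z \<oplus>\<^bsub>?F'\<^esub> h' \<zero>\<^bsub>?P\<^esub>" by (simp only: b0 h'(3))
    also have "\<dots> = h' (z \<oplus>\<^bsub>E i\<^esub> \<zero>\<^bsub>?P\<^esub>)" by (rule h'add[OF z(1) comp(2), symmetric])
    also have "\<dots> = h' z" unfolding P(2) using Pc[OF z(1)] by simp
    also have "\<dots> = y" by (rule z(2)[symmetric])
    finally have "h2 w = y" unfolding h2_def w(4) .
    moreover have "w \<in> component ?P u" unfolding Pcomp using w by simp
    ultimately show "y \<in> h2 ` component ?P u" by blast
  qed
  moreover have "h2 \<zero>\<^bsub>?P\<^esub> = \<zero>\<^bsub>?F'\<^esub>" using h'(3) unfolding h2_def P(2) by simp
  moreover have "h x = \<zero>\<^bsub>?F\<^esub> \<longleftrightarrow> h2 x = \<zero>\<^bsub>?F'\<^esub>" if x: "x \<in> component ?P u" for x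
  proof -
    \<comment> \<open>\<open>X_k\<close> commutes with the power of \<pi>, and by
      \<open>straight_inj\<close> the cocycle \<open>\<pi> ^ n x\<close> is a boundary if
      \<open>X_k\<close> times it is one. The two kernels therefore agree for the same
      \<open>n\<close>.\<close>
    have "Poly_Mapping.single 0 (\<pi> ^ n) \<odot>\<^bsub>E i\<^esub> x \<in> ?B \<longleftrightarrow>
        Poly_Mapping.single 0 (\<pi> ^ n) \<odot>\<^bsub>E i\<^esub> (var k \<odot>\<^bsub>E i\<^esub> x) \<in> ?B" for n
    proof -
      let ?z = "Poly_Mapping.single 0 (\<pi> ^ n) \<odot>\<^bsub>E i\<^esub> x"
      have z: "?z \<in> component ?P u" using comp(4)[OF x, of "\<pi> ^ n"] unfolding P(4) .
      have comm: "Poly_Mapping.single 0 (\<pi> ^ n) \<odot>\<^bsub>E i\<^esub> (var k \<odot>\<^bsub>E i\<^esub> x) = var k \<odot>\<^bsub>E i\<^esub> ?z"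
        by (rule D.M.smult_commute[OF Pc[OF x]])
      have "?z \<in> ?B" if vz: "var k \<odot>\<^bsub>E i\<^esub> ?z \<in> ?B"
      proof -
        have "var k \<odot>\<^bsub>E i\<^esub> ?z \<in> component (E i) ?v"
          using mult[OF z] D.M.tors_component unfolding Pcomp by blast
        then obtain y where y: "y \<in> D'.M.tors F ?v" "var k \<odot>\<^bsub>E i\<^esub> ?z = ext_d (int i - 1) y"
          using B_comp[OF vz] by blast
        have zc: "?z \<in> X.C F (int i) u" "ext_d (int i) ?z = \<zero>\<^bsub>ext (int i + 1)\<^esub>"
          using z unfolding Pcomp int_Suc ext_nat by simp_all
        have "\<exists>y\<in>D'.M.tors F u. ?z = ext_d (int i - 1) y"
          using X.straight_inj[OF straight u zc(1) y(1) zc(2), unfolded ext_nat] y(2) by blast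
        then show ?thesis using B_tors by auto
      qed
      then show ?thesis unfolding comm using Bsmult by blast
    qed
    then show ?thesis unfolding h2_def h(4)[OF x] h'(4)[OF mult[OF x]] P(4) by simp
  qed
  moreover have "Module.module type_ring (component_module ?P u)"
    by (rule module_component[OF modP comp])
  moreover have "carrier (component_module ?P u) = component ?P u" "\<zero>\<^bsub>component_module ?P u\<^esub> = \<zero>\<^bsub>?P\<^esub>"
    by (simp_all add: component_module_def)
  ultimately have "mod_iso type_ring ?F ?F'" "mod_iso type_ring ?F' ?F"
    using mod_iso_of_same_kernel[of type_ring "component_module ?P u" h ?F h2 ?F']
      mod_iso_of_same_kernel[of type_ring "component_module ?P u" h2 ?F' h ?F] h(1-3)
    by simp_all
  then show ?thesis by (rule free_plus_fract_unique[OF dvr])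
qed

end

section \<open>Paths inside a block\<close>

lemma up_eq: "up k u = u(k := u k + 1)"
  by (auto simp: lookup_single when_def)

text \<open>From any point of the block one walks to its corner in unit steps that decrease the
  distance. Coordinates in \<open>U\<close> stay nonnegative and the others stay below 0, so no step
  leads from -1 to 0, the only one that \<open>step\<close> leaves out.\<close>

lemma constant_on_block:
  fixes c :: "('n::finite \<Rightarrow> int) \<Rightarrow> 'c"
  assumes step: "\<And>u k. u k \<noteq> -1 \<Longrightarrow> c u = c (up k u)"
  shows "\<exists>x. \<forall>u\<in>block U. c u = x"
proof -
  \<comment> \<open>The corner of the block nearest to the origin.\<close>
  define base where "base k = (if k \<in> U then 0 else -1 :: int)" for k
  have "c u = c base" if "u \<in> block U" for u
    using that
  proof (induction "\<Sum>k\<in>UNIV. nat \<bar>u k - base k\<bar>" arbitrary: u rule: less_induct)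
    case less
    show ?case
    proof (cases "u = base")
      case False
      then obtain k where k: "u k \<noteq> base k" by blast
      have smaller: "(\<Sum>j\<in>UNIV. nat \<bar>(u(k := x)) j - base j\<bar>) < (\<Sum>j\<in>UNIV. nat \<bar>u j - base j\<bar>)"
        if "\<bar>x - base k\<bar> < \<bar>u k - base k\<bar>" for x
        using that by (intro sum_strict_mono_ex1) auto
      show ?thesis
      proof (cases "k \<in> U")
        case True
        then have pos: "u k > 0" using less.prems k by (force simp: block_def base_def)
        let ?u = "u(k := u k - 1)"
        have "c ?u = c base"
          by (rule less.hyps[OF smaller]) (use pos True less.prems in \<open>auto simp: base_def block_def\<close>)
        moreover have "c ?u = c (up k ?u)" by (rule step) (use pos in simp)
        moreover have "up k ?u = u" unfolding up_eq by (simp add: fun_eq_iff)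
        ultimately show ?thesis by simp
      next
        case False
        then have "u k < -1" using less.prems k by (force simp: block_def base_def)
        then have "c (up k u) = c base" unfolding up_eq
          by (intro less.hyps[OF smaller]) (use False less.prems in \<open>auto simp: base_def block_def\<close>)
        then show ?thesis using step[of u k] \<open>u k < -1\<close> by simp
      qed
    qed simp
  qed
  then show ?thesis by blast
qed

theorem theoremA:
  fixes \<pi> :: "'a::idom" and p :: nat
    and I :: "('n::finite, 'a) mpoly set"
    and \<epsilon> :: "('n, 'a) mpoly \<Rightarrow> 'm"
    and E :: "nat \<Rightarrow> (('n, 'a) mpoly, 'm, 'n) graded_module"
    and d :: "nat \<Rightarrow> 'm \<Rightarrow> 'm"
    and i :: nat
    and M :: "(('n, 'a) mpoly, 'm set, 'n) graded_module"
    and a b :: "('n \<Rightarrow> int) \<Rightarrow> nat"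
  assumes "discrete_valuation_ring \<pi>"
    and "adically_complete \<pi>"
    and "mixed_characteristic \<pi> p"
    and "finite (carrier (residue_ring_of \<pi>))"
    and "C_monomial_ideal I"
    and "graded_injective_resolution mpoly_module \<epsilon> E d"
    and "M = local_cohomology I E d i"
    and "\<And>u. mod_iso type_ring
           (quotient_module (component_module M u) (pi_torsion \<pi> (component_module M u)))
           (free_plus_fract (a u) (b u))"
  shows "\<forall>U. (\<exists>c. \<forall>u\<in>block U. a u = c) \<and> (\<exists>c. \<forall>u\<in>block U. b u = c)"
proof -
  interpret resolution \<pi> \<epsilon> E d by (intro resolution.intro assms)
  have "a u = a (up k u) \<and> b u = b (up k u)" if "u k \<noteq> -1" for u k
    by (rule component_eq[where a = a and b = b, OF assms(5)]) (rule assms(8)[unfolded assms(7)], rule that)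
  then show ?thesis using constant_on_block[of a] constant_on_block[of b] by blast
qed

end
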